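(* Let $(\gamma,\nu_1,\nu_2):I\to\mathbb{R}^3\times\Delta$ and $(\tilde\gamma,\tilde\nu_1,\tilde\nu_2):J\to\mathbb{R}^3\times\Delta$ be framed curves with curvatures $(\ell,m,n,\alpha)$ and $(\tilde\ell,\tilde m,\tilde n,\tilde\alpha)$, respectively, and let $T=(t_{ij})$ be their frame matrix. Then the translation surface $\mathbf{x}(u,v)=\gamma(u)+\tilde\gamma(v)$ has a cross cap (an $S_0$ singular point) at $p_0=(u_0,v_0)\in I\times J$ if and only if $\alpha(u_0)\tilde\alpha(v_0)\neq0$, $|t_{33}(p_0)|=1$ and $$m(u_0)\bigl(\tilde m(v_0)t_{21}(p_0)-\tilde n(v_0)t_{11}(p_0)\bigr)+n(u_0)\bigl(\tilde m(v_0)t_{22}(p_0)-\tilde n(v_0)t_{12}(p_0)\bigr)\neq0.$$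
   Context: All maps are $C^\infty$. $I,J\subset\mathbb{R}$ are intervals, with parameters $u\in I$, $v\in J$; subscripts $u,v$ denote derivatives. $S^2$ is the unit sphere in $\mathbb{R}^3$ and $\Delta=\{(a,b)\in S^2\times S^2 : a\cdot b=0\}$. A framed curve is a smooth map $(\gamma,\nu_1,\nu_2):I\to\mathbb{R}^3\times\Delta$ with $\gamma_u\cdot\nu_1=\gamma_u\cdot\nu_2=0$ on $I$. Put $\mu=\nu_1\times\nu_2$. Its curvature is $(\ell,m,n,\alpha)$ with $\ell=\nu_{1u}\cdot\nu_2$, $m=\nu_{1u}\cdot\mu$, $n=\nu_{2u}\cdot\mu$, $\alpha=\gamma_u\cdot\mu$. The same notation with tildes is used for a framed curve on $J$ with parameter $v$. The frame matrix of the two framed curves is $T=(t_{ij}):I\times J\to SO(3)$ determined by $$\begin{pmatrix}\tilde\nu_1(v)\\ \tilde\nu_2(v)\\ \tilde\mu(v)\end{pmatrix}=T(u,v)\begin{pmatrix}\nu_1(u)\\ \nu_2(u)\\ \mu(u)\end{pmatrix}.$$ Two map germs $\mathbb{R}^2\to\mathbb{R}^3$ are $\mathcal{A}$-equivalent if they coincide up to diffeomorphism germs of the source and of the target. A point $p$ is a cross cap ($S_0$ singular point) of $\mathbf{x}$ if the germ of $\mathbf{x}$ at $p$ is $\mathcal{A}$-equivalent to $(u,v)\mapsto(u,uv,v^2)$ at $0$. *)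

theory Defs
  imports "HOL-Analysis.Analysis"
begin

section \<open>Smooth maps\<close>

text \<open>
  \<open>Ck_on k S f\<close>: the map \<open>f\<close> is of class C\<open>\<^sup>k\<close> on \<open>S\<close>. Derivatives are taken within \<open>S\<close> (one-sided
  at an end point of an interval), so the definition is meaningful for those \<open>S\<close> on which such
  derivatives are unique. It is used only for open sets and for nondegenerate intervals.
\<close>

primrec Ck_on :: "nat \<Rightarrow> 'a::euclidean_space set \<Rightarrow> ('a \<Rightarrow> 'b::euclidean_space) \<Rightarrow> bool" where
  "Ck_on 0 S f \<longleftrightarrow> continuous_on S f"
| "Ck_on (Suc k) S f \<longleftrightarrow>
     f differentiable_on S \<and> (\<forall>h. Ck_on k S (\<lambda>x. frechet_derivative f (at x within S) h))"

definition smooth_on :: "'a::euclidean_space set \<Rightarrow> ('a \<Rightarrow> 'b::euclidean_space) \<Rightarrow> bool" where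
  "smooth_on S f \<longleftrightarrow> (\<forall>k. Ck_on k S f)"


section \<open>Equivalence of map germs and cross caps\<close>

definition diffeomorphism_on ::
    "'a::euclidean_space set \<Rightarrow> 'a set \<Rightarrow> ('a \<Rightarrow> 'a) \<Rightarrow> bool" where
  "diffeomorphism_on U V \<phi> \<longleftrightarrow>
     open U \<and> open V \<and>
     (\<exists>\<psi>. homeomorphism U V \<phi> \<psi> \<and> smooth_on U \<phi> \<and> smooth_on V \<psi>)"

text \<open>
  \<open>A_equivalent f p g q\<close>: the germ of \<open>f\<close> at \<open>p\<close> and the germ of \<open>g\<close> at \<open>q\<close> coincide up to a
  diffeomorphism germ \<open>\<phi>\<close> of the source and a diffeomorphism germ \<open>\<Phi>\<close> of the target. Only the
  values of \<open>f\<close> near \<open>p\<close> and of \<open>g\<close> near \<open>q\<close> matter. The condition \<open>f ` U \<subseteq> W\<close> is no restriction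
  for continuous \<open>f\<close>, as \<open>U\<close> can be shrunk.
\<close>

definition A_equivalent ::
    "('a::euclidean_space \<Rightarrow> 'b::euclidean_space) \<Rightarrow> 'a \<Rightarrow> ('a \<Rightarrow> 'b) \<Rightarrow> 'a \<Rightarrow> bool" where
  "A_equivalent f p g q \<longleftrightarrow>
     (\<exists>U V \<phi> W Z \<Phi>.
        diffeomorphism_on U V \<phi> \<and> p \<in> U \<and> \<phi> p = q \<and>
        diffeomorphism_on W Z \<Phi> \<and> f p \<in> W \<and> \<Phi> (f p) = g q \<and>
        f ` U \<subseteq> W \<and> (\<forall>x\<in>U. \<Phi> (f x) = g (\<phi> x)))"

definition cross_cap :: "(real \<times> real \<Rightarrow> real ^ 3) \<Rightarrow> real \<times> real \<Rightarrow> bool" where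
  "cross_cap f p \<longleftrightarrow> A_equivalent f p (\<lambda>(u, v). vector [u, u * v, v\<^sup>2]) (0, 0)"


section \<open>Framed curves\<close>

definition Delta :: "((real ^ 3) \<times> (real ^ 3)) set" where
  "Delta = {(a, b). a \<in> sphere 0 1 \<and> b \<in> sphere 0 1 \<and> a \<bullet> b = 0}"

definition framed_curve ::
    "real set \<Rightarrow> (real \<Rightarrow> real ^ 3) \<Rightarrow> (real \<Rightarrow> real ^ 3) \<Rightarrow> (real \<Rightarrow> real ^ 3) \<Rightarrow> bool" where
  "framed_curve I \<gamma> \<nu>1 \<nu>2 \<longleftrightarrow>
     smooth_on I \<gamma> \<and> smooth_on I \<nu>1 \<and> smooth_on I \<nu>2 \<and>
     (\<forall>u\<in>I. (\<nu>1 u, \<nu>2 u) \<in> Delta \<and>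
        vector_derivative \<gamma> (at u within I) \<bullet> \<nu>1 u = 0 \<and>
        vector_derivative \<gamma> (at u within I) \<bullet> \<nu>2 u = 0)"

definition frame_mu :: "(real \<Rightarrow> real ^ 3) \<Rightarrow> (real \<Rightarrow> real ^ 3) \<Rightarrow> real \<Rightarrow> real ^ 3" where
  "frame_mu \<nu>1 \<nu>2 u = cross3 (\<nu>1 u) (\<nu>2 u)"

definition framed_curvature ::
    "real set \<Rightarrow> (real \<Rightarrow> real ^ 3) \<Rightarrow> (real \<Rightarrow> real ^ 3) \<Rightarrow> (real \<Rightarrow> real ^ 3) \<Rightarrow>
     real \<Rightarrow> real \<times> real \<times> real \<times> real" where
  "framed_curvature I \<gamma> \<nu>1 \<nu>2 u =
     (vector_derivative \<nu>1 (at u within I) \<bullet> \<nu>2 u,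
      vector_derivative \<nu>1 (at u within I) \<bullet> frame_mu \<nu>1 \<nu>2 u,
      vector_derivative \<nu>2 (at u within I) \<bullet> frame_mu \<nu>1 \<nu>2 u,
      vector_derivative \<gamma> (at u within I) \<bullet> frame_mu \<nu>1 \<nu>2 u)"

text \<open>The matrix with rows \<open>\<nu>1 u\<close>, \<open>\<nu>2 u\<close> and \<open>\<mu> u\<close>.\<close>

definition frame :: "(real \<Rightarrow> real ^ 3) \<Rightarrow> (real \<Rightarrow> real ^ 3) \<Rightarrow> real \<Rightarrow> real ^ 3 ^ 3" where
  "frame \<nu>1 \<nu>2 u = vector [\<nu>1 u, \<nu>2 u, frame_mu \<nu>1 \<nu>2 u]"

text \<open>
  The frames are orthonormal, so the equation below determines \<open>T\<close> on \<open>I \<times> J\<close>, and its values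
  there are in SO(3).
\<close>

definition is_frame_matrix ::
    "real set \<Rightarrow> (real \<Rightarrow> real ^ 3) \<Rightarrow> (real \<Rightarrow> real ^ 3) \<Rightarrow>
     real set \<Rightarrow> (real \<Rightarrow> real ^ 3) \<Rightarrow> (real \<Rightarrow> real ^ 3) \<Rightarrow>
     (real \<Rightarrow> real \<Rightarrow> real ^ 3 ^ 3) \<Rightarrow> bool" where
  "is_frame_matrix I \<nu>1 \<nu>2 J \<nu>1' \<nu>2' T \<longleftrightarrow>
     (\<forall>u\<in>I. \<forall>v\<in>J. frame \<nu>1' \<nu>2' v = T u v ** frame \<nu>1 \<nu>2 u)"

definition translation_surface ::
    "(real \<Rightarrow> real ^ 3) \<Rightarrow> (real \<Rightarrow> real ^ 3) \<Rightarrow> real \<times> real \<Rightarrow> real ^ 3" where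
  "translation_surface \<gamma> \<gamma>' = (\<lambda>(u, v). \<gamma> u + \<gamma>' v)"

end

(*
  After a linear change of the target and with the first coordinate taken as parameter, a map of
  corank one has the form (a, P(a,t), Q(a,t)). A Morse lemma with parameter turns Q into b^2, and
  Whitney's theorem on even functions gives P(a,b) = H(a,b^2) + b K(a,b^2). Here H can be removed by
  a diffeomorphism of the target, and K becomes a coordinate of source and target exactly when the
  mixed derivative of P does not vanish. For translation surfaces this says that the velocities are
  parallel and nonzero and that det(gamma', gamma'', delta'') is nonzero. Conversely, the second
  order chain rule shows that this condition is invariant under A-equivalence, and the structure
  equations of the frames translate it into the curvatures and the frame matrix.

  Whitney's theorem needs functions that are smooth on both sides of b^2 = 0. They come from the
  cosine series of a compactly supported even function: cos(k b) is replaced by D(k^2 s), where D is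
  a smooth function on the whole line with all derivatives bounded and D(b^2) = cos b.
*)
theory Submission
  imports Defs
begin

section \<open>Calculus of smooth maps\<close>

text \<open>The analytic obstacle is smoothness of h in e(a, b) = h(a, b^2) across s = 0, uniformly
  in the parameter a. For a series with terms c_k(a) D(k^2 s), a derivative in s brings down k^2,
  and two integrations by parts turn k^2 c_k into minus the coefficient of e_bb. So every derivative
  of such a series is again of this kind, with another even family and another derivative of D, and
  decay 1/k^2 with bounded D suffices at every order. The bounds for s >= 0 come from the equation
  4zy'' + (4j+2)y' + y = 0 satisfied by the j-th derivative of cos(sqrt z); for s < 0 its values
  would be hyperbolic cosines, which a cutoff removes.

  For a translation surface the mixed derivative vanishes identically. In the necessity part this
  isolates the Hessian of the target diffeomorphism, which can then be eliminated from the two pure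
  second derivatives. In the sufficiency part gamma', gamma'', delta'' form a basis, and its dual
  basis supplies linear coordinates of the target.\<close>

lemma frechet_derivative_within_cong:
  assumes "x \<in> S" "\<And>y. y \<in> S \<Longrightarrow> f y = g y"
  shows "frechet_derivative f (at x within S) = frechet_derivative g (at x within S)"
proof -
  have "(f has_derivative D) (at x within S) \<longleftrightarrow> (g has_derivative D) (at x within S)" for D
    using has_derivative_transform[OF assms(1), of g f D] has_derivative_transform[OF assms(1), of f g D] assms(2)
    by auto
  then show ?thesis unfolding frechet_derivative_def by presburger
qed

lemma Ck_on_cong:
  "(\<And>x. x \<in> S \<Longrightarrow> f x = g x) \<Longrightarrow> Ck_on k S f \<longleftrightarrow> Ck_on k S g"
proof (induction k arbitrary: f g)
  case 0
  then show ?case by (simp cong: continuous_on_cong)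
next
  case (Suc k)
  have "f differentiable_on S \<longleftrightarrow> g differentiable_on S"
  proof -
    have "f' differentiable_on S" if eq: "\<And>x. x \<in> S \<Longrightarrow> f' x = g' x" and d: "g' differentiable_on S" for f' g'
      unfolding differentiable_on_def
    proof
      fix x assume "x \<in> S"
      then obtain D where "(g' has_derivative D) (at x within S)"
        using d unfolding differentiable_on_def differentiable_def by blast
      then show "f' differentiable at x within S"
        using has_derivative_transform[OF \<open>x \<in> S\<close>, of f' g'] eq unfolding differentiable_def by blast
    qed
    from this[of f g] this[of g f] show ?thesis using Suc.prems by fastforce
  qed
  moreover have "Ck_on k S (\<lambda>x. frechet_derivative f (at x within S) h)
      \<longleftrightarrow> Ck_on k S (\<lambda>x. frechet_derivative g (at x within S) h)" for h
    using frechet_derivative_within_cong[of _ S f g, OF _ Suc.prems] by (intro Suc.IH) simp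
  ultimately show ?case by simp
qed

lemma Ck_on_SucD: "Ck_on (Suc k) S f \<Longrightarrow> Ck_on k S f"
proof (induction k arbitrary: f)
  case 0
  then show ?case by (simp add: differentiable_imp_continuous_on)
next
  case (Suc k)
  have "f differentiable_on S"
    "\<And>h. Ck_on (Suc k) S (\<lambda>x. frechet_derivative f (at x within S) h)"
    using Suc.prems unfolding Ck_on.simps(2)[of "Suc k"] by (rule conjunct1, metis)
  then show ?case
    using Suc.IH unfolding Ck_on.simps(2)[of k] by metis
qed

lemma Ck_on_imp_continuous_on: "Ck_on k S f \<Longrightarrow> continuous_on S f"
  by (cases k) (simp_all add: differentiable_imp_continuous_on)

lemma Ck_on_has_derivative:
  assumes "Ck_on (Suc k) S f" "open S" "x \<in> S"
  shows "(f has_derivative frechet_derivative f (at x)) (at x)"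
proof -
  have "f differentiable_on S" using assms(1) unfolding Ck_on.simps(2) by (rule conjunct1)
  then have "f differentiable (at x)"
    using assms(2,3) at_within_open[of x S] unfolding differentiable_on_def by auto
  then show ?thesis
    by (rule iffD1[OF frechet_derivative_works])
qed

lemma Ck_on_frechet_derivative:
  assumes "Ck_on (Suc k) S f" "open S"
  shows "Ck_on k S (\<lambda>x. frechet_derivative f (at x) h)"
proof -
  have "Ck_on k S (\<lambda>x. frechet_derivative f (at x within S) h)"
    using assms(1) unfolding Ck_on.simps(2) by (rule conjunct2[THEN spec])
  then show ?thesis
    by (rule iffD1[OF Ck_on_cong, rotated]) (simp add: at_within_open[OF _ assms(2)])
qed

lemma Ck_on_SucI:
  assumes "open S" "\<And>x. x \<in> S \<Longrightarrow> (f has_derivative f' x) (at x)"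
    and "\<And>h. Ck_on k S (\<lambda>x. f' x h)"
  shows "Ck_on (Suc k) S f"
proof -
  have "f differentiable_on S"
    using assms(2) by (meson differentiable_at_withinI differentiable_def differentiable_on_def)
  moreover have "Ck_on k S (\<lambda>x. frechet_derivative f (at x within S) h)" for h
  proof (rule iffD2[OF Ck_on_cong, OF _ assms(3)])
    show "frechet_derivative f (at x within S) h = f' x h" if "x \<in> S" for x
      using frechet_derivative_at[OF assms(2)[OF that]] at_within_open[OF that assms(1)] by simp
  qed
  ultimately show ?thesis unfolding Ck_on.simps(2) by blast
qed

text \<open>At a point of an open subset the derivative within \<open>S\<close> is the ordinary one.
  This is the passage from the interval on which a framed curve is given to its interior, where the
  later calculus takes place.\<close>

lemma Ck_on_interior_subset:
  assumes "Ck_on k S f" "U \<subseteq> S" "open U"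
  shows "Ck_on k U f"
  using assms(1)
proof (induction k arbitrary: f)
  case 0
  then show ?case using assms(2) continuous_on_subset by auto
next
  case (Suc k)
  have at: "at x within S = at x" if "x \<in> U" for x
    using that assms(2,3) by (meson at_within_interior interior_maximal subsetD)
  have "Ck_on k U (\<lambda>x. frechet_derivative f (at x within S) h)" for h
    using Suc by simp
  then have "Ck_on k U (\<lambda>x. frechet_derivative f (at x) h)" for h
    by (rule iffD1[OF Ck_on_cong, rotated]) (simp add: at)
  moreover have "(f has_derivative frechet_derivative f (at x)) (at x)" if "x \<in> U" for x
  proof -
    have "f differentiable (at x within S)" using that Suc.prems assms(2) by (auto simp: differentiable_on_def)
    then show ?thesis using at that by (simp add: frechet_derivative_works)
  qed
  ultimately show ?case by (intro Ck_on_SucI[OF assms(3)]) auto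
qed

text \<open>Serves to glue a cut-off function to its extension by zero.\<close>

lemma Ck_on_local:
  assumes "open S" "\<And>x. x \<in> S \<Longrightarrow> \<exists>U. open U \<and> x \<in> U \<and> Ck_on k U f"
  shows "Ck_on k S f"
  using assms(2)
proof (induction k arbitrary: f)
  case 0
  then show ?case
    using continuous_on_eq_continuous_at assms(1) unfolding Ck_on.simps(1) by metis
next
  case (Suc k)
  show ?case
  proof (rule Ck_on_SucI[OF assms(1)])
    show "(f has_derivative frechet_derivative f (at x)) (at x)" if "x \<in> S" for x
      using Suc.prems[OF that] Ck_on_has_derivative by blast
    show "Ck_on k S (\<lambda>x. frechet_derivative f (at x) h)" for h
    proof (rule Suc.IH)
      fix x assume "x \<in> S"
      then obtain U where "open U" "x \<in> U" "Ck_on (Suc k) U f" using Suc.prems by blast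
      then show "\<exists>U. open U \<and> x \<in> U \<and> Ck_on k U (\<lambda>x. frechet_derivative f (at x) h)"
        using Ck_on_frechet_derivative by blast
    qed
  qed
qed

section \<open>Closure of the class C^k under algebraic operations and composition\<close>

lemma Ck_on_const: "open S \<Longrightarrow> Ck_on k S (\<lambda>x. c)"
proof (induction k arbitrary: c)
  case (Suc k)
  show ?case by (rule Ck_on_SucI[OF Suc.prems, where f' = "\<lambda>_ _. 0"]) (auto intro: Suc)
qed simp

lemma Ck_on_bounded_linear:
  assumes "open S" "bounded_linear L"
  shows "Ck_on k S L"
proof (cases k)
  case 0
  then show ?thesis using assms linear_continuous_on by auto
next
  case (Suc j)
  show ?thesis unfolding Suc
    by (rule Ck_on_SucI[OF assms(1), where f' = "\<lambda>_. L"])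
      (auto intro: bounded_linear_imp_has_derivative assms Ck_on_const)
qed

lemma Ck_on_add:
  assumes "open S" "Ck_on k S f" "Ck_on k S g"
  shows "Ck_on k S (\<lambda>x. f x + g x)"
  using assms(2,3)
proof (induction k arbitrary: f g)
  case 0
  then show ?case by (simp add: continuous_on_add)
next
  case (Suc k)
  show ?case
    by (rule Ck_on_SucI[OF assms(1), where
        f' = "\<lambda>x h. frechet_derivative f (at x) h + frechet_derivative g (at x) h"])
      (use Suc.prems assms(1) in \<open>auto intro!: has_derivative_add Suc.IH
         Ck_on_frechet_derivative Ck_on_has_derivative simp del: Ck_on.simps\<close>)
qed

lemma Ck_on_sum:
  assumes "open S" "\<And>i. i \<in> A \<Longrightarrow> Ck_on k S (f i)"
  shows "Ck_on k S (\<lambda>x. \<Sum>i\<in>A. f i x)"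
  using assms(2)
  by (induction A rule: infinite_finite_induct) (auto intro: Ck_on_const Ck_on_add assms(1))

lemma Ck_on_linear_compose:
  assumes "open S" "bounded_linear L" "Ck_on k S f"
  shows "Ck_on k S (\<lambda>x. L (f x))"
  using assms(3)
proof (induction k arbitrary: f)
  case 0
  then show ?case
    using assms(2) by (auto intro: bounded_linear.continuous_on)
next
  case (Suc k)
  show ?case
    by (rule Ck_on_SucI[OF assms(1), where f' = "\<lambda>x h. L (frechet_derivative f (at x) h)"])
      (use Suc.prems assms(1) in \<open>auto intro!: bounded_linear.has_derivative[OF assms(2)] Suc.IH
         Ck_on_frechet_derivative Ck_on_has_derivative simp del: Ck_on.simps\<close>)
qed

lemma Ck_on_bilinear:
  assumes "open S" "bounded_bilinear B" "Ck_on k S f" "Ck_on k S g"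
  shows "Ck_on k S (\<lambda>x. B (f x) (g x))"
  using assms(3,4)
proof (induction k arbitrary: f g)
  case 0
  then show ?case
    using assms(2) by (auto intro: bounded_bilinear.continuous_on)
next
  case (Suc k)
  show ?case
  proof (rule Ck_on_SucI[OF assms(1)])
    show "((\<lambda>x. B (f x) (g x)) has_derivative
        (\<lambda>h. B (f x) (frechet_derivative g (at x) h) + B (frechet_derivative f (at x) h) (g x))) (at x)"
      if "x \<in> S" for x
      using Suc.prems that assms(1)
      by (auto intro!: bounded_bilinear.FDERIV[OF assms(2)] Ck_on_has_derivative simp del: Ck_on.simps)
    show "Ck_on k S (\<lambda>x. B (f x) (frechet_derivative g (at x) h) +
        B (frechet_derivative f (at x) h) (g x))" for h
      using Suc.prems assms(1)
      by (auto intro!: Ck_on_add Suc.IH Ck_on_frechet_derivative dest: Ck_on_SucD simp del: Ck_on.simps)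
  qed
qed

text \<open>The derivative of the composite in direction h is g'(f x) applied to f'(x) h, a
  direction that moves with x, whereas \<open>Ck_on\<close> speaks of fixed directions only.
  Expanding f'(x) h in the basis leaves products of fixed-direction derivatives, to which the
  induction hypothesis and the product rule apply.\<close>

lemma Ck_on_compose:
  fixes f :: "'a::euclidean_space \<Rightarrow> 'b::euclidean_space" and g :: "'b \<Rightarrow> 'c::euclidean_space"
  assumes "open S" "open T" "f ` S \<subseteq> T" "Ck_on k T g" "Ck_on k S f"
  shows "Ck_on k S (\<lambda>x. g (f x))"
  using assms(4,5)
proof (induction k arbitrary: g)
  case 0
  then show ?case
    using assms(3) continuous_on_compose2 by auto
next
  case (Suc k)
  let ?f' = "\<lambda>x h. frechet_derivative f (at x) h"
  let ?g' = "\<lambda>x h. frechet_derivative g (at x) h"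
  have g': "(g has_derivative ?g' (f x)) (at (f x))" if "x \<in> S" for x
    using Ck_on_has_derivative[OF Suc.prems(1) assms(2), of "f x"] that assms(3) by fast
  have f': "(f has_derivative ?f' x) (at x)" if "x \<in> S" for x
    by (rule Ck_on_has_derivative[OF Suc.prems(2) assms(1) that])
  have eq: "?g' (f x) (?f' x h) = (\<Sum>i\<in>Basis. (?f' x h \<bullet> i) *\<^sub>R ?g' (f x) i)" if "x \<in> S" for x h
  proof -
    interpret linear "?g' (f x)"
      by (rule has_derivative_linear[OF g'[OF that]])
    have "?g' (f x) (\<Sum>i\<in>Basis. (?f' x h \<bullet> i) *\<^sub>R i) = (\<Sum>i\<in>Basis. (?f' x h \<bullet> i) *\<^sub>R ?g' (f x) i)"
      by (simp add: sum scale del: euclidean_representation)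
    then show ?thesis by (simp add: euclidean_representation)
  qed
  show ?case
  proof (rule Ck_on_SucI[OF assms(1)])
    show "((\<lambda>x. g (f x)) has_derivative (\<lambda>h. ?g' (f x) (?f' x h))) (at x)" if "x \<in> S" for x
      by (rule has_derivative_compose[OF f'[OF that] g'[OF that]])
    have sum: "Ck_on k S (\<lambda>x. \<Sum>i\<in>Basis. (?f' x h \<bullet> i) *\<^sub>R ?g' (f x) i)" for h
    proof (intro Ck_on_sum assms(1))
      fix i :: 'b
      have 1: "Ck_on k S (\<lambda>x. ?g' (f x) i)"
        by (rule Suc.IH[OF Ck_on_frechet_derivative[OF Suc.prems(1) assms(2)] Ck_on_SucD[OF Suc.prems(2)]])
      have 2: "Ck_on k S (\<lambda>x. ?f' x h \<bullet> i)"
        by (rule Ck_on_linear_compose[OF assms(1) bounded_linear_inner_left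
              Ck_on_frechet_derivative[OF Suc.prems(2) assms(1)]])
      show "Ck_on k S (\<lambda>x. (?f' x h \<bullet> i) *\<^sub>R ?g' (f x) i)"
        by (rule Ck_on_bilinear[OF assms(1) bounded_bilinear_scaleR 2 1])
    qed
    show "Ck_on k S (\<lambda>x. ?g' (f x) (?f' x h))" for h
      by (rule iffD2[OF Ck_on_cong sum]) (rule eq)
  qed
qed

lemma smooth_on_cong:
  "(\<And>x. x \<in> S \<Longrightarrow> f x = g x) \<Longrightarrow> smooth_on S f \<longleftrightarrow> smooth_on S g"
  unfolding smooth_on_def using Ck_on_cong by blast

lemma smooth_on_imp_continuous_on: "smooth_on S f \<Longrightarrow> continuous_on S f"
  unfolding smooth_on_def using Ck_on_imp_continuous_on by blast

lemma smooth_on_subset: "smooth_on S f \<Longrightarrow> U \<subseteq> S \<Longrightarrow> open U \<Longrightarrow> smooth_on U f"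
  unfolding smooth_on_def using Ck_on_interior_subset by blast

lemma smooth_on_local:
  "open S \<Longrightarrow> (\<And>x. x \<in> S \<Longrightarrow> \<exists>U. open U \<and> x \<in> U \<and> smooth_on U f) \<Longrightarrow> smooth_on S f"
  unfolding smooth_on_def using Ck_on_local by (metis (no_types, lifting))

lemma smooth_on_has_derivative:
  "smooth_on S f \<Longrightarrow> open S \<Longrightarrow> x \<in> S \<Longrightarrow> (f has_derivative frechet_derivative f (at x)) (at x)"
  unfolding smooth_on_def using Ck_on_has_derivative by blast

lemma smooth_on_frechet_derivative:
  "smooth_on S f \<Longrightarrow> open S \<Longrightarrow> smooth_on S (\<lambda>x. frechet_derivative f (at x) h)"
  unfolding smooth_on_def using Ck_on_frechet_derivative by blast

text \<open>Suited to functions given by a formula whose derivatives follow the same pattern: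
  \<open>P\<close> is chosen as the whole family, here the integrals depending on a parameter. The
  real version below serves \<open>flat_exp\<close>, \<open>cos_root\<close> and the combinations of
  sine and cosine.\<close>

lemma smooth_on_coinduct:
  assumes "P f" "open S"
    and step: "\<And>f. P f \<Longrightarrow> \<exists>f'. (\<forall>x\<in>S. (f has_derivative f' x) (at x)) \<and> (\<forall>h. P (\<lambda>x. f' x h))"
  shows "smooth_on S f"
proof -
  have "P f \<Longrightarrow> Ck_on k S f" for k f
  proof (induction k arbitrary: f)
    case 0
    obtain f' where "\<forall>x\<in>S. (f has_derivative f' x) (at x)" using step[OF 0] by blast
    then show ?case
      unfolding Ck_on.simps(1) using has_derivative_continuous continuous_at_imp_continuous_on by blast
  next
    case (Suc k)
    obtain f' where f': "\<forall>x\<in>S. (f has_derivative f' x) (at x)" "\<forall>h. P (\<lambda>x. f' x h)"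
      using step[OF Suc.prems] by blast
    show ?case
      by (rule Ck_on_SucI[OF assms(2), of f f']) (use f' Suc.IH in auto)
  qed
  then show ?thesis using assms(1) unfolding smooth_on_def by blast
qed

lemma smooth_on_const: "open S \<Longrightarrow> smooth_on S (\<lambda>x. c)"
  unfolding smooth_on_def using Ck_on_const by blast

lemma smooth_on_bounded_linear: "open S \<Longrightarrow> bounded_linear L \<Longrightarrow> smooth_on S L"
  unfolding smooth_on_def using Ck_on_bounded_linear by blast

lemma smooth_on_add: "open S \<Longrightarrow> smooth_on S f \<Longrightarrow> smooth_on S g \<Longrightarrow> smooth_on S (\<lambda>x. f x + g x)"
  unfolding smooth_on_def using Ck_on_add by blast

lemma smooth_on_linear_compose:
  "open S \<Longrightarrow> bounded_linear L \<Longrightarrow> smooth_on S f \<Longrightarrow> smooth_on S (\<lambda>x. L (f x))"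
  unfolding smooth_on_def using Ck_on_linear_compose by blast

lemma smooth_on_bilinear:
  "open S \<Longrightarrow> bounded_bilinear B \<Longrightarrow> smooth_on S f \<Longrightarrow> smooth_on S g \<Longrightarrow> smooth_on S (\<lambda>x. B (f x) (g x))"
  unfolding smooth_on_def using Ck_on_bilinear by blast

lemma smooth_on_compose:
  "open S \<Longrightarrow> open T \<Longrightarrow> f ` S \<subseteq> T \<Longrightarrow> smooth_on T g \<Longrightarrow> smooth_on S f \<Longrightarrow> smooth_on S (\<lambda>x. g (f x))"
  unfolding smooth_on_def using Ck_on_compose by blast

lemma smooth_on_minus: "open S \<Longrightarrow> smooth_on S f \<Longrightarrow> smooth_on S (\<lambda>x. - f x)"
  by (rule smooth_on_linear_compose[OF _ bounded_linear_minus[OF bounded_linear_ident]])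

lemma smooth_on_diff:
  "open S \<Longrightarrow> smooth_on S f \<Longrightarrow> smooth_on S g \<Longrightarrow> smooth_on S (\<lambda>x. f x - g x)"
  using smooth_on_add[of S f "\<lambda>x. - g x"] smooth_on_minus by auto

lemma smooth_on_mult:
  "open S \<Longrightarrow> smooth_on S f \<Longrightarrow> smooth_on S g \<Longrightarrow> smooth_on S (\<lambda>x. f x * g x :: real)"
  by (rule smooth_on_bilinear[OF _ bounded_bilinear_mult])

lemma smooth_on_power: "open S \<Longrightarrow> smooth_on S f \<Longrightarrow> smooth_on S (\<lambda>x. (f x :: real) ^ i)"
  by (induction i) (auto intro: smooth_on_const smooth_on_mult)

lemma smooth_on_scaleR:
  "open S \<Longrightarrow> smooth_on S f \<Longrightarrow> smooth_on S g \<Longrightarrow> smooth_on S (\<lambda>x. f x *\<^sub>R g x)"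
  by (rule smooth_on_bilinear[OF _ bounded_bilinear_scaleR])

lemma smooth_on_Pair:
  assumes "open S" "smooth_on S f" "smooth_on S g"
  shows "smooth_on S (\<lambda>x. (f x, g x))"
proof -
  have "smooth_on S (\<lambda>x. (f x, 0) + (0, g x))"
    by (intro smooth_on_add assms smooth_on_linear_compose[where L = "\<lambda>y. (y, 0)"]
        smooth_on_linear_compose[where L = "\<lambda>y. (0, y)"] bounded_linear_Pair
        bounded_linear_ident bounded_linear_zero)
  then show ?thesis by simp
qed

lemma smooth_on_ident: "open S \<Longrightarrow> smooth_on S (\<lambda>x. x)"
  by (rule smooth_on_bounded_linear[OF _ bounded_linear_ident])

lemma smooth_on_fst: "open S \<Longrightarrow> smooth_on S f \<Longrightarrow> smooth_on S (\<lambda>x. fst (f x))"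
  by (rule smooth_on_linear_compose[OF _ bounded_linear_fst])

lemma smooth_on_snd: "open S \<Longrightarrow> smooth_on S f \<Longrightarrow> smooth_on S (\<lambda>x. snd (f x))"
  by (rule smooth_on_linear_compose[OF _ bounded_linear_snd])

lemma smooth_on_vec_nth: "open S \<Longrightarrow> smooth_on S f \<Longrightarrow> smooth_on S (\<lambda>x. (f x :: real^'n) $ i)"
  by (rule smooth_on_linear_compose[OF _ bounded_linear_vec_nth])

lemma smooth_on_vec3:
  assumes "open S" "smooth_on S f" "smooth_on S g" "smooth_on S h"
  shows "smooth_on S (\<lambda>x. vector [f x, g x, h x] :: real^3)"
proof -
  have *: "vector [p, q, r] = p *\<^sub>R axis 1 1 + q *\<^sub>R axis 2 1 + r *\<^sub>R (axis 3 1 :: real^3)" for p q r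
    by (simp add: vec_eq_iff forall_3 axis_def)
  show ?thesis unfolding *
    by (intro smooth_on_add smooth_on_scaleR smooth_on_const assms)
qed

lemmas smooth_intros = smooth_on_Pair smooth_on_fst smooth_on_snd smooth_on_add smooth_on_diff smooth_on_minus
  smooth_on_mult smooth_on_scaleR smooth_on_power smooth_on_vec_nth smooth_on_vec3 smooth_on_ident smooth_on_const

section \<open>Real functions of one variable, reciprocals and square roots\<close>

lemma Ck_on_has_real_derivative:
  fixes f :: "real \<Rightarrow> real"
  assumes "open S" "\<And>x. x \<in> S \<Longrightarrow> (f has_real_derivative g x) (at x)" "Ck_on k S g"
  shows "Ck_on (Suc k) S f"
proof (rule Ck_on_SucI[OF assms(1)])
  show "(f has_derivative (\<lambda>h. g x * h)) (at x)" if "x \<in> S" for x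
    using assms(2)[OF that] by (simp add: has_field_derivative_def)
  show "Ck_on k S (\<lambda>x. g x * h)" for h
    by (rule Ck_on_linear_compose[OF assms(1) bounded_linear_mult_left assms(3)])
qed

lemma smooth_on_coinduct_real:
  fixes f :: "real \<Rightarrow> real"
  assumes "P f" "open S"
    and step: "\<And>f. P f \<Longrightarrow> \<exists>g. (\<forall>x\<in>S. (f has_real_derivative g x) (at x)) \<and> P g"
  shows "smooth_on S f"
proof -
  have "P f \<Longrightarrow> Ck_on k S f" for k f
  proof (induction k arbitrary: f)
    case 0
    obtain g where "\<forall>x\<in>S. (f has_real_derivative g x) (at x)" using step[OF 0] by blast
    then show ?case
      unfolding Ck_on.simps(1) using DERIV_isCont continuous_at_imp_continuous_on by blast
  next
    case (Suc k)
    obtain g where g: "\<forall>x\<in>S. (f has_real_derivative g x) (at x)" "P g"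
      using step[OF Suc.prems] by blast
    show ?case
      by (rule Ck_on_has_real_derivative[OF assms(2) _ Suc.IH[OF g(2)]]) (use g in auto)
  qed
  then show ?thesis using assms(1) unfolding smooth_on_def by blast
qed

text \<open>The derivative is a polynomial in the function itself, so each order of
  differentiability yields the next one.\<close>

lemma smooth_on_real_inverse: "smooth_on (- {0}) (inverse :: real \<Rightarrow> real)"
proof -
  have S: "open (- {0::real})" by auto
  have "Ck_on k (- {0}) (inverse :: real \<Rightarrow> real)" for k
  proof (induction k)
    case 0
    show ?case by (auto intro!: continuous_intros)
  next
    case (Suc k)
    show ?case
    proof (rule Ck_on_has_real_derivative[OF S])
      show "(inverse has_real_derivative - 1 * (inverse x * inverse x)) (at x)" if "x \<in> - {0}" for x :: real
        using that by (auto intro!: derivative_eq_intros simp: power2_eq_square)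
      show "Ck_on k (- {0::real}) (\<lambda>x. - 1 * (inverse x * inverse x))"
        by (intro Ck_on_bilinear[OF _ bounded_bilinear_mult] S Ck_on_const Suc)
    qed
  qed
  then show ?thesis by (simp add: smooth_on_def)
qed

lemma smooth_on_inverse:
  fixes f :: "'a::euclidean_space \<Rightarrow> real"
  assumes "open S" "smooth_on S f" "\<And>x. x \<in> S \<Longrightarrow> f x \<noteq> 0"
  shows "smooth_on S (\<lambda>x. inverse (f x))"
  by (rule smooth_on_compose[OF assms(1) _ _ smooth_on_real_inverse assms(2)]) (use assms(3) in auto)

lemma smooth_on_divide:
  fixes f :: "'a::euclidean_space \<Rightarrow> real"
  assumes "open S" "smooth_on S f" "smooth_on S g" "\<And>x. x \<in> S \<Longrightarrow> g x \<noteq> 0"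
  shows "smooth_on S (\<lambda>x. f x / g x)"
  unfolding divide_inverse by (intro smooth_on_mult smooth_on_inverse assms)

text \<open>The same bootstrap as for the reciprocal: the derivative is half the reciprocal of the
  function.\<close>

lemma smooth_on_real_sqrt: "smooth_on {0<..} sqrt"
proof -
  have S: "open {0::real<..}" by auto
  have "Ck_on k {0<..} sqrt" for k
  proof (induction k)
    case 0
    show ?case by (auto intro!: continuous_intros)
  next
    case (Suc k)
    show ?case
    proof (rule Ck_on_has_real_derivative[OF S])
      show "(sqrt has_real_derivative (inverse (sqrt x) * (1/2))) (at x)" if "x \<in> {0<..}" for x
        using that by (auto intro!: derivative_eq_intros)
      have "Ck_on k {0<..} (\<lambda>x. inverse (sqrt x))"
        by (rule Ck_on_compose[OF S _ _ _ Suc, of "- {0}"])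
          (use smooth_on_real_inverse in \<open>auto simp: smooth_on_def\<close>)
      then show "Ck_on k {0<..} (\<lambda>x. inverse (sqrt x) * (1/2))"
        by (intro Ck_on_bilinear[OF _ bounded_bilinear_mult] S Ck_on_const)
    qed
  qed
  then show ?thesis by (simp add: smooth_on_def)
qed

lemma smooth_on_sqrt:
  assumes "open S" "smooth_on S f" "\<And>x. x \<in> S \<Longrightarrow> f x > 0"
  shows "smooth_on S (\<lambda>x. sqrt (f x))"
  by (rule smooth_on_compose[OF assms(1) _ _ smooth_on_real_sqrt assms(2)]) (use assms(3) in auto)

section \<open>Inverse functions in the plane\<close>

text \<open>Cramer's rule: \<open>R\<close> is the adjugate divided by the determinant. The explicit
  formula later shows that the inverse depends smoothly on the entries.\<close>

lemma plane_linear_inverse: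
  fixes D :: "real \<times> real \<Rightarrow> real \<times> real"
  assumes "linear D"
    and j: "J = fst (D (1, 0)) * snd (D (0, 1)) - fst (D (0, 1)) * snd (D (1, 0))" "J \<noteq> 0"
  defines "R \<equiv> \<lambda>k. ((snd (D (0, 1)) * fst k - fst (D (0, 1)) * snd k) / J,
                   (fst (D (1, 0)) * snd k - snd (D (1, 0)) * fst k) / J)"
  shows "R (D h) = h" and "D (R k) = k"
proof -
  interpret linear D by fact
  have D: "D h = (fst (D (1, 0)) * fst h + fst (D (0, 1)) * snd h,
      snd (D (1, 0)) * fst h + snd (D (0, 1)) * snd h)" for h
  proof -
    have "D h = D (fst h *\<^sub>R (1, 0) + snd h *\<^sub>R (0, 1))" by (cases h) simp
    also have "\<dots> = fst h *\<^sub>R D (1, 0) + snd h *\<^sub>R D (0, 1)" by (simp only: add scale)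
    finally show ?thesis by (simp add: prod_eq_iff)
  qed
  define a b c d where "a = fst (D (1, 0))" and "b = fst (D (0, 1))"
    and "c = snd (D (1, 0))" and "d = snd (D (0, 1))"
  note D' = D[folded a_def b_def c_def d_def]
  have j': "a * d - b * c \<noteq> 0" using j(2) unfolding j(1) by (simp add: a_def b_def c_def d_def)
  have R: "R k = ((d * fst k - b * snd k) / (a * d - b * c), (a * snd k - c * fst k) / (a * d - b * c))" for k
    by (simp add: R_def j(1) a_def b_def c_def d_def)
  show "R (D h) = h"
    unfolding R D'[of h] using j' by (cases h) (simp add: field_simps)
  show "D (R k) = k"
    unfolding D'[of "R k"] unfolding R using j'
    by (cases k) (simp add: divide_simps, simp add: algebra_simps)
qed

text \<open>The C^1 inverse function theorem provides a differentiable local inverse g. Its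
  derivative is the inverse of F' at g(y), hence by Cramer's rule a smooth function of g(y), and
  this raises the smoothness of g order by order.\<close>

theorem plane_inverse_function:
  fixes F :: "real \<times> real \<Rightarrow> real \<times> real"
  assumes S: "open S" "smooth_on S F" "p \<in> S"
    and D: "(F has_derivative D) (at p)"
    and j: "fst (D (1, 0)) * snd (D (0, 1)) - fst (D (0, 1)) * snd (D (1, 0)) \<noteq> 0"
  obtains U V where "diffeomorphism_on U V F" "p \<in> U" "U \<subseteq> S"
proof -
  define F' where "F' = (\<lambda>x. frechet_derivative F (at x))"
  have F': "(F has_derivative F' x) (at x)" if "x \<in> S" for x
    unfolding F'_def by (rule smooth_on_has_derivative[OF S(2,1) that])
  have sF': "smooth_on S (\<lambda>x. F' x h)" for h
    unfolding F'_def by (rule smooth_on_frechet_derivative[OF S(2,1)])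
  define J where "J = (\<lambda>x. fst (F' x (1, 0)) * snd (F' x (0, 1)) - fst (F' x (0, 1)) * snd (F' x (1, 0)))"
  have sJ: "smooth_on S J"
    unfolding J_def by (intro smooth_intros S(1) sF')
  \<comment> \<open>The Jacobian is kept nonzero on the whole domain, so that the derivative of the
    inverse is given by \<open>R\<close> at every point of the image and not only at F(p).\<close>
  define T where "T = {x \<in> S. J x \<noteq> 0}"
  have T: "open T" "T \<subseteq> S"
  proof -
    have "open (S \<inter> J -` (- {0}))"
      by (rule continuous_open_preimage[OF smooth_on_imp_continuous_on[OF sJ] S(1)]) auto
    moreover have "T = S \<inter> J -` (- {0})" by (auto simp: T_def)
    ultimately show "open T" "T \<subseteq> S" by auto
  qed
  have "F' p = D"
    using has_derivative_unique[OF F'[OF S(3)] D] .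
  then have pT: "p \<in> T" using j S(3) by (simp add: T_def J_def)
  have lin: "linear (F' x)" if "x \<in> T" for x
    using has_derivative_linear[OF F'] that T(2) by blast
  define R where "R = (\<lambda>x k. ((snd (F' x (0, 1)) * fst k - fst (F' x (0, 1)) * snd k) / J x,
                   (fst (F' x (1, 0)) * snd k - snd (F' x (1, 0)) * fst k) / J x))"
  have R: "R x (F' x h) = h" "F' x (R x k) = k" if "x \<in> T" for x h k
    using plane_linear_inverse[OF lin[OF that] refl] that unfolding T_def J_def R_def by blast+
  have blF: "bounded_linear (F' x)" if "x \<in> T" for x
    using has_derivative_bounded_linear[OF F'] that T(2) by blast
  have blR: "bounded_linear (R x)" if "x \<in> T" for x
  proof -
    have "linear (R x)"
      unfolding R_def by (rule linearI) (simp_all add: algebra_simps add_divide_distrib diff_divide_distrib)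
    then show ?thesis by (rule linear_conv_bounded_linear[THEN iffD1])
  qed
  \<comment> \<open>The derivative must depend continuously on the point as an operator; in finite
    dimension it is enough to check this on fixed vectors.\<close>
  have "continuous_on T (\<lambda>x. Blinfun (F' x))"
  proof (rule continuous_on_blinfun_componentwise)
    fix i :: "real \<times> real"
    have "continuous_on T (\<lambda>x. F' x i)"
      using smooth_on_imp_continuous_on[OF sF'] T(2) continuous_on_subset by blast
    then show "continuous_on T (\<lambda>x. blinfun_apply (Blinfun (F' x)) i)"
      by (rule continuous_on_eq) (simp add: bounded_linear_Blinfun_apply blF)
  qed
  moreover have "Blinfun (R p) o\<^sub>L Blinfun (F' p) = id_blinfun"
    by (rule blinfun_eqI) (simp add: bounded_linear_Blinfun_apply blF blR pT R)
  moreover have "(F has_derivative blinfun_apply (Blinfun (F' x))) (at x)" if "x \<in> T" for x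
    unfolding bounded_linear_Blinfun_apply[OF blF[OF that]] using F' T(2) that by blast
  ultimately obtain U V g g' where UV: "open U" "U \<subseteq> T" "p \<in> U" "open V" "homeomorphism U V F g"
    and g: "\<And>y. y \<in> V \<Longrightarrow> (g has_derivative g' y) (at y)"
      "\<And>y. y \<in> V \<Longrightarrow> g' y = inv (blinfun_apply (Blinfun (F' (g y))))"
    using inverse_function_theorem[OF T(1) _ _ pT, where f = F and f' = "\<lambda>x. Blinfun (F' x)"] by metis
  have gV: "g y \<in> T" if "y \<in> V" for y
    using UV that unfolding homeomorphism_def by blast
  have g': "g' y k = R (g y) k" if "y \<in> V" for y k
  proof -
    have "inj (F' (g y))" using R(1)[OF gV[OF that]] by (metis injI)
    then have "inv (F' (g y)) (F' (g y) (R (g y) k)) = R (g y) k" by (rule inv_f_f)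
    then show ?thesis
      using g(2)[OF that] R(2)[OF gV[OF that]] by (simp add: bounded_linear_Blinfun_apply blF gV that)
  qed
  have "smooth_on T (\<lambda>x. R x k)" for k
    unfolding R_def
    by (intro smooth_intros smooth_on_divide T(1) smooth_on_subset[OF sF' T(2,1)] smooth_on_subset[OF sJ T(2,1)])
      (auto simp: T_def)
  then have sR: "Ck_on k T (\<lambda>x. R x h)" for k h by (simp add: smooth_on_def)
  \<comment> \<open>By \<open>g'\<close>, the derivative of g in direction h is the smooth map x ->
    R x h composed with g, so it is as smooth as g itself.\<close>
  have "Ck_on k V g" for k
  proof (induction k)
    case 0
    then show ?case using UV(5) by (simp add: homeomorphism_def)
  next
    case (Suc k)
    show ?case
    proof (rule Ck_on_SucI[OF UV(4) g(1)])
      show "Ck_on k V (\<lambda>y. g' y h)" for h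
        by (rule iffD2[OF Ck_on_cong Ck_on_compose[OF UV(4) T(1) _ sR Suc]]) (use g' gV in auto)
    qed
  qed
  then have "smooth_on V g" by (simp add: smooth_on_def)
  moreover have "smooth_on U F" using smooth_on_subset[OF S(2)] UV T(2) by blast
  ultimately have "diffeomorphism_on U V F"
    unfolding diffeomorphism_on_def using UV by blast
  then show thesis using that UV T(2) by blast
qed

section \<open>Integrals with a parameter\<close>

text \<open>Leibniz's rule, applied on a ball because it asks for a convex parameter set. The
  integrand is differentiated in the parameter only, hence the direction (h, 0).\<close>

lemma has_derivative_parametric_integral:
  fixes G :: "'a::euclidean_space \<times> real \<Rightarrow> 'b::euclidean_space"
  assumes "open U" "open W" "U \<times> {a..b} \<subseteq> W" "smooth_on W G" "x \<in> U"
  shows "((\<lambda>x. integral {a..b} (\<lambda>t. G (x, t))) has_derivative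
      (\<lambda>h. integral {a..b} (\<lambda>t. frechet_derivative G (at (x, t)) (h, 0)))) (at x)"
proof -
  obtain e where e: "e > 0" "ball x e \<subseteq> U" using assms(1,5) openE by blast
  define B where "B = ball x e"
  have B: "open B" "convex B" "x \<in> B" "B \<times> {a..b} \<subseteq> W" using e assms(3) by (auto simp: B_def)
  define G' where "G' = (\<lambda>p h. frechet_derivative G (at p) (h, 0))"
  have dG: "((\<lambda>y. G (y, t)) has_derivative G' (y, t)) (at y)" if "y \<in> B" "t \<in> {a..b}" for y t
  proof -
    have "(G has_derivative frechet_derivative G (at (y, t))) (at (y, t))"
      by (rule smooth_on_has_derivative[OF assms(4,2)]) (use B(4) that in auto)
    moreover have "((\<lambda>y. (y, t)) has_derivative (\<lambda>h. (h, 0))) (at y)"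
      by (auto intro!: derivative_eq_intros)
    ultimately show ?thesis unfolding G'_def by (rule has_derivative_compose[rotated])
  qed
  have cG': "continuous_on (B \<times> {a..b}) (\<lambda>p. G' p h)" for h
    unfolding G'_def
    by (rule continuous_on_subset[OF smooth_on_imp_continuous_on[OF smooth_on_frechet_derivative[OF assms(4,2)]] B(4)])
  have bl: "bounded_linear (G' p)" if "p \<in> B \<times> {a..b}" for p
    using has_derivative_bounded_linear[OF dG] that by force
  have cF: "continuous_on (B \<times> {a..b}) (\<lambda>p. Blinfun (G' p))"
  proof (rule continuous_on_blinfun_componentwise)
    show "continuous_on (B \<times> {a..b}) (\<lambda>p. blinfun_apply (Blinfun (G' p)) i)" for i
      by (rule continuous_on_eq[OF cG'[of i]]) (simp add: bounded_linear_Blinfun_apply bl)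
  qed
  have "((\<lambda>y. integral (cbox a b) (\<lambda>t. G (y, t))) has_derivative
      integral (cbox a b) (\<lambda>t. Blinfun (G' (x, t)))) (at x within B)"
  proof (rule leibniz_rule)
    show "((\<lambda>y. G (y, t)) has_derivative blinfun_apply (Blinfun (G' (y, t)))) (at y within B)"
      if "y \<in> B" "t \<in> cbox a b" for y t
    proof -
      have "blinfun_apply (Blinfun (G' (y, t))) = G' (y, t)"
        by (rule bounded_linear_Blinfun_apply[OF bl]) (use that in auto)
      then show ?thesis using has_derivative_at_withinI[OF dG[of y t]] that by simp
    qed
    show "(\<lambda>t. G (y, t)) integrable_on cbox a b" if "y \<in> B" for y
    proof (rule integrable_continuous, rule continuous_on_compose2[OF smooth_on_imp_continuous_on[OF assms(4)]])
      show "continuous_on (cbox a b) (\<lambda>t. (y, t))" by (intro continuous_intros)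
      show "Pair y ` cbox a b \<subseteq> W" using that B(4) by auto
    qed
    show "continuous_on (B \<times> cbox a b) (\<lambda>(y, t). Blinfun (G' (y, t)))"
      using cF unfolding case_prod_unfold prod.collapse box_real .
  qed (fact B(3), fact B(2))
  then have D: "((\<lambda>y. integral {a..b} (\<lambda>t. G (y, t))) has_derivative
      integral {a..b} (\<lambda>t. Blinfun (G' (x, t)))) (at x)"
    unfolding at_within_open[OF B(3,1)] box_real .
  have "blinfun_apply (integral {a..b} (\<lambda>t. Blinfun (G' (x, t)))) h = integral {a..b} (\<lambda>t. G' (x, t) h)" for h
  proof -
    have "continuous_on {a..b} (\<lambda>t. Blinfun (G' (x, t)))"
    proof (rule continuous_on_compose2[OF cF])
      show "continuous_on {a..b} (\<lambda>t. (x, t))" by (intro continuous_intros)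
    qed (use B(3) in auto)
    then have "(\<lambda>t. Blinfun (G' (x, t))) integrable_on {a..b}"
      by (rule integrable_continuous_real)
    from integral_linear[OF this blinfun.bounded_linear_left, of h]
    have "blinfun_apply (integral {a..b} (\<lambda>t. Blinfun (G' (x, t)))) h
        = integral {a..b} (\<lambda>t. blinfun_apply (Blinfun (G' (x, t))) h)" by (simp add: o_def)
    also have "\<dots> = integral {a..b} (\<lambda>t. G' (x, t) h)"
      by (rule integral_cong) (simp add: bounded_linear_Blinfun_apply bl B(3))
    finally show ?thesis .
  qed
  then have "blinfun_apply (integral {a..b} (\<lambda>t. Blinfun (G' (x, t)))) = (\<lambda>h. integral {a..b} (\<lambda>t. G' (x, t) h))"
    by blast
  with D show ?thesis unfolding G'_def by simp
qed

text \<open>A derivative in the parameter replaces the integrand by another smooth function on the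
  same \<open>W\<close>, so these integrals form a class closed under differentiation.\<close>

lemma smooth_on_parametric_integral:
  fixes G :: "'a::euclidean_space \<times> real \<Rightarrow> 'b::euclidean_space"
  assumes "open U" "open W" "U \<times> {a..b} \<subseteq> W" "smooth_on W G"
  shows "smooth_on U (\<lambda>x. integral {a..b} (\<lambda>t. G (x, t)))"
proof (rule smooth_on_coinduct[where P = "\<lambda>f. \<exists>G. smooth_on W G \<and> f = (\<lambda>x. integral {a..b} (\<lambda>t. G (x, t)))"])
  show "\<exists>G'. smooth_on W G' \<and> (\<lambda>x. integral {a..b} (\<lambda>t. G (x, t))) = (\<lambda>x. integral {a..b} (\<lambda>t. G' (x, t)))"
    using assms(4) by blast
next
  fix f :: "'a \<Rightarrow> 'b"
  assume "\<exists>G. smooth_on W G \<and> f = (\<lambda>x. integral {a..b} (\<lambda>t. G (x, t)))"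
  then obtain G where G: "smooth_on W G" "f = (\<lambda>x. integral {a..b} (\<lambda>t. G (x, t)))" by blast
  show "\<exists>f'. (\<forall>x\<in>U. (f has_derivative f' x) (at x)) \<and>
      (\<forall>h. \<exists>G. smooth_on W G \<and> (\<lambda>x. f' x h) = (\<lambda>x. integral {a..b} (\<lambda>t. G (x, t))))"
  proof (intro exI[of _ "\<lambda>x h. integral {a..b} (\<lambda>t. frechet_derivative G (at (x, t)) (h, 0))"] conjI ballI allI)
    show "(f has_derivative (\<lambda>h. integral {a..b} (\<lambda>t. frechet_derivative G (at (x, t)) (h, 0)))) (at x)"
      if "x \<in> U" for x
      unfolding G(2) by (rule has_derivative_parametric_integral[OF assms(1-3) G(1) that])
    show "\<exists>G'. smooth_on W G' \<and> (\<lambda>x. integral {a..b} (\<lambda>t. frechet_derivative G (at (x, t)) (h, 0))) =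
        (\<lambda>x. integral {a..b} (\<lambda>t. G' (x, t)))" for h
      by (rule exI[of _ "\<lambda>p. frechet_derivative G (at p) (h, 0)"])
        (auto intro: smooth_on_frechet_derivative[OF G(1) assms(2)])
  qed
qed (rule assms(1))

text \<open>The quotient is k(a, r) = integral over t in [0, 1] of q_r(a, t r), by the fundamental
  theorem along the segment from (a, 0) to (a, r); \<open>US\<close> keeps that segment inside
  \<open>S\<close>. At r = 0 the integrand is constant, which gives the value of k there.\<close>

lemma Hadamard_lemma:
  fixes q :: "real \<times> real \<Rightarrow> real"
  assumes "open S" "smooth_on S q" "open U"
    and US: "\<And>a r t. (a, r) \<in> U \<Longrightarrow> t \<in> {0..1} \<Longrightarrow> (a, t * r) \<in> S"
  obtains k where "smooth_on U k"
    "\<And>a r. (a, r) \<in> U \<Longrightarrow> q (a, r) = q (a, 0) + r * k (a, r)"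
    "\<And>a r. (a, r) \<in> U \<Longrightarrow> k (a, 0) = frechet_derivative q (at (a, 0)) (0, 1)"
proof
  define q' where "q' = (\<lambda>p. frechet_derivative q (at p) (0, 1))"
  define k where "k = (\<lambda>p. integral {0..1} (\<lambda>t. q' (fst p, t * snd p)))"
  \<comment> \<open>The integrand is q_r composed with \<open>m\<close>, and the preimage of
    \<open>S\<close> under \<open>m\<close> is an open neighbourhood of U x [0, 1] on which it is
    smooth.\<close>
  define m where "m = (\<lambda>z :: (real \<times> real) \<times> real. (fst (fst z), snd z * snd (fst z)))"
  define W where "W = m -` S"
  have "continuous_on UNIV m"
    unfolding m_def by (intro continuous_intros)
  then have W: "open W"
    unfolding W_def using assms(1) by (intro open_vimage)
  have sq': "smooth_on S q'" unfolding q'_def by (rule smooth_on_frechet_derivative[OF assms(2,1)])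
  have sm: "smooth_on W m"
    unfolding m_def by (intro smooth_intros W)
  have "smooth_on W (\<lambda>z. q' (m z))"
    by (rule smooth_on_compose[OF W assms(1) _ sq' sm]) (auto simp: W_def)
  moreover have "U \<times> {0..1} \<subseteq> W"
    using US by (auto simp: m_def W_def)
  ultimately have "smooth_on U (\<lambda>p. integral {0..1} (\<lambda>t. q' (m (p, t))))"
    using smooth_on_parametric_integral[OF assms(3) W] by blast
  then show "smooth_on U k"
    by (simp add: k_def m_def)
  show "q (a, r) = q (a, 0) + r * k (a, r)" if "(a, r) \<in> U" for a r
  proof -
    have "((\<lambda>t. r * q' (a, t * r)) has_integral (q (a, 1 * r) - q (a, 0 * r))) {0..1}"
    proof (rule fundamental_theorem_of_calculus)
      fix t :: real assume t: "t \<in> {0..1}"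
      have D: "(q has_derivative frechet_derivative q (at (a, t * r))) (at (a, t * r))"
        by (rule smooth_on_has_derivative[OF assms(2,1) US[OF that t]])
      have "((\<lambda>t. (a, t * r)) has_derivative (\<lambda>h. (0, h * r))) (at t)"
        by (auto intro!: derivative_eq_intros)
      from has_derivative_compose[OF this D]
      have "((\<lambda>t. q (a, t * r)) has_derivative (\<lambda>h. frechet_derivative q (at (a, t * r)) (0, h * r))) (at t)" .
      moreover have "frechet_derivative q (at (a, t * r)) (0, h * r) = h *\<^sub>R (r * q' (a, t * r))" for h
      proof -
        have "linear (frechet_derivative q (at (a, t * r)))" by (rule has_derivative_linear[OF D])
        from linear_scale[OF this, of "h * r" "(0, 1)"] show ?thesis by (simp add: q'_def)
      qed
      ultimately show "((\<lambda>t. q (a, t * r)) has_vector_derivative r * q' (a, t * r)) (at t within {0..1})"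
        unfolding has_vector_derivative_def by (simp add: has_derivative_at_withinI)
    qed simp
    from integral_unique[OF this] show ?thesis by (simp add: k_def)
  qed
  show "k (a, 0) = frechet_derivative q (at (a, 0)) (0, 1)" for a
    by (simp add: k_def q'_def)
qed

section \<open>The function cos (sqrt z) on the whole line\<close>

lemma poly_mult_exp_minus_tendsto_0: "((\<lambda>y. poly p y * exp (- y)) \<longlongrightarrow> (0::real)) at_top"
proof -
  have "((\<lambda>y. \<Sum>i\<le>degree p. coeff p i * (y ^ i / exp y)) \<longlongrightarrow> (\<Sum>i\<le>degree p. coeff p i * 0)) at_top"
    by (intro tendsto_sum tendsto_mult tendsto_const tendsto_power_div_exp_0)
  then show ?thesis
    by (simp add: poly_altdef sum_distrib_right exp_minus divide_inverse mult.assoc)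
qed

text \<open>The polynomial factor makes the family closed under differentiation: every derivative of
  exp(-1/x), extended by zero, is a polynomial in 1/x times the same exponential.\<close>

definition flat_exp :: "real poly \<Rightarrow> real \<Rightarrow> real" where
  "flat_exp p x = (if 0 < x then poly p (inverse x) * exp (- inverse x) else 0)"

lemma flat_exp_tendsto_0: "((flat_exp p) \<longlongrightarrow> 0) (at 0)"
proof -
  have "((\<lambda>x. poly p (inverse x) * exp (- inverse x)) \<longlongrightarrow> 0) (at_right 0)"
    by (rule filterlim_compose[OF poly_mult_exp_minus_tendsto_0 filterlim_inverse_at_top_right])
  then have "(flat_exp p \<longlongrightarrow> 0) (at_right 0)"
    by (rule Lim_transform_eventually)
      (auto simp: flat_exp_def eventually_at_filter)
  moreover have "(flat_exp p \<longlongrightarrow> 0) (at_left 0)"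
    by (rule Lim_transform_eventually[OF tendsto_const])
      (auto simp: flat_exp_def eventually_at_filter)
  ultimately show ?thesis by (simp add: filterlim_split_at)
qed

text \<open>With y = 1/x and y' = -y^2, the derivative of p(y) exp(-y) is y^2 (p(y) - p'(y))
  exp(-y); the factor \<open>[:0, 0, 1:]\<close> is y^2.\<close>

lemma DERIV_flat_exp:
  "(flat_exp p has_real_derivative flat_exp ([:0, 0, 1:] * (p - pderiv p)) x) (at x)"
proof -
  consider "x > 0" | "x < 0" | "x = 0" by linarith
  then show ?thesis
  proof cases
    case 1
    have "((\<lambda>x. poly p (inverse x) * exp (- inverse x)) has_real_derivative
        flat_exp ([:0, 0, 1:] * (p - pderiv p)) x) (at x)"
      using 1 by (auto intro!: derivative_eq_intros DERIV_chain'[OF _ poly_DERIV]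
          simp: flat_exp_def algebra_simps power2_eq_square)
    then show ?thesis
      by (rule has_field_derivative_transform_within_open[where S = "{0<..}"])
        (use 1 in \<open>auto simp: flat_exp_def\<close>)
  next
    case 2
    have "((\<lambda>x. 0) has_real_derivative flat_exp ([:0, 0, 1:] * (p - pderiv p)) x) (at x)"
      using 2 by (auto simp: flat_exp_def)
    then show ?thesis
      by (rule has_field_derivative_transform_within_open[where S = "{..<0}"])
        (use 2 in \<open>auto simp: flat_exp_def\<close>)
  next
    \<comment> \<open>The difference quotient at 0 multiplies the polynomial by 1/h, so it is again
      a member of the family and tends to 0.\<close>
    case 3
    have "(\<lambda>h. (flat_exp p (0 + h) - flat_exp p 0) / h) = flat_exp ([:0, 1:] * p)"
      by (simp add: fun_eq_iff flat_exp_def divide_inverse)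
    then have "((\<lambda>h. (flat_exp p (0 + h) - flat_exp p 0) / h) \<longlongrightarrow> 0) (at 0)"
      using flat_exp_tendsto_0[of "[:0, 1:] * p"] by (simp only:)
    then show ?thesis
      unfolding DERIV_def 3 by (simp add: flat_exp_def)
  qed
qed

lemma smooth_on_flat_exp: "smooth_on UNIV (flat_exp p)"
  by (rule smooth_on_coinduct_real[where P = "\<lambda>f. \<exists>p. f = flat_exp p"])
    (use DERIV_flat_exp in blast)+

text \<open>With e(x) = exp(-1/x) for x > 0 and 0 otherwise, take e(x) / (e(x) + e(1 - x)). At every
  x one of the two summands of the denominator is positive.\<close>

lemma smooth_step:
  obtains \<theta> :: "real \<Rightarrow> real" where "smooth_on UNIV \<theta>"
    "\<And>x. x \<le> 0 \<Longrightarrow> \<theta> x = 0" "\<And>x. x \<ge> 1 \<Longrightarrow> \<theta> x = 1"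
proof
  let ?e = "flat_exp 1"
  have pos: "?e x + ?e (1 - x) > 0" for x
  proof -
    have "?e y \<ge> 0" and "y > 0 \<Longrightarrow> ?e y > 0" for y by (auto simp: flat_exp_def)
    then show ?thesis by (cases "x > 0") (auto intro: add_pos_nonneg add_nonneg_pos)
  qed
  have e': "smooth_on UNIV (\<lambda>x. ?e (1 - x))"
    by (rule smooth_on_compose[OF open_UNIV open_UNIV _ smooth_on_flat_exp
          smooth_on_diff[OF open_UNIV smooth_on_const[OF open_UNIV] smooth_on_ident[OF open_UNIV]]]) simp
  show "smooth_on UNIV (\<lambda>x. ?e x / (?e x + ?e (1 - x)))"
    by (intro smooth_on_divide smooth_on_add e' smooth_on_flat_exp open_UNIV)
      (use pos in \<open>metis less_irrefl\<close>)
  show "?e x / (?e x + ?e (1 - x)) = 0" if "x \<le> 0" for x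
    using that by (simp add: flat_exp_def)
  show "?e x / (?e x + ?e (1 - x)) = 1" if "x \<ge> 1" for x
    using that pos[of x] by (simp add: flat_exp_def)
qed

text \<open>\<open>cos_root 0 z = cos (sqrt z)\<close> for \<open>z \<ge> 0\<close>, and \<open>cos_root j\<close> is its \<open>j\<close>-th derivative.\<close>

definition cos_root_coeff :: "nat \<Rightarrow> nat \<Rightarrow> real" where
  "cos_root_coeff j = (diffs ^^ j) (\<lambda>n. (- 1) ^ n / fact (2 * n))"

definition cos_root :: "nat \<Rightarrow> real \<Rightarrow> real" where
  "cos_root j z = (\<Sum>n. cos_root_coeff j n * z ^ n)"

lemma summable_cos_root: "summable (\<lambda>n. cos_root_coeff j n * z ^ n)"
proof (induction j arbitrary: z)
  case 0
  \<comment> \<open>The cosine series gives convergence at nonnegative arguments only. A power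
    series that converges at |z| + 1 converges at z, whatever the sign of z.\<close>
  let ?K = "(\<bar>z\<bar> + 1)"
  have "summable (\<lambda>n. (- 1) ^ n / fact (2 * n) * (sqrt ?K) ^ (2 * n))"
    using cos_paired sums_summable by blast
  then have "summable (\<lambda>n. cos_root_coeff 0 n * ?K ^ n)"
    by (simp add: cos_root_coeff_def power_mult)
  then show ?case by (rule powser_inside) simp
next
  case (Suc j)
  then show ?case
    using termdiff_converges_all[of "cos_root_coeff j"] by (simp add: cos_root_coeff_def)
qed

lemma cos_root_square: "cos_root 0 (b\<^sup>2) = cos b"
  unfolding cos_root_def cos_root_coeff_def
  using sums_unique[OF cos_paired, of b] by (simp add: power_mult)

lemma DERIV_cos_root: "(cos_root j has_real_derivative cos_root (Suc j) z) (at z)"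
  using termdiffs_strong_converges_everywhere[OF summable_cos_root, of j z]
  by (simp add: cos_root_def[abs_def] cos_root_coeff_def)

lemma smooth_on_cos_root: "smooth_on UNIV (cos_root j)"
  by (rule smooth_on_coinduct_real[where P = "\<lambda>f. \<exists>j. f = cos_root j"])
    (use DERIV_cos_root in blast)+

text \<open>This is the differential equation below, read off the coefficients. For j = 0 it is the
  quotient of consecutive factorials; raising j by one is the same recurrence at n + 1, multiplied
  by n + 1, since 4(n + 1) + 4j = 4n + 4(j + 1).\<close>

lemma cos_root_coeff_recurrence:
  "(4 * real n + 4 * real j + 2) * cos_root_coeff (Suc j) n + cos_root_coeff j n = 0"
proof (induction j arbitrary: n)
  case 0
  have f: "fact (2 * Suc n) = (2 * real n + 2) * (2 * real n + 1) * fact (2 * n)" for n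
    by (simp add: algebra_simps)
  show ?case
    unfolding cos_root_coeff_def diffs_def funpow.simps o_apply id_apply f
    by (simp add: divide_simps) (simp add: algebra_simps)
next
  case (Suc j)
  have "cos_root_coeff (Suc i) n = (real n + 1) * cos_root_coeff i (Suc n)" for i n
    by (simp add: cos_root_coeff_def diffs_def)
  then have *: "(4 * real n + 4 * real (Suc j) + 2) * cos_root_coeff (Suc (Suc j)) n + cos_root_coeff (Suc j) n
    = (real n + 1) * ((4 * real (Suc n) + 4 * real j + 2) * cos_root_coeff (Suc j) (Suc n) + cos_root_coeff j (Suc n))"
    by (simp add: algebra_simps)
  show ?case unfolding * Suc by simp
qed

text \<open>The function y = cos(sqrt z) satisfies 4zy'' + 2y' + y = 0, and each differentiation of
  this equation adds 4 to the coefficient of the middle term.\<close>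

lemma cos_root_ode:
  "4 * z * cos_root (Suc (Suc j)) z + (4 * real j + 2) * cos_root (Suc j) z + cos_root j z = 0"
proof -
  let ?a = "cos_root_coeff j" and ?b = "cos_root_coeff (Suc j)"
  have "(\<lambda>n. real n * ?b n * z ^ (n - Suc 0)) sums cos_root (Suc (Suc j)) z"
    using diffs_equiv[of ?b z] summable_cos_root[of "Suc (Suc j)" z]
    by (simp add: cos_root_def cos_root_coeff_def)
  from sums_mult[OF this, of "4 * z"]
  have 1: "(\<lambda>n. 4 * (real n * ?b n * z ^ n)) sums (4 * z * cos_root (Suc (Suc j)) z)"
  proof (rule sums_cong[THEN iffD1, rotated])
    show "4 * z * (real n * ?b n * z ^ (n - Suc 0)) = 4 * (real n * ?b n * z ^ n)" for n
      by (cases n) auto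
  qed
  have 2: "(\<lambda>n. (4 * real j + 2) * (?b n * z ^ n)) sums ((4 * real j + 2) * cos_root (Suc j) z)"
    unfolding cos_root_def by (intro sums_mult summable_sums summable_cos_root)
  have 3: "(\<lambda>n. ?a n * z ^ n) sums cos_root j z"
    unfolding cos_root_def by (intro summable_sums summable_cos_root)
  have "(\<lambda>n. 4 * (real n * ?b n * z ^ n) + (4 * real j + 2) * (?b n * z ^ n) + ?a n * z ^ n) =
      (\<lambda>n. ((4 * real n + 4 * real j + 2) * ?b n + ?a n) * z ^ n)"
    by (simp add: algebra_simps)
  also have "\<dots> = (\<lambda>n. 0)" by (simp add: cos_root_coeff_recurrence)
  finally show ?thesis using sums_add[OF sums_add[OF 1 2] 3] sums_unique2[OF sums_zero] by simp
qed

text \<open>The energy \<open>y\<^sup>2 + 4 z y'\<^sup>2\<close> of a solution \<open>y\<close> of the equation above is nonincreasing on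
  \<open>z \<ge> 0\<close>.\<close>

lemma abs_cos_root_le:
  assumes "z \<ge> 0"
  shows "\<bar>cos_root j z\<bar> \<le> \<bar>cos_root j 0\<bar>"
proof -
  let ?E = "\<lambda>z. (cos_root j z)\<^sup>2 + 4 * z * (cos_root (Suc j) z)\<^sup>2"
  have "?E z \<le> ?E 0"
  proof (rule DERIV_nonpos_imp_nonincreasing[OF assms])
    fix x assume "0 \<le> x" "x \<le> z"
    let ?y = "cos_root j x" and ?y' = "cos_root (Suc j) x" and ?y'' = "cos_root (Suc (Suc j)) x"
    have "(?E has_real_derivative (2 * ?y * ?y' + 4 * ?y'\<^sup>2 + 4 * x * (2 * ?y' * ?y''))) (at x)"
      by (auto intro!: derivative_eq_intros DERIV_cos_root)
    moreover have "2 * ?y * ?y' + 4 * ?y'\<^sup>2 + 4 * x * (2 * ?y' * ?y'') = - 8 * real j * ?y'\<^sup>2"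
    proof -
      have y: "?y = - 4 * x * ?y'' - (4 * real j + 2) * ?y'" using cos_root_ode[of x j] by simp
      show ?thesis unfolding y by (simp add: algebra_simps power2_eq_square)
    qed
    moreover have "- 8 * real j * ?y'\<^sup>2 \<le> 0" by simp
    ultimately show "\<exists>D. (?E has_real_derivative D) (at x) \<and> D \<le> 0" by auto
  qed
  moreover have "4 * z * (cos_root (Suc j) z)\<^sup>2 \<ge> 0" using assms by simp
  ultimately have "(cos_root j z)\<^sup>2 \<le> (cos_root j 0)\<^sup>2" by simp
  then show ?thesis by (rule abs_le_square_iff[THEN iffD2])
qed

lemma smooth_on_deriv:
  fixes f :: "real \<Rightarrow> real"
  assumes "smooth_on S f" "open S"
  shows "smooth_on S (deriv f)" and "x \<in> S \<Longrightarrow> (f has_real_derivative deriv f x) (at x)"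
proof -
  have *: "(f has_real_derivative frechet_derivative f (at x) 1) (at x)" if "x \<in> S" for x
  proof -
    have D: "(f has_derivative frechet_derivative f (at x)) (at x)"
      by (rule smooth_on_has_derivative[OF assms that])
    have "frechet_derivative f (at x) h = frechet_derivative f (at x) 1 * h" for h
      using linear_scale[OF has_derivative_linear[OF D], of h 1] by simp
    then show ?thesis
      unfolding has_field_derivative_def by (intro has_derivative_eq_rhs[OF D] ext)
  qed
  show "smooth_on S (deriv f)"
    by (rule iffD2[OF smooth_on_cong smooth_on_frechet_derivative[OF assms, of 1]])
      (rule DERIV_imp_deriv[OF *])
  show "(f has_real_derivative deriv f x) (at x)" if "x \<in> S"
    using *[OF that] unfolding DERIV_imp_deriv[OF *[OF that]] .
qed

lemma smooth_on_deriv_funpow: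
  fixes f :: "real \<Rightarrow> real"
  assumes "smooth_on S f" "open S"
  shows "smooth_on S ((deriv ^^ j) f)"
  by (induction j) (auto intro: assms smooth_on_deriv)

lemma deriv_funpow_cong_open:
  fixes f g :: "real \<Rightarrow> real"
  assumes "open S" "\<And>x. x \<in> S \<Longrightarrow> f x = g x" "x \<in> S"
  shows "(deriv ^^ j) f x = (deriv ^^ j) g x"
  using assms(3)
proof (induction j arbitrary: x)
  case (Suc j)
  have "\<forall>\<^sub>F y in nhds x. (deriv ^^ j) f y = (deriv ^^ j) g y"
    using eventually_nhds_in_open[OF assms(1) Suc.prems] by (rule eventually_mono) (rule Suc.IH)
  then show ?case by (simp add: deriv_cong_ev)
qed (use assms(2) in simp)

text \<open>For negative z the power series is cosh(sqrt(-z)), which is unbounded, so it is cut off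
  there. Each derivative is then zero far to the left, bounded on [-2, 0] by compactness and on z >=
  0 by the energy estimate.\<close>

lemma smooth_cos_root_extension:
  obtains D :: "nat \<Rightarrow> real \<Rightarrow> real" where
    "\<And>b. D 0 (b\<^sup>2) = cos b"
    "\<And>j z. (D j has_real_derivative D (Suc j) z) (at z)"
    "\<And>j. \<exists>M. \<forall>z. \<bar>D j z\<bar> \<le> M"
proof -
  obtain \<theta> :: "real \<Rightarrow> real" where \<theta>: "smooth_on UNIV \<theta>"
    "\<And>x. x \<le> 0 \<Longrightarrow> \<theta> x = 0" "\<And>x. x \<ge> 1 \<Longrightarrow> \<theta> x = 1" using smooth_step by blast
  \<comment> \<open>The step vanishes for z <= -2 and equals 1 for z >= -1; the nonnegative
    half-line, where D(b^2) = cos b is required, lies well inside the unchanged part.\<close>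
  define D0 where "D0 = (\<lambda>z. cos_root 0 z * \<theta> (z + 2))"
  have sD: "smooth_on UNIV D0"
    unfolding D0_def
    by (intro smooth_intros smooth_on_cos_root open_UNIV smooth_on_compose[OF _ _ _ \<theta>(1)]) auto
  let ?D = "\<lambda>j. (deriv ^^ j) D0"
  have DD: "(?D j has_real_derivative ?D (Suc j) z) (at z)" for j z
    using smooth_on_deriv(2)[OF smooth_on_deriv_funpow[OF sD open_UNIV] open_UNIV] by simp
  have neg: "?D j z = 0" if "z < - 2" for j z
  proof -
    have "?D j z = (deriv ^^ j) (\<lambda>_. 0) z"
      by (rule deriv_funpow_cong_open[of "{..< -2}"]) (use that \<theta>(2) in \<open>auto simp: D0_def\<close>)
    also have "(deriv ^^ j) (\<lambda>_. 0) = (\<lambda>_. 0 :: real)" by (induction j) simp_all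
    finally show ?thesis .
  qed
  have pos: "?D j z = cos_root j z" if "z > - 1" for j z
  proof -
    have "?D j z = (deriv ^^ j) (cos_root 0) z"
      by (rule deriv_funpow_cong_open[of "{-1<..}"]) (use that \<theta>(3) in \<open>auto simp: D0_def\<close>)
    also have "(deriv ^^ j) (cos_root 0) = cos_root j"
      by (induction j) (use DERIV_imp_deriv[OF DERIV_cos_root] in auto)
    finally show ?thesis .
  qed
  have "\<exists>M. \<forall>z. \<bar>?D j z\<bar> \<le> M" for j
  proof -
    have "continuous_on {-2..0} (?D j)"
      using DERIV_continuous_on DD has_field_derivative_at_within by blast
    then have "bounded (?D j ` {-2..0})"
      by (intro compact_imp_bounded compact_continuous_image) auto
    then obtain B where B: "\<And>z. z \<in> {-2..0} \<Longrightarrow> \<bar>?D j z\<bar> \<le> B"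
      unfolding bounded_iff by (metis imageI real_norm_def)
    have "\<bar>?D j z\<bar> \<le> max B \<bar>cos_root j 0\<bar>" for z
    proof -
      consider "z < -2" | "z \<in> {-2..0}" | "z \<ge> 0" by fastforce
      then show ?thesis
        using neg[of z j] pos[of z j] B[of z] abs_cos_root_le[of z j] by cases (auto simp: max_def)
    qed
    then show ?thesis by blast
  qed
  moreover have "?D 0 (b\<^sup>2) = cos b" for b
  proof -
    have "b\<^sup>2 > - 1" by (smt (verit) zero_le_power2)
    then show ?thesis using pos[of "b\<^sup>2" 0] cos_root_square by simp
  qed
  ultimately show thesis using that[of ?D] DD by blast
qed

section \<open>Cosine series\<close>

lemma integral_cos_of_int:
  "((\<lambda>t. cos (of_int m * t)) has_integral (if m = 0 then pi else 0)) {0..pi}"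
proof (cases "m = 0")
  case True
  then show ?thesis using has_integral_const_real[of "1::real" 0 pi] by simp
next
  case False
  have "((\<lambda>t. cos (of_int m * t)) has_integral (sin (of_int m * pi) / of_int m - sin (of_int m * 0) / of_int m)) {0..pi}"
  proof (rule fundamental_theorem_of_calculus)
    fix t
    have "((\<lambda>t. sin (of_int m * t) / of_int m) has_real_derivative
        (cos (of_int m * t) * (of_int m * 1)) / of_int m) (at t within {0..pi})"
      by (intro DERIV_cdivide DERIV_chain2[OF DERIV_sin] DERIV_cmult DERIV_ident)
    then show "((\<lambda>t. sin (of_int m * t) / of_int m) has_vector_derivative cos (of_int m * t)) (at t within {0..pi})"
      using False by (simp add: has_real_derivative_iff_has_vector_derivative)
  qed simp
  moreover have "sin (of_int m * pi) = 0"
    using sin_npi_int[of m] by (simp add: mult.commute)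
  ultimately show ?thesis using False by simp
qed

lemma integral_cos_mult_cos:
  "((\<lambda>t. cos (real k * t) * cos (real j * t)) has_integral
     (if k = j then (if k = 0 then pi else pi / 2) else 0)) {0..pi}"
proof -
  let ?I = "\<lambda>m :: int. if m = 0 then pi else 0"
  have 1: "((\<lambda>t. (cos (of_int (int k - int j) * t) + cos (of_int (int k + int j) * t)) / 2) has_integral
     (?I (int k - int j) + ?I (int k + int j)) / 2) {0..pi}"
    by (intro has_integral_divide has_integral_add integral_cos_of_int)
  have 2: "(cos (of_int (int k - int j) * t) + cos (of_int (int k + int j) * t)) / 2
     = cos (real k * t) * cos (real j * t)" for t
    by (simp add: cos_times_cos left_diff_distrib distrib_right)
  have "(?I (int k - int j) + ?I (int k + int j)) / 2 =
      (if k = j then (if k = 0 then pi else pi / 2) else 0)"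
    by (cases "k = j"; cases "k = 0") simp_all
  then show ?thesis by (intro has_integral_eq_rhs[OF 1[unfolded 2]]) (rule sym)
qed

text \<open>Induction on the power of the cosine: cos t cos(jt) is the mean of cos((j-1)t) and
  cos((j+1)t), and for j = 0 the additional factor is cos(1 t). This turns orthogonality to all
  cos(jt) into orthogonality to all polynomials in cos t.\<close>

lemma integral_mult_cos_power_eq_0:
  assumes w: "continuous_on {0..pi} w"
    and 0: "\<And>j. integral {0..pi} (\<lambda>t. w t * cos (real j * t)) = 0"
  shows "integral {0..pi} (\<lambda>t. w t * (cos t) ^ i * cos (real j * t)) = 0"
proof (induction i arbitrary: j)
  case 0
  then show ?case using assms(2) by simp
next
  case (Suc i)
  have int: "(\<lambda>t. w t * (cos t) ^ i * cos (real j * t)) integrable_on {0..pi}" for j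
    by (intro integrable_continuous_real continuous_intros w)
  show ?case
  proof (cases j)
    case 0
    then show ?thesis using Suc[of 1] by (simp add: mult_ac)
  next
    case (Suc j')
    have "w t * (cos t) ^ Suc i * cos (real j * t) =
        (w t * (cos t) ^ i * cos (real j' * t) + w t * (cos t) ^ i * cos (real (j + 1) * t)) / 2" for t
    proof -
      have 1: "real j * t - t = real j' * t" and 2: "real j * t + t = real (j + 1) * t"
        using Suc by (simp_all add: algebra_simps)
      have "cos (real j * t) * cos t = (cos (real j' * t) + cos (real (j + 1) * t)) / 2"
        unfolding cos_times_cos 1 2 by simp
      moreover have "w t * (cos t) ^ Suc i * cos (real j * t) =
          w t * (cos t) ^ i * (cos (real j * t) * cos t)" by simp
      ultimately show ?thesis by (simp only: distrib_left times_divide_eq_right)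
    qed
    moreover have "integral {0..pi} (\<lambda>t. (w t * (cos t) ^ i * cos (real j' * t)
        + w t * (cos t) ^ i * cos (real (j + 1) * t)) / 2) = 0"
      unfolding integral_divide integral_add[OF int int] Suc.IH by simp
    ultimately show ?thesis by (simp only:)
  qed
qed

text \<open>The substitution y = cos t identifies continuous functions on [0, pi] with those on
  [-1, 1], so by Weierstrass w is a uniform limit of polynomials in cos t. As w is orthogonal to
  these, the integral of w^2 is at most epsilon times the integral of |w|, hence zero.\<close>

lemma cosine_coefficients_unique:
  assumes w: "continuous_on {0..pi} w"
    and 0: "\<And>j. integral {0..pi} (\<lambda>t. w t * cos (real j * t)) = 0"
    and x: "x \<in> {0..pi}"
  shows "w x = 0"
proof -
  note cint = integrable_continuous_real continuous_intros w
  have poly: "integral {0..pi} (\<lambda>t. w t * g (cos t)) = 0" if g: "real_polynomial_function g" for g :: "real \<Rightarrow> real"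
  proof -
    obtain a n where "g = (\<lambda>x. \<Sum>i\<le>n. a i * x ^ i)"
      using g unfolding real_polynomial_function_iff_sum by blast
    then have "(\<lambda>t. w t * g (cos t)) = (\<lambda>t. \<Sum>i\<le>n. a i * (w t * (cos t) ^ i * cos (real 0 * t)))"
      by (simp add: sum_distrib_left mult.left_commute)
    moreover have "integral {0..pi} (\<lambda>t. \<Sum>i\<le>n. a i * (w t * (cos t) ^ i * cos (real 0 * t)))
        = (\<Sum>i\<le>n. integral {0..pi} (\<lambda>t. a i * (w t * (cos t) ^ i * cos (real 0 * t))))"
      by (intro integral_sum finite_atMost cint)
    moreover have "\<dots> = 0"
      unfolding integral_mult_right integral_mult_cos_power_eq_0[OF w 0] by simp
    ultimately show ?thesis by (simp only:)
  qed
  define A where "A = integral {0..pi} (\<lambda>t. \<bar>w t\<bar>)"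
  have A: "A \<ge> 0" unfolding A_def by (rule integral_nonneg) (auto intro!: cint)
  have small: "integral {0..pi} (\<lambda>t. w t * w t) \<le> e * A" if "e > 0" for e
  proof -
    have "continuous_on {-1..1} (\<lambda>y. w (arccos y))"
      by (rule continuous_on_compose2[OF w continuous_on_arccos'])
        (auto intro: arccos_lbound arccos_ubound)
    from Stone_Weierstrass_real_polynomial_function[OF compact_Icc this \<open>e > 0\<close>]
    obtain g where g: "real_polynomial_function g" "\<And>y. y \<in> {-1..1} \<Longrightarrow> \<bar>w (arccos y) - g y\<bar> < e"
      by blast
    have close: "\<bar>w t - g (cos t)\<bar> \<le> e" if "t \<in> {0..pi}" for t
      using g(2)[of "cos t"] that by (simp add: arccos_cos)
    have gc: "continuous_on {0..pi} (\<lambda>t. g (cos t))"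
    proof (rule continuous_on_compose2[of UNIV g])
      show "continuous_on UNIV g"
        using g(1) unfolding real_polynomial_function_eq by (rule continuous_on_polymonial_function)
      show "continuous_on {0..pi} (cos :: real \<Rightarrow> real)" by (intro continuous_intros)
    qed simp
    have "integral {0..pi} (\<lambda>t. w t * w t - w t * g (cos t)) =
        integral {0..pi} (\<lambda>t. w t * w t) - integral {0..pi} (\<lambda>t. w t * g (cos t))"
      by (intro integral_diff cint gc)
    then have "integral {0..pi} (\<lambda>t. w t * w t) = integral {0..pi} (\<lambda>t. w t * (w t - g (cos t)))"
      unfolding poly[OF g(1)] diff_zero right_diff_distrib by (rule sym)
    also have "\<dots> \<le> integral {0..pi} (\<lambda>t. e * \<bar>w t\<bar>)"
    proof (rule integral_le)
      fix t assume "t \<in> {0..pi}"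
      have "w t * (w t - g (cos t)) \<le> \<bar>w t\<bar> * \<bar>w t - g (cos t)\<bar>"
        by (metis abs_ge_self abs_mult)
      also have "\<dots> \<le> \<bar>w t\<bar> * e" by (intro mult_left_mono close \<open>t \<in> _\<close>) auto
      finally show "w t * (w t - g (cos t)) \<le> e * \<bar>w t\<bar>" by (simp add: mult.commute)
    qed (auto intro!: cint gc)
    finally show ?thesis by (simp add: A_def)
  qed
  have "integral {0..pi} (\<lambda>t. w t * w t) \<le> 0"
  proof (rule field_le_epsilon)
    \<comment> \<open>The bound is used with e / (A + 1) in place of e, so that the case A = 0 needs
      no separate treatment.\<close>
    fix e :: real assume "e > 0"
    then have "integral {0..pi} (\<lambda>t. w t * w t) \<le> (e / (A + 1)) * A"
      using A by (intro small) simp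
    also have "\<dots> \<le> e" using A \<open>e > 0\<close> by (simp add: field_simps)
    finally show "integral {0..pi} (\<lambda>t. w t * w t) \<le> 0 + e" by simp
  qed
  moreover have "integral {0..pi} (\<lambda>t. w t * w t) \<ge> 0"
    by (rule integral_nonneg) (auto intro!: cint)
  ultimately have "integral {0..pi} (\<lambda>t. w t * w t) = 0" by simp
  moreover have "continuous_on {0..pi} (\<lambda>t. w t * w t)" by (intro continuous_intros w)
  ultimately have "\<forall>t\<in>{0..pi}. w t * w t = 0"
    using integral_eq_0_iff[of 0 pi "\<lambda>t. w t * w t", OF _ pi_gt_zero] zero_le_square by blast
  then show ?thesis using x by simp
qed

definition cosine_coeff :: "(real \<Rightarrow> real) \<Rightarrow> nat \<Rightarrow> real" where
  "cosine_coeff f k = integral {0..pi} (\<lambda>t. f t * cos (real k * t))"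

text \<open>The reciprocal of the integral of cos(kt)^2 over [0, pi].\<close>

definition cosine_weight :: "nat \<Rightarrow> real" where
  "cosine_weight k = (if k = 0 then 1 / pi else 2 / pi)"

text \<open>Absolutely summable coefficients make the series converge uniformly to a continuous G.
  Integrating term by term, G has the same cosine coefficients as F, and continuous functions are
  determined by these.\<close>

theorem cosine_series_sums:
  assumes F: "continuous_on {0..pi} F" and c: "summable (\<lambda>k. \<bar>cosine_coeff F k\<bar>)" and x: "x \<in> {0..pi}"
  shows "(\<lambda>k. cosine_weight k * cosine_coeff F k * cos (real k * x)) sums F x"
proof -
  let ?c = "\<lambda>k. cosine_weight k * cosine_coeff F k"
  define G where "G = (\<lambda>x. \<Sum>k. ?c k * cos (real k * x))"
  have sc: "summable (\<lambda>k. \<bar>?c k\<bar>)"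
  proof (rule summable_comparison_test'[OF summable_mult[OF c, of "2 / pi"]])
    show "norm \<bar>?c k\<bar> \<le> 2 / pi * \<bar>cosine_coeff F k\<bar>" for k
      unfolding real_norm_def abs_abs abs_mult
      by (rule mult_right_mono) (simp_all add: cosine_weight_def divide_right_mono)
  qed
  have b: "\<bar>?c k * cos (real k * t)\<bar> \<le> \<bar>?c k\<bar>" for k t
    unfolding abs_mult[of _ "cos _"] by (rule mult_left_le) auto
  have sums: "(\<lambda>k. ?c k * cos (real k * t)) sums G t" for t
    unfolding G_def by (rule summable_sums, rule summable_comparison_test'[OF sc]) (use b in simp)
  have ul: "uniform_limit {0..pi} (\<lambda>n t. \<Sum>k<n. ?c k * cos (real k * t)) G sequentially"
    unfolding G_def by (rule Weierstrass_m_test[OF _ sc]) (use b in simp)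
  have contG: "continuous_on {0..pi} G"
    by (rule uniform_limit_theorem[OF _ ul]) (auto intro!: always_eventually continuous_intros)
  have coef: "integral {0..pi} (\<lambda>t. G t * cos (real j * t)) = cosine_coeff F j" for j
  proof -
    have ulj: "uniform_limit {0..pi} (\<lambda>n t. (\<Sum>k<n. ?c k * cos (real k * t)) * cos (real j * t))
        (\<lambda>t. G t * cos (real j * t)) sequentially"
    proof (rule uniform_lim_mult[OF ul uniform_limit_const])
      show "bounded (G ` {0..pi})"
        by (intro compact_imp_bounded compact_continuous_image contG) auto
      show "bounded ((\<lambda>t. cos (real j * t)) ` {0..pi})"
        by (intro compact_imp_bounded compact_continuous_image continuous_intros) auto
    qed
    obtain I J where IJ: "\<And>n. ((\<lambda>t. (\<Sum>k<n. ?c k * cos (real k * t)) * cos (real j * t)) has_integral I n) {0..pi}"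
      "((\<lambda>t. G t * cos (real j * t)) has_integral J) {0..pi}" "I \<longlonglongrightarrow> J"
      by (rule uniform_limit_integral[OF ulj]) (auto intro!: continuous_intros)
    \<comment> \<open>By orthogonality the integral of a partial sum against cos(jt) no longer
      changes once the term with index j has been included.\<close>
    have I: "I n = cosine_coeff F j" if "n > j" for n
    proof -
      have "((\<lambda>t. \<Sum>k<n. ?c k * (cos (real k * t) * cos (real j * t))) has_integral
        (\<Sum>k<n. ?c k * (if k = j then (if k = 0 then pi else pi / 2) else 0))) {0..pi}"
        by (intro has_integral_sum has_integral_mult_right integral_cos_mult_cos) simp
      moreover have "(\<Sum>k<n. ?c k * (if k = j then (if k = 0 then pi else pi / 2) else 0)) =
        (\<Sum>k<n. if k = j then cosine_coeff F j else 0)"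
        by (rule sum.cong) (auto simp: cosine_weight_def)
      moreover have "\<dots> = cosine_coeff F j" using that by simp
      ultimately show ?thesis
        using has_integral_unique[OF IJ(1)[of n]] by (simp add: sum_distrib_right mult.assoc)
    qed
    have "I \<longlonglongrightarrow> cosine_coeff F j"
      by (rule tendsto_eventually[OF eventually_mono[OF eventually_gt_at_top[of j] I]])
    then have "J = cosine_coeff F j" using IJ(3) LIMSEQ_unique by blast
    then show ?thesis using IJ(2) integral_unique by blast
  qed
  have "F x - G x = 0"
  proof (rule cosine_coefficients_unique[OF _ _ x])
    show "continuous_on {0..pi} (\<lambda>x. F x - G x)" by (intro continuous_intros F contG)
    show "integral {0..pi} (\<lambda>t. (F t - G t) * cos (real j * t)) = 0" for j
    proof -
      have "integral {0..pi} (\<lambda>t. F t * cos (real j * t) - G t * cos (real j * t)) =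
        integral {0..pi} (\<lambda>t. F t * cos (real j * t)) - integral {0..pi} (\<lambda>t. G t * cos (real j * t))"
        by (rule integral_diff) (auto intro!: integrable_continuous_real continuous_intros F contG)
      then show ?thesis using coef[of j] by (simp add: left_diff_distrib cosine_coeff_def)
    qed
  qed
  then show ?thesis using sums[of x] by simp
qed

section \<open>Even functions\<close>

abbreviation "partial1 E \<equiv> (\<lambda>p. frechet_derivative E (at p) (1, 0))"
abbreviation "partial2 E \<equiv> (\<lambda>p. frechet_derivative E (at p) (0, 1))"

lemma frechet_derivative_plane:
  fixes E :: "real \<times> real \<Rightarrow> real"
  assumes "smooth_on S E" "open S" "p \<in> S"
  shows "(E has_derivative (\<lambda>h. fst h * partial1 E p + snd h * partial2 E p)) (at p)"
proof -
  have D: "(E has_derivative frechet_derivative E (at p)) (at p)"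
    by (rule smooth_on_has_derivative[OF assms])
  interpret linear "frechet_derivative E (at p)" by (rule has_derivative_linear[OF D])
  have "frechet_derivative E (at p) h = fst h * partial1 E p + snd h * partial2 E p" for h
  proof -
    have "frechet_derivative E (at p) h = frechet_derivative E (at p) (fst h *\<^sub>R (1, 0) + snd h *\<^sub>R (0, 1))"
      by (cases h) simp
    also have "\<dots> = fst h *\<^sub>R partial1 E p + snd h *\<^sub>R partial2 E p" by (simp only: add scale)
    finally show ?thesis by simp
  qed
  then show ?thesis by (intro has_derivative_eq_rhs[OF D] ext)
qed

lemma DERIV_partial1:
  fixes E :: "real \<times> real \<Rightarrow> real"
  assumes "smooth_on S E" "open S" "(a, b) \<in> S"
  shows "((\<lambda>a. E (a, b)) has_real_derivative partial1 E (a, b)) (at a)"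
proof -
  have "((\<lambda>a. (a, b)) has_derivative (\<lambda>h. (h, 0))) (at a)"
    by (auto intro!: derivative_eq_intros)
  from has_derivative_compose[OF this frechet_derivative_plane[OF assms]]
  show ?thesis by (simp add: has_field_derivative_def mult.commute[of _ "partial1 E (a, b)"])
qed

lemma DERIV_partial2:
  fixes E :: "real \<times> real \<Rightarrow> real"
  assumes "smooth_on S E" "open S" "(a, b) \<in> S"
  shows "((\<lambda>b. E (a, b)) has_real_derivative partial2 E (a, b)) (at b)"
proof -
  have "((\<lambda>b. (a, b)) has_derivative (\<lambda>h. (0, h))) (at b)"
    by (auto intro!: derivative_eq_intros)
  from has_derivative_compose[OF this frechet_derivative_plane[OF assms]]
  show ?thesis by (simp add: has_field_derivative_def mult.commute[of _ "partial2 E (a, b)"])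
qed

lemma abs_cosine_coeff_le:
  assumes "continuous_on {0..pi} f" "\<And>t. t \<in> {0..pi} \<Longrightarrow> \<bar>f t\<bar> \<le> M"
  shows "\<bar>cosine_coeff f k\<bar> \<le> pi * M"
proof -
  have "norm (integral {0..pi} (\<lambda>t. f t * cos (real k * t))) \<le> M * (pi - 0)"
  proof (rule integral_bound)
    show "continuous_on {0..pi} (\<lambda>t. f t * cos (real k * t))" by (intro continuous_intros assms(1))
    fix t assume "t \<in> {0..pi}"
    have "\<bar>f t * cos (real k * t)\<bar> \<le> \<bar>f t\<bar>"
      unfolding abs_mult by (rule mult_left_le) auto
    also have "\<dots> \<le> M" by (rule assms(2)) fact
    finally show "norm (f t * cos (real k * t)) \<le> M" by simp
  qed simp
  then show ?thesis by (simp add: cosine_coeff_def mult.commute)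
qed

text \<open>Families \<open>E a\<close> of even functions supported in \<open>[-1, 1]\<close>, hence periodizable with period \<open>2\<pi>\<close>.\<close>

definition even_family :: "real set \<Rightarrow> (real \<times> real \<Rightarrow> real) \<Rightarrow> bool" where
  "even_family A E \<longleftrightarrow> smooth_on (A \<times> UNIV) E \<and>
     (\<forall>a\<in>A. \<forall>b. E (a, - b) = E (a, b)) \<and> (\<forall>a\<in>A. \<forall>b. \<bar>b\<bar> > 1 \<longrightarrow> E (a, b) = 0)"

text \<open>The sign c treats both parities at once. A derivative in a keeps the parity and one in b
  reverses it, so the second derivative in b of an even family is even again.\<close>

lemma partial_reflect:
  fixes E :: "real \<times> real \<Rightarrow> real"
  assumes A: "open A" and sm: "smooth_on (A \<times> UNIV) E"
    and r: "\<And>a b. a \<in> A \<Longrightarrow> E (a, - b) = c * E (a, b)" and "a \<in> A"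
  shows "partial1 E (a, - b) = c * partial1 E (a, b)"
    and "- partial2 E (a, - b) = c * partial2 E (a, b)"
proof -
  have o: "open (A \<times> (UNIV :: real set))" by (intro open_Times A open_UNIV)
  have "((\<lambda>a. c * E (a, b)) has_real_derivative c * partial1 E (a, b)) (at a)"
    using \<open>a \<in> A\<close> by (intro DERIV_cmult DERIV_partial1[OF sm o]) simp
  then have "((\<lambda>a. E (a, - b)) has_real_derivative c * partial1 E (a, b)) (at a)"
    by (rule has_field_derivative_transform_within_open[OF _ A \<open>a \<in> A\<close>]) (simp add: r)
  moreover have "((\<lambda>a. E (a, - b)) has_real_derivative partial1 E (a, - b)) (at a)"
    using \<open>a \<in> A\<close> by (intro DERIV_partial1[OF sm o]) simp
  ultimately show "partial1 E (a, - b) = c * partial1 E (a, b)" using DERIV_unique by blast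
  have "((\<lambda>b. c * E (a, b)) has_real_derivative c * partial2 E (a, b)) (at b)"
    using \<open>a \<in> A\<close> by (intro DERIV_cmult DERIV_partial2[OF sm o]) simp
  then have "((\<lambda>b. E (a, - b)) has_real_derivative c * partial2 E (a, b)) (at b)"
    by (simp add: r[OF \<open>a \<in> A\<close>])
  moreover have "((\<lambda>b. E (a, - b)) has_real_derivative partial2 E (a, - b) * - 1) (at b)"
    using \<open>a \<in> A\<close>
    by (intro DERIV_chain2[of "\<lambda>b. E (a, b)"] DERIV_partial2[OF sm o] DERIV_minus DERIV_ident) simp
  ultimately show "- partial2 E (a, - b) = c * partial2 E (a, b)" using DERIV_unique by force
qed

lemma partial_support:
  fixes E :: "real \<times> real \<Rightarrow> real"
  assumes A: "open A" and r: "\<And>a b. a \<in> A \<Longrightarrow> \<bar>b\<bar> > 1 \<Longrightarrow> E (a, b) = 0" and ab: "a \<in> A" "\<bar>b\<bar> > 1"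
  shows "frechet_derivative E (at (a, b)) h = 0"
proof -
  have o: "open (A \<times> {b :: real. \<bar>b\<bar> > 1})"
    by (intro open_Times A open_Collect_less continuous_intros)
  have "((\<lambda>_. 0) has_derivative (\<lambda>_. 0)) (at (a, b))" by simp
  then have "(E has_derivative (\<lambda>_. 0)) (at (a, b))"
    by (rule has_derivative_transform_within_open[OF _ o]) (use ab r in auto)
  from frechet_derivative_at[OF this] show ?thesis by metis
qed

text \<open>These two operations on E are the ones that occur when the extended cosine series is
  differentiated in a and in s.\<close>

lemma even_family_partial:
  assumes A: "open A" and E: "even_family A E"
  shows "even_family A (partial1 E)" and "even_family A (partial2 (partial2 E))"
proof -
  have o: "open (A \<times> (UNIV :: real set))" by (intro open_Times A open_UNIV)
  note E' = E[unfolded even_family_def]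
  have sm: "smooth_on (A \<times> UNIV) E" using E' by blast
  have ev: "E (a, - b) = 1 * E (a, b)" if "a \<in> A" for a b using E' that by simp
  have su: "E (a, b) = 0" if "a \<in> A" "\<bar>b\<bar> > 1" for a b using E' that by blast
  have sm2: "smooth_on (A \<times> UNIV) (partial2 E)" by (rule smooth_on_frechet_derivative[OF sm o])
  have od: "partial2 E (a, - b) = - 1 * partial2 E (a, b)" if "a \<in> A" for a b
    using partial_reflect(2)[OF A sm ev that, of b] by simp
  show "even_family A (partial1 E)"
    unfolding even_family_def
    using smooth_on_frechet_derivative[OF sm o] partial_reflect(1)[OF A sm ev] partial_support[of A E, OF A su]
    by simp
  have "partial2 (partial2 E) (a, - b) = partial2 (partial2 E) (a, b)" if "a \<in> A" for a b
    using partial_reflect(2)[OF A sm2 od that, of b] by simp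
  moreover have "partial2 (partial2 E) (a, b) = 0" if "a \<in> A" "\<bar>b\<bar> > 1" for a b
    by (rule partial_support[of A "partial2 E", OF A _ that]) (rule partial_support[of A E, OF A su])
  ultimately show "even_family A (partial2 (partial2 E))"
    unfolding even_family_def using smooth_on_frechet_derivative[OF sm2 o] by blast
qed

lemma even_family_continuous:
  assumes "even_family A E" "a \<in> A"
  shows "continuous_on S (\<lambda>b. E (a, b))"
proof (rule continuous_on_compose2[of "A \<times> UNIV" E])
  show "continuous_on (A \<times> UNIV) E"
    using assms(1) smooth_on_imp_continuous_on unfolding even_family_def by blast
  show "continuous_on S (Pair a)" by (intro continuous_intros)
qed (use assms(2) in auto)

text \<open>Two integrations by parts, carried out at once with the primitive E_b cos(kt) + k E
  sin(kt). It vanishes at pi because the support lies in [-1, 1], and at 0 because E_b is odd and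
  the sine is zero there.\<close>

lemma cosine_coeff_partial2:
  assumes A: "open A" and E: "even_family A E" and a: "a \<in> A"
  shows "(real k)\<^sup>2 * cosine_coeff (\<lambda>b. E (a, b)) k = - cosine_coeff (\<lambda>b. partial2 (partial2 E) (a, b)) k"
proof -
  have o: "open (A \<times> (UNIV :: real set))" by (intro open_Times A open_UNIV)
  note E' = E[unfolded even_family_def]
  have sm: "smooth_on (A \<times> UNIV) E" using E' by blast
  have ev: "E (a, - b) = 1 * E (a, b)" if "a \<in> A" for a b using E' that by simp
  have su: "E (a, b) = 0" if "a \<in> A" "\<bar>b\<bar> > 1" for a b using E' that by blast
  have sm2: "smooth_on (A \<times> UNIV) (partial2 E)" by (rule smooth_on_frechet_derivative[OF sm o])
  let ?E2 = "\<lambda>t. partial2 E (a, t)" and ?E22 = "\<lambda>t. partial2 (partial2 E) (a, t)"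
  let ?F = "\<lambda>t. ?E2 t * cos (real k * t) + real k * (E (a, t) * sin (real k * t))"
  have "((\<lambda>t. ?E22 t * cos (real k * t) + (real k)\<^sup>2 * (E (a, t) * cos (real k * t))) has_integral (?F pi - ?F 0)) {0..pi}"
  proof (rule fundamental_theorem_of_calculus)
    fix t
    have 1: "(?E2 has_real_derivative ?E22 t) (at t)"
      using a by (intro DERIV_partial2[OF sm2 o]) simp
    have 2: "((\<lambda>t. E (a, t)) has_real_derivative ?E2 t) (at t)"
      using a by (intro DERIV_partial2[OF sm o]) simp
    have k: "((\<lambda>t. real k * t) has_real_derivative real k * 1) (at t)"
      by (intro DERIV_cmult DERIV_ident)
    have "(?F has_real_derivative
        (?E22 t * cos (real k * t) + (- sin (real k * t) * (real k * 1)) * ?E2 t) +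
        real k * (?E2 t * sin (real k * t) + (cos (real k * t) * (real k * 1)) * E (a, t))) (at t)"
      by (rule DERIV_add DERIV_mult DERIV_cmult 1 2 DERIV_chain2[OF DERIV_cos k] DERIV_chain2[OF DERIV_sin k])+
    then have "(?F has_real_derivative
        ?E22 t * cos (real k * t) + (real k)\<^sup>2 * (E (a, t) * cos (real k * t))) (at t)"
      by (rule DERIV_cong) (simp add: algebra_simps power2_eq_square)
    then show "(?F has_vector_derivative ?E22 t * cos (real k * t) + (real k)\<^sup>2 * (E (a, t) * cos (real k * t))) (at t within {0..pi})"
      unfolding has_real_derivative_iff_has_vector_derivative by (rule has_vector_derivative_at_within)
  qed simp
  moreover have "?F pi = 0"
  proof -
    have pi1: "\<bar>pi\<bar> > 1" using pi_gt3 by simp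
    show ?thesis using su[OF a pi1] partial_support[of A E a pi, OF A su a pi1] by simp
  qed
  moreover have "?F 0 = 0"
    using partial_reflect(2)[OF A sm ev a, of 0] by simp
  ultimately have "integral {0..pi} (\<lambda>t. ?E22 t * cos (real k * t) + (real k)\<^sup>2 * (E (a, t) * cos (real k * t))) = 0"
    by (simp add: integral_unique)
  moreover have "integral {0..pi} (\<lambda>t. ?E22 t * cos (real k * t) + (real k)\<^sup>2 * (E (a, t) * cos (real k * t)))
     = cosine_coeff ?E22 k + (real k)\<^sup>2 * cosine_coeff (\<lambda>b. E (a, b)) k"
    unfolding cosine_coeff_def integral_mult_right[symmetric]
    by (intro integral_add integrable_continuous_real continuous_intros
        even_family_continuous[OF E a] even_family_continuous[OF even_family_partial(2)[OF A E] a])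
  ultimately show ?thesis by simp
qed

lemma even_family_bounded:
  assumes E: "even_family A E" and K: "compact K" "K \<subseteq> A"
  obtains M where "\<And>a t. a \<in> K \<Longrightarrow> t \<in> {0..pi} \<Longrightarrow> \<bar>E (a, t)\<bar> \<le> M"
proof -
  have "continuous_on (A \<times> UNIV) E"
    using E smooth_on_imp_continuous_on unfolding even_family_def by blast
  then have "continuous_on (K \<times> {0..pi}) E"
    by (rule continuous_on_subset) (use K in auto)
  then have "bounded (E ` (K \<times> {0..pi}))"
    by (intro compact_imp_bounded compact_continuous_image compact_Times K compact_Icc)
  then obtain M where "\<forall>x\<in>E ` (K \<times> {0..pi}). norm x \<le> M" unfolding bounded_iff by blast
  then show thesis by (intro that[of M]) auto
qed

text \<open>If c is a coefficient of E and d the one of E_bb, then c (k^2 + 1) = c - d, and both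
  terms are bounded uniformly over the compact set K. Adding 1 to k^2 includes k = 0 in the
  estimate.\<close>

lemma cosine_coeff_decay:
  assumes A: "open A" and E: "even_family A E" and K: "compact K" "K \<subseteq> A"
  obtains M where "\<And>a k. a \<in> K \<Longrightarrow> \<bar>cosine_coeff (\<lambda>b. E (a, b)) k\<bar> \<le> M / ((real k)\<^sup>2 + 1)"
proof -
  note E2 = even_family_partial(2)[OF A E]
  obtain M1 where M1: "\<And>a t. a \<in> K \<Longrightarrow> t \<in> {0..pi} \<Longrightarrow> \<bar>E (a, t)\<bar> \<le> M1"
    using even_family_bounded[OF E K] by blast
  obtain M2 where M2: "\<And>a t. a \<in> K \<Longrightarrow> t \<in> {0..pi} \<Longrightarrow> \<bar>partial2 (partial2 E) (a, t)\<bar> \<le> M2"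
    using even_family_bounded[OF E2 K] by blast
  have "\<bar>cosine_coeff (\<lambda>b. E (a, b)) k\<bar> \<le> (pi * M1 + pi * M2) / ((real k)\<^sup>2 + 1)" if "a \<in> K" for a k
  proof -
    have a: "a \<in> A" using K that by blast
    let ?c = "cosine_coeff (\<lambda>b. E (a, b)) k" and ?d = "cosine_coeff (\<lambda>b. partial2 (partial2 E) (a, b)) k"
    have "\<bar>?c\<bar> \<le> pi * M1"
      by (rule abs_cosine_coeff_le[OF even_family_continuous[OF E a] M1[OF that]])
    moreover have "\<bar>?d\<bar> \<le> pi * M2"
      by (rule abs_cosine_coeff_le[OF even_family_continuous[OF E2 a] M2[OF that]])
    moreover have "\<bar>?c\<bar> * ((real k)\<^sup>2 + 1) = \<bar>?c - ?d\<bar>"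
    proof -
      have "?c - ?d = ?c * ((real k)\<^sup>2 + 1)"
        using cosine_coeff_partial2[OF A E a, of k] by (simp add: algebra_simps)
      then show ?thesis by (simp add: abs_mult)
    qed
    ultimately have "\<bar>?c\<bar> * ((real k)\<^sup>2 + 1) \<le> pi * M1 + pi * M2" by linarith
    moreover have "(real k)\<^sup>2 + 1 > 0" by (simp add: add_nonneg_pos)
    ultimately show ?thesis by (simp add: pos_le_divide_eq)
  qed
  then show thesis using that by blast
qed

lemma summable_inverse_square_plus_1: "summable (\<lambda>k. M / ((real k)\<^sup>2 + 1))"
proof -
  have "summable (\<lambda>k. 1 / ((real k)\<^sup>2 + 1))"
  proof (rule summable_comparison_test'[OF inverse_power_summable[of 2, where ?'a = real]])
    show "norm (1 / ((real k)\<^sup>2 + 1)) \<le> inverse ((of_nat k)\<^sup>2)" if "1 \<le> k" for k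
      using that by (simp add: inverse_eq_divide frac_le)
  qed simp
  from summable_mult[OF this, of M] show ?thesis by simp
qed

lemma DERIV_cosine_coeff:
  assumes A: "open A" and E: "even_family A E" and a: "a \<in> A"
  shows "((\<lambda>a. cosine_coeff (\<lambda>b. E (a, b)) k) has_real_derivative
     cosine_coeff (\<lambda>b. partial1 E (a, b)) k) (at a)"
proof -
  let ?G = "\<lambda>p. E p * cos (real k * snd p)"
  have o: "open (A \<times> (UNIV :: real set))" by (intro open_Times A open_UNIV)
  have sm: "smooth_on (A \<times> UNIV) E" using E unfolding even_family_def by blast
  \<comment> \<open>The combinations of cosine and sine are closed under differentiation.\<close>
  have scos: "smooth_on UNIV (cos :: real \<Rightarrow> real)"
  proof (rule smooth_on_coinduct_real[where P = "\<lambda>f. \<exists>c d. f = (\<lambda>x. c * cos x + d * sin x)"])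
    show "\<exists>c d. cos = (\<lambda>x. c * cos x + d * sin x :: real)"
      by (intro exI[of _ 1] exI[of _ 0]) simp
    fix f :: "real \<Rightarrow> real" assume "\<exists>c d. f = (\<lambda>x. c * cos x + d * sin x)"
    then obtain c d where f: "f = (\<lambda>x. c * cos x + d * sin x)" by blast
    have "(f has_real_derivative d * cos x + (- c) * sin x) (at x)" for x
      unfolding f by (auto intro!: derivative_eq_intros)
    then show "\<exists>g. (\<forall>x\<in>UNIV. (f has_real_derivative g x) (at x)) \<and> (\<exists>c d. g = (\<lambda>x. c * cos x + d * sin x))"
      by (intro exI[of _ "\<lambda>x. d * cos x + (- c) * sin x"]) blast
  qed simp
  have sG: "smooth_on (A \<times> UNIV) ?G"
    by (intro smooth_intros sm o smooth_on_compose[OF _ open_UNIV _ scos]) simp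
  have dG: "frechet_derivative ?G (at (a, t)) (h, 0) = h * (partial1 E (a, t) * cos (real k * t))" for t h
  proof -
    have "(?G has_derivative (\<lambda>h. E (a, t) * (real k * snd h * - sin (real k * t)) +
        (fst h * partial1 E (a, t) + snd h * partial2 E (a, t)) * cos (real k * t))) (at (a, t))"
      using frechet_derivative_plane[OF sm o, of "(a, t)"] a
      by (auto intro!: derivative_eq_intros)
    from frechet_derivative_at[OF this, symmetric] show ?thesis by simp
  qed
  have "((\<lambda>a. integral {0..pi} (\<lambda>t. ?G (a, t))) has_derivative
      (\<lambda>h. integral {0..pi} (\<lambda>t. frechet_derivative ?G (at (a, t)) (h, 0)))) (at a)"
    by (rule has_derivative_parametric_integral[OF A o _ sG a]) auto
  then show ?thesis
    unfolding dG snd_conv has_field_derivative_def cosine_coeff_def integral_mult_right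
    by (rule has_derivative_eq_rhs) (simp add: fun_eq_iff mult.commute)
qed

text \<open>D is an argument because differentiating in s replaces it by its derivative; E is one
  because both derivatives change the family.\<close>

definition even_extension :: "(real \<Rightarrow> real) \<Rightarrow> (real \<times> real \<Rightarrow> real) \<Rightarrow> real \<times> real \<Rightarrow> real" where
  "even_extension D E p =
    (\<Sum>k. cosine_weight k * cosine_coeff (\<lambda>b. E (fst p, b)) k * D ((real k)\<^sup>2 * snd p))"

text \<open>Boundedness of D on the whole line makes the estimate independent of s, so the
  Weierstrass test needs compactness in a only.\<close>

lemma even_extension_uniform_limit:
  assumes A: "open A" and E: "even_family A E" and K: "compact K" "K \<subseteq> A"
    and D: "\<And>z. \<bar>D z\<bar> \<le> B"
  shows "uniform_limit (K \<times> UNIV) (\<lambda>n p. \<Sum>k<n. cosine_weight k * cosine_coeff (\<lambda>b. E (fst p, b)) k *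
      D ((real k)\<^sup>2 * snd p)) (even_extension D E) sequentially"
proof -
  obtain M where M: "\<And>a k. a \<in> K \<Longrightarrow> \<bar>cosine_coeff (\<lambda>b. E (a, b)) k\<bar> \<le> M / ((real k)\<^sup>2 + 1)"
    using cosine_coeff_decay[OF A E K] by blast
  have "uniform_limit (K \<times> UNIV) (\<lambda>n p. \<Sum>k<n. cosine_weight k * cosine_coeff (\<lambda>b. E (fst p, b)) k *
      D ((real k)\<^sup>2 * snd p)) (\<lambda>p. \<Sum>k. cosine_weight k * cosine_coeff (\<lambda>b. E (fst p, b)) k *
      D ((real k)\<^sup>2 * snd p)) sequentially"
  proof (rule Weierstrass_m_test[OF _ summable_inverse_square_plus_1])
    fix k and p :: "real \<times> real"
    assume "p \<in> K \<times> UNIV"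
    then have p: "fst p \<in> K" by auto
    have w: "\<bar>cosine_weight k\<bar> \<le> 1"
      using pi_gt3 by (simp add: cosine_weight_def)
    have "\<bar>cosine_weight k * cosine_coeff (\<lambda>b. E (fst p, b)) k * D ((real k)\<^sup>2 * snd p)\<bar>
      \<le> 1 * (M / ((real k)\<^sup>2 + 1)) * B"
      unfolding abs_mult by (intro mult_mono w M[OF p] D mult_nonneg_nonneg abs_ge_zero order_trans[OF abs_ge_zero M[OF p]]) auto
    then show "norm (cosine_weight k * cosine_coeff (\<lambda>b. E (fst p, b)) k * D ((real k)\<^sup>2 * snd p))
      \<le> (M * B) / ((real k)\<^sup>2 + 1)" by simp
  qed
  then show ?thesis unfolding even_extension_def[abs_def] .
qed

text \<open>The factor k^2 from the derivative in s is absorbed by the coefficients: k^2 c_k is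
  minus the coefficient of E_bb, which accounts for the minus sign. The differentiated series is
  thus of the same type and converges uniformly for the same reason.\<close>

lemma has_derivative_even_extension:
  assumes A: "open A" and E: "even_family A E" and a: "fst p \<in> A"
    and D: "\<And>z. (D has_real_derivative D' z) (at z)"
    and B: "\<And>z. \<bar>D z\<bar> \<le> B" and B': "\<And>z. \<bar>D' z\<bar> \<le> B'"
  shows "(even_extension D E has_derivative (\<lambda>h. fst h * even_extension D (partial1 E) p
     - snd h * even_extension D' (partial2 (partial2 E)) p)) (at p)"
proof -
  \<comment> \<open>The closed ball supplies the compact set for the coefficient bounds; the open
    ball times the line is the convex open set on which the series is differentiated.\<close>
  obtain d where d: "d > 0" "cball (fst p) d \<subseteq> A" using A a open_contains_cball by blast
  define K where "K = cball (fst p) d"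
  have K: "compact K" "K \<subseteq> A" using d by (simp_all add: K_def)
  define S where "S = ball (fst p) d \<times> (UNIV :: real set)"
  have S: "open S" "convex S" "p \<in> S" "S \<subseteq> K \<times> UNIV"
    using d(1) by (auto simp: S_def K_def open_Times convex_Times mem_Times_iff)
  note E1 = even_family_partial(1)[OF A E] and E2 = even_family_partial(2)[OF A E]
  define T where "T = (\<lambda>D E k (p :: real \<times> real). cosine_weight k * cosine_coeff (\<lambda>b. E (fst p, b)) k * D ((real k)\<^sup>2 * snd p :: real))"
  define f' where "f' = (\<lambda>k p h :: real \<times> real. fst h * T D (partial1 E) k p - snd h * T D' (partial2 (partial2 E)) k p)"
  define g' where "g' = (\<lambda>p h :: real \<times> real. fst h * even_extension D (partial1 E) p
     - snd h * even_extension D' (partial2 (partial2 E)) p)"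
  have ul: "uniform_limit S (\<lambda>n p. \<Sum>k<n. T D E k p) (even_extension D E) sequentially"
    "uniform_limit S (\<lambda>n p. \<Sum>k<n. T D (partial1 E) k p) (even_extension D (partial1 E)) sequentially"
    "uniform_limit S (\<lambda>n p. \<Sum>k<n. T D' (partial2 (partial2 E)) k p) (even_extension D' (partial2 (partial2 E))) sequentially"
    using even_extension_uniform_limit[OF A E K, of D, OF B] even_extension_uniform_limit[OF A E1 K, of D, OF B]
      even_extension_uniform_limit[OF A E2 K, of D', OF B']
    unfolding T_def by (blast intro: uniform_limit_on_subset[OF _ S(4)])+
  have sums: "(\<lambda>k. T D E k q) sums even_extension D E q" if "q \<in> S" for q
    using tendsto_uniform_limitI[OF ul(1) that] by (simp add: sums_def)
  have "\<exists>g. \<forall>q\<in>S. (\<lambda>k. T D E k q) sums g q \<and> (g has_derivative g' q) (at q within S)"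
  proof (rule has_derivative_series[OF S(2), where f = "T D E" and f' = f' and x = p])
    show "p \<in> S" by (rule S(3))
    show "(\<lambda>k. T D E k p) sums even_extension D E p" by (rule sums[OF S(3)])
  next
    fix k and q :: "real \<times> real"
    assume "q \<in> S"
    then have "q \<in> K \<times> UNIV" using S(4) by blast
    then have q: "fst q \<in> A" using K(2) by auto
    let ?c = "\<lambda>a. cosine_coeff (\<lambda>b. E (a, b)) k"
    have "(fst has_derivative fst) (at q)" "(snd has_derivative snd) (at q)"
      by (intro bounded_linear_imp_has_derivative bounded_linear_fst bounded_linear_snd)+
    note fs = this
    have 1: "((\<lambda>q. ?c (fst q)) has_derivative (\<lambda>h. cosine_coeff (\<lambda>b. partial1 E (fst q, b)) k * fst h)) (at q)"
      using has_derivative_compose[OF fs(1) DERIV_cosine_coeff[OF A E q, of k, unfolded has_field_derivative_def]] .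
    have 2: "((\<lambda>q. D ((real k)\<^sup>2 * snd q)) has_derivative (\<lambda>h. D' ((real k)\<^sup>2 * snd q) * ((real k)\<^sup>2 * snd h))) (at q)"
      using has_derivative_compose[OF has_derivative_mult_right[OF fs(2)] D[unfolded has_field_derivative_def]] .
    have "(T D E k has_derivative (\<lambda>h. cosine_weight k * ?c (fst q) * (D' ((real k)\<^sup>2 * snd q) * ((real k)\<^sup>2 * snd h))
      + cosine_weight k * (cosine_coeff (\<lambda>b. partial1 E (fst q, b)) k * fst h) * D ((real k)\<^sup>2 * snd q))) (at q)"
      unfolding T_def by (intro has_derivative_mult has_derivative_mult_right 1 2)
    moreover have "cosine_weight k * ?c (fst q) * (D' ((real k)\<^sup>2 * snd q) * ((real k)\<^sup>2 * snd h))
      + cosine_weight k * (cosine_coeff (\<lambda>b. partial1 E (fst q, b)) k * fst h) * D ((real k)\<^sup>2 * snd q) = f' k q h" for h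
    proof -
      have "cosine_weight k * ?c (fst q) * (D' ((real k)\<^sup>2 * snd q) * ((real k)\<^sup>2 * snd h)) =
        cosine_weight k * ((real k)\<^sup>2 * ?c (fst q)) * D' ((real k)\<^sup>2 * snd q) * snd h" by simp
      then show ?thesis
        unfolding cosine_coeff_partial2[OF A E q] by (simp add: f'_def T_def)
    qed
    ultimately have "(T D E k has_derivative f' k q) (at q)" by (simp add: fun_eq_iff)
    then show "(T D E k has_derivative f' k q) (at q within S)" by (rule has_derivative_at_withinI)
  next
    fix e :: real assume e: "e > 0"
    have "\<forall>\<^sub>F n in sequentially. \<forall>q\<in>S. dist (\<Sum>k<n. T D (partial1 E) k q) (even_extension D (partial1 E) q) < e / 2"
      "\<forall>\<^sub>F n in sequentially. \<forall>q\<in>S. dist (\<Sum>k<n. T D' (partial2 (partial2 E)) k q)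
         (even_extension D' (partial2 (partial2 E)) q) < e / 2"
      using uniform_limitD[OF ul(2), of "e / 2"] uniform_limitD[OF ul(3), of "e / 2"] e by simp_all
    then show "\<forall>\<^sub>F n in sequentially. \<forall>q\<in>S. \<forall>h. norm ((\<Sum>k<n. f' k q h) - g' q h) \<le> e * norm h"
    proof eventually_elim
      case (elim n)
      show ?case
      proof (intro ballI allI)
        fix q h assume q: "q \<in> S"
        let ?x = "(\<Sum>k<n. T D (partial1 E) k q) - even_extension D (partial1 E) q"
        let ?y = "(\<Sum>k<n. T D' (partial2 (partial2 E)) k q) - even_extension D' (partial2 (partial2 E)) q"
        have xy: "\<bar>?x\<bar> \<le> e / 2" "\<bar>?y\<bar> \<le> e / 2"
          using bspec[OF elim(1) q] bspec[OF elim(2) q] unfolding dist_real_def by linarith+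
        have h: "\<bar>fst h\<bar> \<le> norm h" "\<bar>snd h\<bar> \<le> norm h"
          using norm_fst_le[of "fst h" "snd h"] norm_snd_le[of "snd h" "fst h"] by simp_all
        have "(\<Sum>k<n. f' k q h) - g' q h = fst h * ?x - snd h * ?y"
          by (simp add: f'_def g'_def sum_subtractf sum_distrib_left right_diff_distrib)
        then have "norm ((\<Sum>k<n. f' k q h) - g' q h) \<le> \<bar>fst h\<bar> * \<bar>?x\<bar> + \<bar>snd h\<bar> * \<bar>?y\<bar>"
          unfolding abs_mult[symmetric] by simp
        also have "\<dots> \<le> norm h * (e / 2) + norm h * (e / 2)"
          by (intro add_mono mult_mono h xy) auto
        finally show "norm ((\<Sum>k<n. f' k q h) - g' q h) \<le> e * norm h" by (simp add: field_simps)
      qed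
    qed
  qed
  then obtain g where g: "\<And>q. q \<in> S \<Longrightarrow> (\<lambda>k. T D E k q) sums g q" "(g has_derivative g' p) (at p within S)"
    using S(3) by blast
  have "(g has_derivative g' p) (at p)" using g(2) unfolding at_within_open[OF S(3,1)] .
  then have "(even_extension D E has_derivative g' p) (at p)"
    by (rule has_derivative_transform_within_open[OF _ S(1,3)]) (rule sums_unique2[OF g(1) sums])
  then show ?thesis unfolding g'_def .
qed

text \<open>The induction on the order runs over all j and E at once, since the derivatives involve
  D (j+1) and the families E_a and E_bb.\<close>

lemma smooth_on_even_extension:
  assumes A: "open A" and E: "even_family A E"
    and D: "\<And>j z. (D j has_real_derivative D (Suc j) z) (at z)" "\<And>j. \<exists>B. \<forall>z. \<bar>D j z\<bar> \<le> B"
  shows "smooth_on (A \<times> UNIV) (even_extension (D j) E)"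
proof -
  have o: "open (A \<times> (UNIV :: real set))" by (intro open_Times A open_UNIV)
  have "Ck_on k (A \<times> UNIV) (even_extension (D j) E)" for k
    using E
  proof (induction k arbitrary: j E)
    case 0
    obtain B B' where "\<And>z. \<bar>D j z\<bar> \<le> B" "\<And>z. \<bar>D (Suc j) z\<bar> \<le> B'" using D(2) by metis
    note * = has_derivative_even_extension[OF A 0 _ D(1) this]
    show ?case
      unfolding Ck_on.simps(1)
      by (intro continuous_at_imp_continuous_on ballI has_derivative_continuous[OF *]) auto
  next
    case (Suc k)
    obtain B B' where "\<And>z. \<bar>D j z\<bar> \<le> B" "\<And>z. \<bar>D (Suc j) z\<bar> \<le> B'" using D(2) by metis
    note * = has_derivative_even_extension[OF A Suc.prems _ D(1) this]
    show ?case
    proof (rule Ck_on_SucI[OF o])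
      show "(even_extension (D j) E has_derivative (\<lambda>h. fst h * even_extension (D j) (partial1 E) p
         - snd h * even_extension (D (Suc j)) (partial2 (partial2 E)) p)) (at p)" if "p \<in> A \<times> UNIV" for p
        by (rule *) (use that in auto)
      fix h :: "real \<times> real"
      have "Ck_on k (A \<times> UNIV) (\<lambda>p. fst h * even_extension (D j) (partial1 E) p
         + (- snd h) * even_extension (D (Suc j)) (partial2 (partial2 E)) p)"
        by (intro Ck_on_add o Ck_on_linear_compose[OF o bounded_linear_mult_right] Suc.IH
            even_family_partial[OF A Suc.prems])
      then show "Ck_on k (A \<times> UNIV) (\<lambda>p. fst h * even_extension (D j) (partial1 E) p
         - snd h * even_extension (D (Suc j)) (partial2 (partial2 E)) p)" by simp
    qed
  qed
  then show ?thesis by (simp add: smooth_on_def)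
qed

text \<open>After a cutoff in b the even function is supported in [-1, 1] and equals its cosine
  series on [0, pi]. Replacing cos(kb) by D(k^2 s) gives h for every real s, and D(b^2) = cos b
  gives e(a, b) = h(a, b^2) where the cutoff is 1.\<close>

theorem Whitney_even_function:
  fixes e :: "real \<times> real \<Rightarrow> real"
  assumes A: "open A" and r: "r > 0" and e: "smooth_on (A \<times> {-r<..<r}) e"
    and even: "\<And>a b. a \<in> A \<Longrightarrow> \<bar>b\<bar> < r \<Longrightarrow> e (a, - b) = e (a, b)"
  obtains h d where "smooth_on (A \<times> UNIV) h" "d > 0" "d \<le> r"
    "\<And>a b. a \<in> A \<Longrightarrow> \<bar>b\<bar> < d \<Longrightarrow> e (a, b) = h (a, b\<^sup>2)"
proof -
  \<comment> \<open>The bound 1 places the support inside [-1, 1], as \<open>even_family\<close>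
    requires.\<close>
  define \<rho> where "\<rho> = min r 1"
  have \<rho>: "\<rho> > 0" "\<rho> \<le> r" "\<rho> \<le> 1" using r by (auto simp: \<rho>_def)
  obtain \<theta> :: "real \<Rightarrow> real" where \<theta>: "smooth_on UNIV \<theta>"
    "\<And>x. x \<le> 0 \<Longrightarrow> \<theta> x = 0" "\<And>x. x \<ge> 1 \<Longrightarrow> \<theta> x = 1" using smooth_step by blast
  \<comment> \<open>The argument of the step is at least 1 for b^2 <= rho^2/2 and at most 0 for b^2
    >= 3 rho^2/4. The values rho/2 and 9 rho/10 below are convenient points on the safe sides, as
    1/4 < 1/2 and 81/100 > 3/4.\<close>
  define \<beta> where "\<beta> = (\<lambda>b. \<theta> (3 - 4 / \<rho>\<^sup>2 * b\<^sup>2))"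
  have \<beta>1: "\<beta> b = 1" if "\<bar>b\<bar> < \<rho> / 2" for b
  proof -
    have "\<bar>b\<bar>\<^sup>2 \<le> (\<rho> / 2)\<^sup>2" using that by (intro power_mono) auto
    then have "4 / \<rho>\<^sup>2 * b\<^sup>2 \<le> 1" using \<rho>(1) by (simp add: field_simps)
    then show ?thesis unfolding \<beta>_def by (intro \<theta>(3)) simp
  qed
  have \<beta>0: "\<beta> b = 0" if "\<bar>b\<bar> > 9 / 10 * \<rho>" for b
  proof -
    have "(9 / 10 * \<rho>)\<^sup>2 \<le> \<bar>b\<bar>\<^sup>2" using that \<rho>(1) by (intro power_mono) auto
    then have "100 * b\<^sup>2 \<ge> 81 * \<rho>\<^sup>2" by (simp add: power_mult_distrib power_divide)
    then have "4 * b\<^sup>2 \<ge> 3 * \<rho>\<^sup>2" using zero_le_power2[of \<rho>] by linarith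
    then have "4 / \<rho>\<^sup>2 * b\<^sup>2 \<ge> 3" using \<rho>(1) by (simp add: field_simps)
    then show ?thesis unfolding \<beta>_def by (intro \<theta>(2)) simp
  qed
  define E where "E = (\<lambda>p. if \<bar>snd p\<bar> < \<rho> then e p * \<beta> (snd p) else 0)"
  have sE: "smooth_on (A \<times> UNIV) E"
  proof (rule smooth_on_local)
    show "open (A \<times> (UNIV :: real set))" by (intro open_Times A open_UNIV)
    fix p :: "real \<times> real" assume p: "p \<in> A \<times> UNIV"
    show "\<exists>U. open U \<and> p \<in> U \<and> smooth_on U E"
    proof (cases "\<bar>snd p\<bar> < \<rho>")
      case True
      let ?U = "A \<times> {-\<rho><..<\<rho>}"
      have U: "open ?U" by (intro open_Times A open_greaterThanLessThan)
      have s\<beta>: "smooth_on ?U (\<lambda>p. \<beta> (snd p))"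
        unfolding \<beta>_def
        by (intro smooth_on_compose[OF U open_UNIV _ \<theta>(1)] smooth_intros U) simp
      have "smooth_on ?U e"
        by (rule smooth_on_subset[OF e _ U]) (use \<rho> in auto)
      then have "smooth_on ?U (\<lambda>p. e p * \<beta> (snd p))" by (intro smooth_on_mult U s\<beta>)
      then have "smooth_on ?U E"
        by (rule iffD1[OF smooth_on_cong, rotated]) (auto simp: E_def)
      then show ?thesis using U p True by (intro exI[of _ ?U]) (auto simp: mem_Times_iff)
    next
      case False
      \<comment> \<open>On this set E vanishes, and it overlaps the strip |b| < rho, so the seam |b|
        = rho lies in its interior.\<close>
      let ?U = "A \<times> {b. \<bar>b\<bar> > 9 / 10 * \<rho>}"
      have U: "open ?U" by (intro open_Times A open_Collect_less continuous_intros)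
      have "smooth_on ?U E"
        by (rule iffD1[OF smooth_on_cong smooth_on_const[OF U]]) (auto simp: E_def \<beta>0)
      then show ?thesis using U p False \<rho>(1) by (intro exI[of _ ?U]) (auto simp: mem_Times_iff)
    qed
  qed
  have E: "even_family A E"
    unfolding even_family_def using sE even \<rho> by (auto simp: E_def \<beta>_def)
  obtain D :: "nat \<Rightarrow> real \<Rightarrow> real" where D: "\<And>b. D 0 (b\<^sup>2) = cos b"
    "\<And>j z. (D j has_real_derivative D (Suc j) z) (at z)" "\<And>j. \<exists>M. \<forall>z. \<bar>D j z\<bar> \<le> M"
    using smooth_cos_root_extension by blast
  have h: "even_extension (D 0) E (a, b\<^sup>2) = E (a, b)" if a: "a \<in> A" and b: "b \<in> {0..pi}" for a b
  proof -
    have "compact {a}" "{a} \<subseteq> A" using a by auto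
    then obtain M where M': "\<And>x k. x \<in> {a} \<Longrightarrow> \<bar>cosine_coeff (\<lambda>b. E (x, b)) k\<bar> \<le> M / ((real k)\<^sup>2 + 1)"
      using cosine_coeff_decay[OF A E] by blast
    note M = M'[OF singletonI]
    have "summable (\<lambda>k. \<bar>cosine_coeff (\<lambda>b. E (a, b)) k\<bar>)"
      by (rule summable_comparison_test'[OF summable_inverse_square_plus_1[of M]]) (simp add: M)
    from cosine_series_sums[OF even_family_continuous[OF E a] this b]
    have "(\<lambda>k. cosine_weight k * cosine_coeff (\<lambda>b. E (a, b)) k * D 0 ((real k * b)\<^sup>2)) sums E (a, b)"
      unfolding D(1) .
    from sums_unique[OF this] show ?thesis
      by (simp add: even_extension_def power_mult_distrib)
  qed
  show thesis
  proof
    show "smooth_on (A \<times> UNIV) (even_extension (D 0) E)"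
      by (rule smooth_on_even_extension[where D = D and j = 0, OF A E D(2,3)])
    show "\<rho> / 2 > 0" "\<rho> / 2 \<le> r" using \<rho> by auto
    show "e (a, b) = even_extension (D 0) E (a, b\<^sup>2)" if "a \<in> A" "\<bar>b\<bar> < \<rho> / 2" for a b
    proof -
      \<comment> \<open>The series represents E on [0, pi] only, so b is replaced by |b|, and
        evenness of e leads back to b.\<close>
      have "\<bar>b\<bar> \<in> {0..pi}" using that(2) \<rho> pi_gt3 by simp
      from h[OF that(1) this] have "even_extension (D 0) E (a, b\<^sup>2) = E (a, \<bar>b\<bar>)" by simp
      also have "\<dots> = e (a, \<bar>b\<bar>)" using that \<beta>1[of "\<bar>b\<bar>"] \<rho> by (simp add: E_def)
      also have "\<dots> = e (a, b)" using even[of a b] that \<rho> by (simp add: abs_if)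
      finally show ?thesis by simp
    qed
  qed
qed

section \<open>Equivalence of map germs\<close>

lemma diffeomorphism_onI:
  assumes "open U" "open V" "smooth_on U \<phi>" "smooth_on V \<psi>"
    "\<And>x. x \<in> U \<Longrightarrow> \<phi> x \<in> V" "\<And>y. y \<in> V \<Longrightarrow> \<psi> y \<in> U"
    "\<And>x. x \<in> U \<Longrightarrow> \<psi> (\<phi> x) = x" "\<And>y. y \<in> V \<Longrightarrow> \<phi> (\<psi> y) = y"
  shows "diffeomorphism_on U V \<phi>"
proof -
  have "homeomorphism U V \<phi> \<psi>"
    by (rule homeomorphismI[OF smooth_on_imp_continuous_on[OF assms(3)] smooth_on_imp_continuous_on[OF assms(4)]])
      (use assms(5-8) in auto)
  then show ?thesis unfolding diffeomorphism_on_def using assms by blast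
qed

lemma diffeomorphism_onE:
  assumes "diffeomorphism_on U V \<phi>"
  obtains \<psi> where "open U" "open V" "smooth_on U \<phi>" "smooth_on V \<psi>"
    "\<forall>x\<in>U. \<phi> x \<in> V" "\<forall>y\<in>V. \<psi> y \<in> U"
    "\<forall>x\<in>U. \<psi> (\<phi> x) = x" "\<forall>y\<in>V. \<phi> (\<psi> y) = y"
proof -
  obtain \<psi> where *: "open U" "open V" "homeomorphism U V \<phi> \<psi>" "smooth_on U \<phi>" "smooth_on V \<psi>"
    using assms unfolding diffeomorphism_on_def by blast
  then have "\<phi> ` U = V" "\<psi> ` V = U" "\<forall>x\<in>U. \<psi> (\<phi> x) = x" "\<forall>y\<in>V. \<phi> (\<psi> y) = y"
    unfolding homeomorphism_def by simp_all
  then show thesis using * by (intro that[of \<psi>]) auto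
qed

lemma smooth_on_open_preimage:
  assumes "smooth_on U f" "open U" "open V"
  shows "open {x \<in> U. f x \<in> V}"
proof -
  have "open (U \<inter> f -` V)"
    by (rule continuous_open_preimage[OF smooth_on_imp_continuous_on[OF assms(1)] assms(2,3)])
  then show ?thesis by (simp add: Int_def vimage_def)
qed

lemma diffeomorphism_on_compose:
  assumes 1: "diffeomorphism_on U V \<phi>" and 2: "diffeomorphism_on U' V' \<phi>'"
  obtains V'' where "diffeomorphism_on {x \<in> U. \<phi> x \<in> U'} V'' (\<lambda>x. \<phi>' (\<phi> x))"
proof -
  obtain \<psi> where p: "open U" "open V" "smooth_on U \<phi>" "smooth_on V \<psi>"
    "\<forall>x\<in>U. \<phi> x \<in> V" "\<forall>y\<in>V. \<psi> y \<in> U"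
    "\<forall>x\<in>U. \<psi> (\<phi> x) = x" "\<forall>y\<in>V. \<phi> (\<psi> y) = y"
    using diffeomorphism_onE[OF 1] by blast
  obtain \<psi>' where p': "open U'" "open V'" "smooth_on U' \<phi>'" "smooth_on V' \<psi>'"
    "\<forall>x\<in>U'. \<phi>' x \<in> V'" "\<forall>y\<in>V'. \<psi>' y \<in> U'"
    "\<forall>x\<in>U'. \<psi>' (\<phi>' x) = x" "\<forall>y\<in>V'. \<phi>' (\<psi>' y) = y"
    using diffeomorphism_onE[OF 2] by blast
  let ?U = "{x \<in> U. \<phi> x \<in> U'}" and ?V = "{y \<in> V'. \<psi>' y \<in> V}"
  have o: "open ?U" "open ?V" by (intro smooth_on_open_preimage p p')+
  have "diffeomorphism_on ?U ?V (\<lambda>x. \<phi>' (\<phi> x))"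
  proof (rule diffeomorphism_onI[OF o, where \<psi> = "\<lambda>y. \<psi> (\<psi>' y)"])
    show "smooth_on ?U (\<lambda>x. \<phi>' (\<phi> x))"
      by (rule smooth_on_compose[OF o(1) p'(1) _ p'(3) smooth_on_subset[OF p(3) _ o(1)]]) auto
    show "smooth_on ?V (\<lambda>y. \<psi> (\<psi>' y))"
      by (rule smooth_on_compose[OF o(2) p(2) _ p(4) smooth_on_subset[OF p'(4) _ o(2)]]) auto
  qed (use p p' in auto)
  then show thesis by (rule that)
qed

lemma A_equivalent_trans:
  assumes "A_equivalent f p g q" "A_equivalent g q h r"
  shows "A_equivalent f p h r"
proof -
  obtain U V \<phi> W Z \<Phi> where 1: "diffeomorphism_on U V \<phi>" "p \<in> U" "\<phi> p = q"
    "diffeomorphism_on W Z \<Phi>" "f p \<in> W" "\<Phi> (f p) = g q" "f ` U \<subseteq> W" "\<forall>x\<in>U. \<Phi> (f x) = g (\<phi> x)"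
    using assms(1) unfolding A_equivalent_def by blast
  obtain U' V' \<phi>' W' Z' \<Phi>' where 2: "diffeomorphism_on U' V' \<phi>'" "q \<in> U'" "\<phi>' q = r"
    "diffeomorphism_on W' Z' \<Phi>'" "g q \<in> W'" "\<Phi>' (g q) = h r" "g ` U' \<subseteq> W'" "\<forall>x\<in>U'. \<Phi>' (g x) = h (\<phi>' x)"
    using assms(2) unfolding A_equivalent_def by blast
  obtain V'' where 3: "diffeomorphism_on {x \<in> U. \<phi> x \<in> U'} V'' (\<lambda>x. \<phi>' (\<phi> x))"
    using diffeomorphism_on_compose[OF 1(1) 2(1)] by blast
  obtain Z'' where 4: "diffeomorphism_on {x \<in> W. \<Phi> x \<in> W'} Z'' (\<lambda>x. \<Phi>' (\<Phi> x))"
    using diffeomorphism_on_compose[OF 1(4) 2(4)] by blast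
  show ?thesis
    unfolding A_equivalent_def
    by (intro exI conjI, rule 3, use 1 2 in simp, use 1 2 in simp, rule 4) (use 1 2 in auto)
qed

lemma diffeomorphism_on_ident: "diffeomorphism_on UNIV UNIV (\<lambda>x. x)"
  by (rule diffeomorphism_onI[where \<psi> = "\<lambda>x. x"]) (auto intro: smooth_on_ident)

lemma A_equivalent_source:
  assumes "diffeomorphism_on U V \<phi>" "p \<in> U" "\<phi> p = q" "\<And>x. x \<in> U \<Longrightarrow> f x = g (\<phi> x)"
  shows "A_equivalent f p g q"
  unfolding A_equivalent_def
  by (intro exI conjI, rule assms(1), rule assms(2), rule assms(3), rule diffeomorphism_on_ident)
    (use assms in auto)

lemma diffeomorphism_on_restrict:
  assumes "diffeomorphism_on U V \<phi>" "open U'" "U' \<subseteq> U"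
  shows "diffeomorphism_on U' (\<phi> ` U') \<phi>"
proof -
  obtain \<psi> where p: "open U" "open V" "smooth_on U \<phi>" "smooth_on V \<psi>"
    "\<forall>x\<in>U. \<phi> x \<in> V" "\<forall>y\<in>V. \<psi> y \<in> U"
    "\<forall>x\<in>U. \<psi> (\<phi> x) = x" "\<forall>y\<in>V. \<phi> (\<psi> y) = y"
    using diffeomorphism_onE[OF assms(1)] by blast
  have "\<phi> ` U' = {y \<in> V. \<psi> y \<in> U'}"
  proof (intro equalityI subsetI)
    show "y \<in> {y \<in> V. \<psi> y \<in> U'}" if "y \<in> \<phi> ` U'" for y
      using that p(5,7) assms(3) by auto
    show "y \<in> \<phi> ` U'" if "y \<in> {y \<in> V. \<psi> y \<in> U'}" for y
      using that bspec[OF p(8), of y] by (intro image_eqI[of _ _ "\<psi> y"]) auto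
  qed
  moreover have "open {y \<in> V. \<psi> y \<in> U'}" by (rule smooth_on_open_preimage[OF p(4,2) assms(2)])
  ultimately have o: "open (\<phi> ` U')" "\<phi> ` U' \<subseteq> V" by auto
  show ?thesis
    by (rule diffeomorphism_onI[OF assms(2) o(1) smooth_on_subset[OF p(3) assms(3,2)]
          smooth_on_subset[OF p(4) o(2,1)]]) (use p assms(3) in auto)
qed

lemma A_equivalent_target:
  assumes "diffeomorphism_on W Z \<Phi>" "open U" "p \<in> U" "\<And>x. x \<in> U \<Longrightarrow> f x \<in> W"
    "\<And>x. x \<in> U \<Longrightarrow> \<Phi> (f x) = g x"
  shows "A_equivalent f p g p"
  unfolding A_equivalent_def
  by (intro exI conjI, rule diffeomorphism_on_restrict[OF diffeomorphism_on_ident assms(2) subset_UNIV],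
      rule assms(3), rule refl, rule assms(1)) (use assms in auto)

text \<open>The Jacobian matrix is triangular because one coordinate is kept, so its determinant is
  the single partial derivative assumed to be nonzero.\<close>

lemma fibrewise_inverse_function1:
  fixes K :: "real \<times> real \<Rightarrow> real"
  assumes W: "open W" "smooth_on W K" "p \<in> W" and c: "partial1 K p \<noteq> 0"
  obtains U V where "diffeomorphism_on U V (\<lambda>p. (K p, snd p))" "p \<in> U" "U \<subseteq> W"
proof -
  let ?D = "\<lambda>h :: real \<times> real. (fst h * partial1 K p + snd h * partial2 K p, snd h)"
  have s: "smooth_on W (\<lambda>p. (K p, snd p))" by (intro smooth_intros W)
  have D: "((\<lambda>p. (K p, snd p)) has_derivative ?D) (at p)"
    by (rule has_derivative_Pair[OF frechet_derivative_plane[OF W(2,1,3)]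
          bounded_linear_imp_has_derivative[OF bounded_linear_snd]])
  have "fst (?D (1, 0)) * snd (?D (0, 1)) - fst (?D (0, 1)) * snd (?D (1, 0)) \<noteq> 0" using c by simp
  from plane_inverse_function[OF W(1) s W(3) D this] that show thesis by blast
qed

lemma fibrewise_inverse_function2:
  fixes K :: "real \<times> real \<Rightarrow> real"
  assumes W: "open W" "smooth_on W K" "p \<in> W" and c: "partial2 K p \<noteq> 0"
  obtains U V where "diffeomorphism_on U V (\<lambda>p. (fst p, K p))" "p \<in> U" "U \<subseteq> W"
proof -
  let ?D = "\<lambda>h :: real \<times> real. (fst h, fst h * partial1 K p + snd h * partial2 K p)"
  have s: "smooth_on W (\<lambda>p. (fst p, K p))" by (intro smooth_intros W)
  have D: "((\<lambda>p. (fst p, K p)) has_derivative ?D) (at p)"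
    by (rule has_derivative_Pair[OF bounded_linear_imp_has_derivative[OF bounded_linear_fst]
          frechet_derivative_plane[OF W(2,1,3)]])
  have "fst (?D (1, 0)) * snd (?D (0, 1)) - fst (?D (0, 1)) * snd (?D (1, 0)) \<noteq> 0" using c by simp
  from plane_inverse_function[OF W(1) s W(3) D this] that show thesis by blast
qed

lemma open_vec_preimage13:
  assumes "open U"
  shows "open {y :: real^3. (y $ 1, y $ 3) \<in> U}"
proof -
  have "open ((\<lambda>y :: real^3. (y $ 1, y $ 3)) -` U)"
    by (intro open_vimage assms continuous_intros)
  then show ?thesis by (simp add: vimage_def)
qed

lemma vec3_eqI: "(x :: real^3) $ 1 = y $ 1 \<Longrightarrow> x $ 2 = y $ 2 \<Longrightarrow> x $ 3 = y $ 3 \<Longrightarrow> x = y"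
  by (simp add: vec_eq_iff forall_3)

section \<open>Normal forms of the cross cap\<close>

text \<open>The target map replaces y1 by K(y1, y3), which along the image is K(a, b^2). The form
  becomes (K, bK, b^2), and with u = K(a, b^2), v = b as source coordinates this is (u, uv, v^2).
  Both changes are invertible because K_a is nonzero at the origin.\<close>

lemma cross_cap_if_odd_form:
  fixes K :: "real \<times> real \<Rightarrow> real"
  assumes W: "open W" "(0, 0) \<in> W" and K: "smooth_on W K" "K (0, 0) = 0"
    and K': "((\<lambda>a. K (a, 0)) has_real_derivative c) (at 0)" "c \<noteq> 0"
  shows "cross_cap (\<lambda>(a, b). vector [a, b * K (a, b\<^sup>2), b\<^sup>2]) (0, 0)"
proof -
  let ?F = "\<lambda>p. (K p, snd p)"
  have "partial1 K (0, 0) \<noteq> 0"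
    unfolding DERIV_unique[OF DERIV_partial1[OF K(1) W] K'(1)] by (rule K'(2))
  then obtain U V where UV: "diffeomorphism_on U V ?F" "(0, 0) \<in> U" "U \<subseteq> W"
    by (rule fibrewise_inverse_function1[OF W(1) K(1) W(2)])
  obtain G where Ga: "open U" "open V" and "smooth_on U ?F" and Gb: "smooth_on V G"
    "\<forall>x\<in>U. ?F x \<in> V" "\<forall>y\<in>V. G y \<in> U"
    "\<forall>x\<in>U. G (?F x) = x" "\<forall>y\<in>V. ?F (G y) = y"
    by (rule diffeomorphism_onE[OF UV(1)])
  note G = Ga Gb
  have G2: "snd (G y) = snd y" "K (G y) = fst y" if "y \<in> V" for y
    using arg_cong[OF bspec[OF G(7) that], of snd] arg_cong[OF bspec[OF G(7) that], of fst] by simp_all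
  let ?\<Phi> = "\<lambda>y :: real^3. vector [K (y $ 1, y $ 3), y $ 2, y $ 3] :: real^3"
  let ?\<Psi> = "\<lambda>y :: real^3. vector [fst (G (y $ 1, y $ 3)), y $ 2, y $ 3] :: real^3"
  let ?W = "{y :: real^3. (y $ 1, y $ 3) \<in> U}" and ?Z = "{y :: real^3. (y $ 1, y $ 3) \<in> V}"
  have o: "open ?W" "open ?Z" by (intro open_vec_preimage13 G)+
  have s13: "smooth_on S (\<lambda>y :: real^3. (y $ 1, y $ 3))" if "open S" for S
    by (intro smooth_intros that)
  have \<Phi>: "diffeomorphism_on ?W ?Z ?\<Phi>"
  proof (rule diffeomorphism_onI[OF o, where \<psi> = ?\<Psi>])
    show "smooth_on ?W ?\<Phi>"
      by (intro smooth_intros o smooth_on_compose[OF _ W(1) _ K(1)] s13)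
        (use UV(3) in auto)
    show "smooth_on ?Z ?\<Psi>"
      by (intro smooth_intros o smooth_on_compose[OF _ G(2) _ G(3)] s13)
        auto
    show "?\<Phi> y \<in> ?Z" "?\<Psi> (?\<Phi> y) = y" if "y \<in> ?W" for y
      using bspec[OF G(4), of "(y $ 1, y $ 3)"] bspec[OF G(6), of "(y $ 1, y $ 3)"] that
      by (auto intro!: vec3_eqI)
    show "?\<Psi> y \<in> ?W" "?\<Phi> (?\<Psi> y) = y" if "y \<in> ?Z" for y
    proof -
      have "(y $ 1, y $ 3) \<in> V" using that by simp
      note * = G2[OF this] bspec[OF G(5) this]
      have "(fst (G (y $ 1, y $ 3)), y $ 3) = G (y $ 1, y $ 3)"
        using *(1) by (simp add: prod_eq_iff)
      then show "?\<Psi> y \<in> ?W" "?\<Phi> (?\<Psi> y) = y" using * by (auto intro!: vec3_eqI)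
    qed
  qed
  define m :: "real \<times> real \<Rightarrow> real \<times> real" where "m = (\<lambda>p. (fst p, (snd p)\<^sup>2))"
  have sm: "smooth_on UNIV m"
    unfolding m_def by (intro smooth_intros open_UNIV)
  define N where "N = {p \<in> UNIV. m p \<in> U}"
  have N: "open N" unfolding N_def by (rule smooth_on_open_preimage[OF sm open_UNIV G(1)])
  have N0: "(0, 0) \<in> N" using UV(2) by (simp add: N_def m_def)
  have 1: "A_equivalent (\<lambda>(a, b). vector [a, b * K (a, b\<^sup>2), b\<^sup>2] :: real^3) (0, 0)
      (\<lambda>(a, b). vector [K (a, b\<^sup>2), b * K (a, b\<^sup>2), b\<^sup>2]) (0, 0)"
    by (rule A_equivalent_target[OF \<Phi> N N0]) (auto simp: N_def m_def)
  let ?\<phi> = "\<lambda>p. (K (m p), snd p)"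
  have sKm: "smooth_on N (\<lambda>p. K (m p))"
    by (rule smooth_on_compose[OF N W(1) _ K(1) smooth_on_subset[OF sm _ N]]) (use UV(3) in \<open>auto simp: N_def\<close>)
  \<comment> \<open>On the axis b = 0 the map \<open>m\<close> is the identity, so this derivative
    is again c.\<close>
  have "partial1 (\<lambda>p. K (m p)) (0, 0) \<noteq> 0"
    using DERIV_unique[OF DERIV_partial1[OF sKm N N0]] K' by (auto simp: m_def)
  then obtain U' V' where UV': "diffeomorphism_on U' V' ?\<phi>" "(0, 0) \<in> U'"
    using fibrewise_inverse_function1[OF N sKm N0] by metis
  have "A_equivalent (\<lambda>(a, b). vector [K (a, b\<^sup>2), b * K (a, b\<^sup>2), b\<^sup>2] :: real^3) (0, 0)
     (\<lambda>(u, v). vector [u, u * v, v\<^sup>2]) (0, 0)"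
    by (rule A_equivalent_source[OF UV']) (auto simp: m_def K(2) mult.commute)
  with 1 show ?thesis unfolding cross_cap_def by (rule A_equivalent_trans)
qed

lemma open_slice1: "open {a. (a, b) \<in> V}" and open_slice2: "open {b. (a, b) \<in> V}" if "open V"
  using open_vimage[OF that, of "\<lambda>a. (a, b)"] open_vimage[OF that, of "\<lambda>b. (a, b)"]
  by (simp_all add: vimage_def continuous_intros)

lemma symmetric_interval_star:
  fixes b t r :: real
  assumes "b \<in> {-r<..<r}" "t \<in> {0..1}"
  shows "t * b \<in> {-r<..<r}"
proof -
  have "\<bar>t * b\<bar> \<le> \<bar>b\<bar>" using assms(2) by (simp add: abs_mult mult_left_le_one_le)
  also have "\<dots> < r" using assms(1) by auto
  finally show ?thesis by auto
qed

lemma open_square_subset: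
  fixes W :: "(real \<times> real) set"
  assumes "open W" "(0, 0) \<in> W"
  obtains r where "r > 0" "{-r<..<r} \<times> {-r<..<r} \<subseteq> W"
proof -
  obtain A B where AB: "open A" "open B" "(0::real) \<in> A" "(0::real) \<in> B" "A \<times> B \<subseteq> W"
    using assms by (auto elim: open_prod_elim)
  obtain d1 where d1: "d1 > 0" "ball 0 d1 \<subseteq> A" using AB openE by blast
  obtain d2 where d2: "d2 > 0" "ball 0 d2 \<subseteq> B" using AB openE by blast
  show thesis
  proof
    show "min d1 d2 > 0" using d1 d2 by simp
    have "{-min d1 d2<..<min d1 d2} \<subseteq> A" "{-min d1 d2<..<min d1 d2} \<subseteq> B"
      using d1(2) d2(2) by (auto simp: subset_iff dist_real_def)
    then show "{-min d1 d2<..<min d1 d2} \<times> {-min d1 d2<..<min d1 d2} \<subseteq> W" using AB(5) by blast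
  qed
qed

section \<open>Shears of the target and reduction to the odd form\<close>

lemma diffeomorphism_on_shear2:
  fixes H :: "real \<times> real \<Rightarrow> real"
  assumes "open S" "smooth_on S H"
  shows "diffeomorphism_on {y :: real^3. (y $ 1, y $ 3) \<in> S} {y. (y $ 1, y $ 3) \<in> S}
    (\<lambda>y. vector [y $ 1, y $ 2 - H (y $ 1, y $ 3), y $ 3])"
proof -
  let ?S = "{y :: real^3. (y $ 1, y $ 3) \<in> S}"
  have o: "open ?S" by (rule open_vec_preimage13[OF assms(1)])
  have sH: "smooth_on ?S (\<lambda>y. H (y $ 1, y $ 3))"
    by (rule smooth_on_compose[OF o assms(1) _ assms(2)])
      (auto intro!: smooth_on_Pair smooth_on_vec_nth smooth_on_ident o)
  have s: "smooth_on ?S (\<lambda>y. vector [y $ 1, y $ 2 - H (y $ 1, y $ 3), y $ 3] :: real^3)"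
    "smooth_on ?S (\<lambda>y. vector [y $ 1, y $ 2 + H (y $ 1, y $ 3), y $ 3] :: real^3)"
    by (intro smooth_intros sH o)+
  show ?thesis
    by (rule diffeomorphism_onI[OF o o s]) (auto intro!: vec3_eqI)
qed

lemma diffeomorphism_on_shear3:
  fixes g :: "real \<Rightarrow> real"
  assumes "open A" "smooth_on A g"
  shows "diffeomorphism_on {y :: real^3. y $ 1 \<in> A} {y. y $ 1 \<in> A}
    (\<lambda>y. vector [y $ 1, y $ 2, y $ 3 - g (y $ 1)])"
proof -
  let ?S = "{y :: real^3. y $ 1 \<in> A}"
  have "open ((\<lambda>y :: real^3. y $ 1) -` A)" by (intro open_vimage assms continuous_intros)
  then have o: "open ?S" by (simp add: vimage_def)
  have sg: "smooth_on ?S (\<lambda>y. g (y $ 1))"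
    by (rule smooth_on_compose[OF o assms(1) _ assms(2)])
      (auto intro!: smooth_on_vec_nth smooth_on_ident o)
  have s: "smooth_on ?S (\<lambda>y. vector [y $ 1, y $ 2, y $ 3 - g (y $ 1)] :: real^3)"
    "smooth_on ?S (\<lambda>y. vector [y $ 1, y $ 2, y $ 3 + g (y $ 1)] :: real^3)"
    by (intro smooth_intros sg o)+
  show ?thesis
    by (rule diffeomorphism_onI[OF o o s]) (auto intro!: vec3_eqI)
qed

text \<open>Whitney's theorem is used twice, for the even part of P and for the quotient of its odd
  part by b. The first is a function of the first and third target coordinates and is removed by a
  shear; the second is K, and K(a, 0) = P_b(a, 0) carries the condition on the mixed derivative over
  to K.\<close>

lemma cross_cap_if_fold_form:
  fixes P :: "real \<times> real \<Rightarrow> real"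
  assumes W: "open W" "(0, 0) \<in> W" and P: "smooth_on W P" "partial2 P (0, 0) = 0"
    and P': "((\<lambda>a. partial2 P (a, 0)) has_real_derivative c) (at 0)" "c \<noteq> 0"
  shows "cross_cap (\<lambda>(a, b). vector [a, P (a, b), b\<^sup>2]) (0, 0)"
proof -
  obtain r where r: "r > 0" "{-r<..<r} \<times> {-r<..<r} \<subseteq> W"
    using open_square_subset[OF W] by blast
  define A where "A = {-r<..<r}"
  have A: "open A" "0 \<in> A" "A \<times> A \<subseteq> W" using r by (auto simp: A_def)
  have S: "open (A \<times> A)" by (intro open_Times A)
  have sP: "smooth_on (A \<times> A) P" by (rule smooth_on_subset[OF P(1) A(3) S])
  have sR: "smooth_on (A \<times> A) (\<lambda>p. P (fst p, - snd p))"
  proof (rule smooth_on_compose[OF S S _ sP])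
    show "smooth_on (A \<times> A) (\<lambda>p. (fst p, - snd p))"
      by (intro smooth_intros S)
  qed (auto simp: A_def)
  have eqA: "A \<times> A = A \<times> {-r<..<r}" by (simp add: A_def)
  define e where "e = (\<lambda>p. (P p + P (fst p, - snd p)) * (1 / 2))"
  define q where "q = (\<lambda>p. (P p - P (fst p, - snd p)) * (1 / 2))"
  have se: "smooth_on (A \<times> A) e" and sq: "smooth_on (A \<times> A) q"
    unfolding e_def q_def by (intro smooth_intros sP sR S)+
  have e_even: "e (a, - b) = e (a, b)" if "a \<in> A" "\<bar>b\<bar> < r" for a b
    by (simp add: e_def)
  obtain H d where H: "smooth_on (A \<times> UNIV) H" "d > 0" "d \<le> r"
    "\<And>a b. a \<in> A \<Longrightarrow> \<bar>b\<bar> < d \<Longrightarrow> e (a, b) = H (a, b\<^sup>2)"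
    by (rule Whitney_even_function[OF A(1) r(1) se[unfolded eqA] e_even])
      (simp, simp, rule that, auto)
  have star: "(a, t * b) \<in> A \<times> A" if "(a, b) \<in> A \<times> A" "t \<in> {0..1}" for a b t
    using symmetric_interval_star that unfolding A_def by blast
  obtain k where k: "smooth_on (A \<times> A) k"
    "\<And>a b. (a, b) \<in> A \<times> A \<Longrightarrow> q (a, b) = q (a, 0) + b * k (a, b)"
    "\<And>a b. (a, b) \<in> A \<times> A \<Longrightarrow> k (a, 0) = partial2 q (a, 0)"
    by (rule Hadamard_lemma[OF S sq S star]) (assumption, assumption, rule that, assumption, blast, blast)
  \<comment> \<open>The quotient of an odd function by b is even: cancel b when it is
    nonzero.\<close>
  have k_even: "k (a, - b) = k (a, b)" if "a \<in> A" "\<bar>b\<bar> < r" for a b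
  proof (cases "b = 0")
    case False
    have "q (a, - b) = - q (a, b)" "q (a, 0) = 0" by (simp_all add: q_def field_simps)
    moreover have "q (a, b) = q (a, 0) + b * k (a, b)" "q (a, - b) = q (a, 0) + (- b) * k (a, - b)"
      using that by (intro k(2); auto simp: A_def)+
    ultimately have "b * k (a, - b) = b * k (a, b)" by simp
    then show ?thesis using False by simp
  qed simp
  obtain K d' where K: "smooth_on (A \<times> UNIV) K" "d' > 0" "d' \<le> r"
    "\<And>a b. a \<in> A \<Longrightarrow> \<bar>b\<bar> < d' \<Longrightarrow> k (a, b) = K (a, b\<^sup>2)"
    by (rule Whitney_even_function[OF A(1) r(1) k(1)[unfolded eqA] k_even])
      (simp, simp, rule that, auto)
  \<comment> \<open>Both K(a, 0) and k(a, 0) equal q_b(a, 0), and the even part of P contributes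
    nothing to the derivative at b = 0.\<close>
  have K0: "K (a, 0) = partial2 P (a, 0)" if a: "a \<in> A" for a
  proof -
    have a0: "(a, 0) \<in> A \<times> A" using a A by simp
    have "((\<lambda>b. P (a, - b)) has_real_derivative partial2 P (a, 0) * - 1) (at 0)"
      using DERIV_partial2[OF sP S a0]
      by (intro DERIV_chain2[of "\<lambda>b. P (a, b)"] DERIV_minus DERIV_ident) simp
    from DERIV_cmult_right[OF DERIV_diff[OF DERIV_partial2[OF sP S a0] this], of "1 / 2"]
    have "((\<lambda>b. q (a, b)) has_real_derivative partial2 P (a, 0)) (at 0)" by (simp add: q_def)
    then have "partial2 q (a, 0) = partial2 P (a, 0)"
      using DERIV_unique DERIV_partial2[OF sq S a0] by blast
    then show ?thesis using K(4)[OF a, of 0] k(3)[OF a0] K(2) by simp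
  qed
  have "((\<lambda>a. K (a, 0)) has_real_derivative c) (at 0)"
    by (rule has_field_derivative_transform_within_open[OF P'(1) A(1,2)]) (simp add: K0)
  then have cc: "cross_cap (\<lambda>(a, b). vector [a, b * K (a, b\<^sup>2), b\<^sup>2]) (0, 0)"
    using A P(2) K0[OF A(2)] P'(2) by (intro cross_cap_if_odd_form[of "A \<times> UNIV"] open_Times K(1)) auto
  let ?d = "min d d'"
  have "A_equivalent (\<lambda>(a, b). vector [a, P (a, b), b\<^sup>2] :: real^3) (0, 0)
     (\<lambda>(a, b). vector [a, b * K (a, b\<^sup>2), b\<^sup>2]) (0, 0)"
  proof (rule A_equivalent_target[OF diffeomorphism_on_shear2[OF _ H(1)]])
    show "open (A \<times> {-?d<..<?d})" by (intro open_Times A open_greaterThanLessThan)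
    show "(0, 0) \<in> A \<times> {-?d<..<?d}" using A H(2) K(2) by auto
    fix p assume "p \<in> A \<times> {-?d<..<?d}"
    then obtain a b where p: "p = (a, b)" "a \<in> A" "\<bar>b\<bar> < d" "\<bar>b\<bar> < d'" by auto
    have "P (a, b) = e (a, b) + q (a, b)" by (simp add: e_def q_def field_simps)
    also have "q (a, b) = b * K (a, b\<^sup>2)"
    proof -
      have "\<bar>b\<bar> < r" using p(4) K(3) by simp
      then have "(a, b) \<in> A \<times> A" using p(2) by (auto simp: A_def)
      from k(2)[OF this] show ?thesis using K(4)[OF p(2,4)] by (simp add: q_def)
    qed
    finally have "P (a, b) - H (a, b\<^sup>2) = b * K (a, b\<^sup>2)" using H(4)[OF p(2,3)] by simp
    then show "(\<lambda>y :: real^3. vector [y $ 1, y $ 2 - H (y $ 1, y $ 3), y $ 3] :: real^3)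
        ((\<lambda>(a, b). vector [a, P (a, b), b\<^sup>2]) p) = (\<lambda>(a, b). vector [a, b * K (a, b\<^sup>2), b\<^sup>2]) p"
      unfolding p(1) by (auto intro!: vec3_eqI)
    show "(\<lambda>(a, b). vector [a, P (a, b), b\<^sup>2] :: real^3) p \<in> {y. (y $ 1, y $ 3) \<in> A \<times> UNIV}"
      using p by simp
  qed (intro open_Times A open_UNIV)
  then show ?thesis using cc unfolding cross_cap_def by (rule A_equivalent_trans)
qed

text \<open>The inverse of a map that keeps the first coordinate also keeps it, so it is described
  by its second component alone.\<close>

lemma fibrewise_inverse2E:
  fixes K :: "real \<times> real \<Rightarrow> real"
  assumes W: "open W" "smooth_on W K" "p \<in> W" and c: "partial2 K p \<noteq> 0"
  obtains U V \<psi> where "open U" "open V" "p \<in> U" "U \<subseteq> W" "(fst p, K p) \<in> V" "smooth_on V \<psi>"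
    "diffeomorphism_on U V (\<lambda>p. (fst p, K p))"
    "\<forall>y\<in>V. (fst y, \<psi> y) \<in> U \<and> K (fst y, \<psi> y) = snd y" "\<forall>x\<in>U. \<psi> (fst x, K x) = snd x"
proof -
  obtain U V where UV: "diffeomorphism_on U V (\<lambda>p. (fst p, K p))" "p \<in> U" "U \<subseteq> W"
    using fibrewise_inverse_function2[OF W c] by metis
  obtain \<psi> where o: "open U" "open V" and "smooth_on U (\<lambda>p. (fst p, K p))" and s: "smooth_on V \<psi>"
    and 1: "\<forall>x\<in>U. (fst x, K x) \<in> V" and 2: "\<forall>y\<in>V. \<psi> y \<in> U"
    and 3: "\<forall>x\<in>U. \<psi> (fst x, K x) = x" and 4: "\<forall>y\<in>V. (fst (\<psi> y), K (\<psi> y)) = y"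
    by (rule diffeomorphism_onE[OF UV(1)])
  have "(fst y, snd (\<psi> y)) = \<psi> y" "K (\<psi> y) = snd y" if "y \<in> V" for y
    using arg_cong[OF bspec[OF 4 that], of fst] arg_cong[OF bspec[OF 4 that], of snd]
    by (simp_all add: prod_eq_iff)
  then have "\<forall>y\<in>V. (fst y, snd (\<psi> y)) \<in> U \<and> K (fst y, snd (\<psi> y)) = snd y"
    using 2 by simp
  moreover have "smooth_on V (\<lambda>y. snd (\<psi> y))" by (intro smooth_on_snd o s)
  moreover have "\<forall>x\<in>U. snd (\<psi> (fst x, K x)) = snd x" using 3 by simp
  moreover have "(fst p, K p) \<in> V" using bspec[OF 1 UV(2)] .
  ultimately show thesis using o UV by (intro that[of U V "\<lambda>y. snd (\<psi> y)"])
qed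

text \<open>For each a the critical point tau(a) of Q(a, .) is moved to b = 0. Applying Hadamard's
  lemma twice gives q(a, b) = q(a, 0) + b^2 R(a, b) with R(0, 0) = d/2 > 0, so b sqrt(R) is the new
  coordinate.\<close>

lemma parametric_Morse_lemma:
  fixes Q :: "real \<times> real \<Rightarrow> real"
  assumes W: "open W" "(0, 0) \<in> W" and Q: "smooth_on W Q" "partial2 Q (0, 0) = 0"
    and Qt: "((\<lambda>t. partial2 Q (0, t)) has_real_derivative d) (at 0)" "d > 0"
  obtains A M g \<beta> where "open A" "open M" "(0, 0) \<in> M" "M \<subseteq> W" "fst ` M \<subseteq> A"
    "smooth_on A g" "smooth_on M \<beta>" "\<beta> (0, 0) = 0" "partial2 \<beta> (0, 0) \<noteq> 0"
    "\<forall>p\<in>M. Q p = g (fst p) + (\<beta> p)\<^sup>2"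
proof -
  let ?Q2 = "partial2 Q"
  have sQ2: "smooth_on W ?Q2" by (rule smooth_on_frechet_derivative[OF Q(1) W(1)])
  have "partial2 ?Q2 (0, 0) = d"
    using DERIV_unique[OF DERIV_partial2[OF sQ2 W] Qt(1)] .
  then have "partial2 ?Q2 (0, 0) \<noteq> 0" using Qt(2) by simp
  then obtain U V \<psi> where U: "open U" "open V" "(0, 0) \<in> U" "U \<subseteq> W" "(fst (0 :: real, 0 :: real), ?Q2 (0, 0)) \<in> V"
    "smooth_on V \<psi>"
    and "diffeomorphism_on U V (\<lambda>p. (fst p, ?Q2 p))"
    and \<psi>: "\<forall>y\<in>V. (fst y, \<psi> y) \<in> U \<and> ?Q2 (fst y, \<psi> y) = snd y" "\<forall>x\<in>U. \<psi> (fst x, ?Q2 x) = snd x"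
    by (rule fibrewise_inverse2E[OF W(1) sQ2 W(2)])
  define i :: "real \<Rightarrow> real \<times> real" where "i = (\<lambda>a. (a, 0))"
  have si: "smooth_on UNIV i" unfolding i_def by (intro smooth_intros open_UNIV)
  define A0 where "A0 = {a \<in> UNIV. i a \<in> V}"
  have A0: "open A0" "0 \<in> A0"
    unfolding A0_def using smooth_on_open_preimage[OF si open_UNIV U(2)] U(5) Q(2) by (simp_all add: i_def)
  \<comment> \<open>The function psi inverts Q_t in its second argument, so its value at (a, 0) is
    the zero of Q_t(a, .).\<close>
  define \<tau> where "\<tau> = (\<lambda>a. \<psi> (i a))"
  have s\<tau>: "smooth_on A0 \<tau>"
    unfolding \<tau>_def by (rule smooth_on_compose[OF A0(1) U(2) _ U(6) smooth_on_subset[OF si subset_UNIV A0(1)]])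
      (auto simp: A0_def)
  have \<tau>: "(a, \<tau> a) \<in> W" "?Q2 (a, \<tau> a) = 0" if "a \<in> A0" for a
    using bspec[OF \<psi>(1), of "i a"] that U(4) by (auto simp: A0_def \<tau>_def i_def)
  have \<tau>0: "\<tau> 0 = 0" using bspec[OF \<psi>(2) U(3)] Q(2) by (simp add: \<tau>_def i_def)
  have A0U: "open (A0 \<times> (UNIV :: real set))" by (intro open_Times A0 open_UNIV)
  have s\<tau>f: "smooth_on (A0 \<times> UNIV) (\<lambda>p :: real \<times> real. \<tau> (fst p))"
    by (rule smooth_on_compose[OF A0U A0(1) _ s\<tau> smooth_on_fst[OF A0U smooth_on_ident[OF A0U]]]) auto
  \<comment> \<open>The map sigma straightens the curve of critical points to the axis b = 0, and
    kappa is its inverse.\<close>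
  define \<sigma> where "\<sigma> = (\<lambda>p :: real \<times> real. (fst p, \<tau> (fst p) + snd p))"
  define \<kappa> where "\<kappa> = (\<lambda>p :: real \<times> real. (fst p, snd p - \<tau> (fst p)))"
  have s\<sigma>: "smooth_on (A0 \<times> UNIV) \<sigma>" and s\<kappa>: "smooth_on (A0 \<times> UNIV) \<kappa>"
    unfolding \<sigma>_def \<kappa>_def
    by (intro smooth_intros s\<tau>f A0U)+
  define S where "S = {p \<in> A0 \<times> UNIV. \<sigma> p \<in> W}"
  have S: "open S" "(0, 0) \<in> S"
    unfolding S_def using smooth_on_open_preimage[OF s\<sigma> A0U W(1)] A0 W(2) \<tau>0 by (simp_all add: \<sigma>_def)
  define q where "q = (\<lambda>p. Q (\<sigma> p))"
  have sq: "smooth_on S q"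
    unfolding q_def
    by (rule smooth_on_compose[OF S(1) W(1) _ Q(1) smooth_on_subset[OF s\<sigma> _ S(1)]]) (auto simp: S_def)
  have q2: "partial2 q (a, b) = ?Q2 (a, \<tau> a + b)" if "(a, b) \<in> S" for a b
  proof -
    have "(a, \<tau> a + b) \<in> W" using that by (simp add: S_def \<sigma>_def)
    from DERIV_partial2[OF Q(1) W(1) this]
    have "((\<lambda>b. Q (a, \<tau> a + b)) has_real_derivative ?Q2 (a, \<tau> a + b) * (0 + 1)) (at b)"
      by (intro DERIV_chain2[of "\<lambda>t. Q (a, t)"] DERIV_add DERIV_const DERIV_ident) simp
    then show ?thesis using DERIV_unique[OF DERIV_partial2[OF sq S(1) that]] by (simp add: q_def \<sigma>_def)
  qed
  obtain r where r: "r > 0" "{-r<..<r} \<times> {-r<..<r} \<subseteq> S" using open_square_subset[OF S] by blast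
  define A where "A = {-r<..<r}"
  have A: "open A" "0 \<in> A" "A \<times> A \<subseteq> S" using r by (auto simp: A_def)
  have AA: "open (A \<times> A)" by (intro open_Times A)
  have AA0: "A \<subseteq> A0" using A(2,3) by (auto simp: S_def)
  have star: "(a, t * b) \<in> A \<times> A" if "(a, b) \<in> A \<times> A" "t \<in> {0..1}" for a b t
    using symmetric_interval_star that unfolding A_def by blast
  have sqA: "smooth_on (A \<times> A) q" by (rule smooth_on_subset[OF sq A(3) AA])
  obtain k where k: "smooth_on (A \<times> A) k"
    "\<And>a b. (a, b) \<in> A \<times> A \<Longrightarrow> q (a, b) = q (a, 0) + b * k (a, b)"
    "\<And>a b. (a, b) \<in> A \<times> A \<Longrightarrow> k (a, 0) = partial2 q (a, 0)"
    by (rule Hadamard_lemma[OF AA sqA AA star]) (assumption, assumption, rule that, assumption, blast, blast)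
  obtain R where R: "smooth_on (A \<times> A) R"
    "\<And>a b. (a, b) \<in> A \<times> A \<Longrightarrow> k (a, b) = k (a, 0) + b * R (a, b)"
    "\<And>a b. (a, b) \<in> A \<times> A \<Longrightarrow> R (a, 0) = partial2 k (a, 0)"
    by (rule Hadamard_lemma[OF AA k(1) AA star]) (assumption, assumption, rule that, assumption, blast, blast)
  have qR: "q (a, b) = q (a, 0) + b\<^sup>2 * R (a, b)" if "(a, b) \<in> A \<times> A" for a b
  proof -
    have a: "a \<in> A0" "(a, 0) \<in> S" using that AA0 A by auto
    have "k (a, 0) = 0" using k(3)[OF that] q2[OF a(2)] \<tau>(2)[OF a(1)] by simp
    then show ?thesis using k(2)[OF that] R(2)[OF that] by (simp add: power2_eq_square mult.assoc)
  qed
  \<comment> \<open>Differentiating q(0, 0) + b^2 R(0, b) twice at b = 0 gives 2 R(0, 0). Since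
    tau(0) = 0, this is the second derivative d of Q(0, .).\<close>
  have R0: "R (0, 0) > 0"
  proof -
    have DR: "((\<lambda>b. R (0, b)) has_real_derivative partial2 R (0, b)) (at b)" if "b \<in> A" for b
      using A that by (intro DERIV_partial2[OF R(1) AA]) simp
    have sR2: "smooth_on (A \<times> A) (partial2 R)" by (rule smooth_on_frechet_derivative[OF R(1) AA])
    have DR2: "((\<lambda>b. partial2 R (0, b)) has_real_derivative partial2 (partial2 R) (0, 0)) (at 0)"
      using A by (intro DERIV_partial2[OF sR2 AA]) simp
    have sqr: "((\<lambda>b :: real. b\<^sup>2) has_real_derivative 2 * b) (at b)" for b
      by (auto intro!: derivative_eq_intros)
    have eq: "?Q2 (0, b) = 2 * b * R (0, b) + b\<^sup>2 * partial2 R (0, b)" if b: "b \<in> A" for b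
    proof -
      have b': "(0, b) \<in> S" using A b by auto
      have "((\<lambda>b. q (0, 0) + b\<^sup>2 * R (0, b)) has_real_derivative 0 + ((2 * b) * R (0, b) + partial2 R (0, b) * b\<^sup>2)) (at b)"
        by (intro DERIV_add DERIV_const DERIV_mult sqr DR[OF b])
      then have "((\<lambda>b. q (0, b)) has_real_derivative 0 + ((2 * b) * R (0, b) + partial2 R (0, b) * b\<^sup>2)) (at b)"
        by (rule has_field_derivative_transform_within_open[OF _ A(1) b])
          (rule qR[symmetric], simp add: A(2))
      then show ?thesis using DERIV_unique[OF DERIV_partial2[OF sq S(1) b']] q2[OF b'] \<tau>0 by simp
    qed
    have "((\<lambda>b. 2 * b * R (0, b) + b\<^sup>2 * partial2 R (0, b)) has_real_derivative
        ((2 * 1) * R (0, 0) + partial2 R (0, 0) * (2 * 0)) + ((2 * 0) * partial2 R (0, 0) + partial2 (partial2 R) (0, 0) * 0\<^sup>2)) (at 0)"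
    proof (intro DERIV_add DERIV_mult DR DR2 A(2))
      show "((\<lambda>b. 2 * b) has_real_derivative 2 * 1) (at 0)" by (rule DERIV_cmult[OF DERIV_ident])
      show "((\<lambda>b :: real. b\<^sup>2) has_real_derivative 2 * 0) (at 0)" by (rule sqr)
    qed
    then have "((\<lambda>b. 2 * b * R (0, b) + b\<^sup>2 * partial2 R (0, b)) has_real_derivative 2 * R (0, 0)) (at 0)"
      by simp
    then have "((\<lambda>b. ?Q2 (0, b)) has_real_derivative 2 * R (0, 0)) (at 0)"
      by (rule has_field_derivative_transform_within_open[OF _ A(1,2)]) (rule eq[symmetric])
    from DERIV_unique[OF this Qt(1)] Qt(2) show ?thesis by simp
  qed
  define N where "N = {p \<in> A \<times> A. R p \<in> {0<..}}"
  have N: "open N" "(0, 0) \<in> N"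
    unfolding N_def using smooth_on_open_preimage[OF R(1) AA open_greaterThan] A R0 by auto
  define \<rho> where "\<rho> = (\<lambda>p. sqrt (R p))"
  have s\<rho>: "smooth_on N \<rho>"
    unfolding \<rho>_def by (rule smooth_on_sqrt[OF N(1) smooth_on_subset[OF R(1) _ N(1)]]) (auto simp: N_def)
  define M where "M = {p \<in> A0 \<times> UNIV. \<kappa> p \<in> N}"
  have M: "open M" "(0, 0) \<in> M"
    unfolding M_def using smooth_on_open_preimage[OF s\<kappa> A0U N(1)] N(2) A0(2) \<tau>0 by (simp_all add: \<kappa>_def)
  have s\<kappa>M: "smooth_on M \<kappa>" by (rule smooth_on_subset[OF s\<kappa> _ M(1)]) (auto simp: M_def)
  have s\<rho>M: "smooth_on M (\<lambda>p. \<rho> (\<kappa> p))"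
    by (rule smooth_on_compose[OF M(1) N(1) _ s\<rho> s\<kappa>M]) (auto simp: M_def)
  define \<beta> where "\<beta> = (\<lambda>p. snd (\<kappa> p) * \<rho> (\<kappa> p))"
  have s\<beta>: "smooth_on M \<beta>" unfolding \<beta>_def by (intro smooth_intros s\<kappa>M s\<rho>M M)
  have MN: "(fst p, snd p - \<tau> (fst p)) \<in> N" "fst p \<in> A" if "p \<in> M" for p
    using that by (auto simp: M_def \<kappa>_def N_def)
  have "partial2 \<beta> (0, 0) = \<rho> (0, 0)"
  proof -
    have "((\<lambda>t. t * \<rho> (\<kappa> (0, t))) has_real_derivative 1 * \<rho> (\<kappa> (0, 0)) + partial2 (\<lambda>p. \<rho> (\<kappa> p)) (0, 0) * 0) (at 0)"
      by (intro DERIV_mult DERIV_ident DERIV_partial2[OF s\<rho>M M])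
    then show ?thesis using DERIV_unique[OF DERIV_partial2[OF s\<beta> M]] by (simp add: \<beta>_def \<kappa>_def \<tau>0)
  qed
  then have \<beta>2: "partial2 \<beta> (0, 0) \<noteq> 0" using R0 by (simp add: \<rho>_def)
  have Q\<beta>: "Q p = q (fst p, 0) + (\<beta> p)\<^sup>2" if "p \<in> M" for p
  proof -
    have "Q p = q (fst p, snd p - \<tau> (fst p))" by (simp add: q_def \<sigma>_def)
    also have "\<dots> = q (fst p, 0) + (snd p - \<tau> (fst p))\<^sup>2 * R (fst p, snd p - \<tau> (fst p))"
      using MN[OF that] by (intro qR) (auto simp: N_def)
    also have "R (fst p, snd p - \<tau> (fst p)) = (\<rho> (\<kappa> p))\<^sup>2"
      using MN[OF that] by (simp add: N_def \<rho>_def \<kappa>_def)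
    finally show ?thesis by (simp add: \<beta>_def \<kappa>_def power_mult_distrib)
  qed
  have "smooth_on A (\<lambda>a. q (i a))"
    by (rule smooth_on_compose[OF A(1) AA _ sqA smooth_on_subset[OF si subset_UNIV A(1)]])
      (use A in \<open>auto simp: i_def\<close>)
  moreover have "M \<subseteq> W"
  proof
    fix p assume "p \<in> M"
    then have "\<kappa> p \<in> S" using A(3) by (auto simp: M_def N_def)
    then show "p \<in> W" by (simp add: S_def \<sigma>_def \<kappa>_def)
  qed
  moreover have "\<beta> (0, 0) = 0" by (simp add: \<beta>_def \<kappa>_def \<tau>0)
  ultimately show thesis
    using A(1) M \<beta>2 s\<beta> Q\<beta> MN(2) by (intro that[of A M "\<lambda>a. q (i a)" \<beta>]) (auto simp: i_def)
qed

text \<open>In the Morse coordinate b = beta(a, t), with inverse t = T(a, b), the second component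
  has b-derivative P_t(a, T) T_b. Its a-derivative at the origin is c T_b: the motion of T with a
  contributes a multiple of P_tt = 0, and the derivative of T_b is multiplied by P_t = 0.\<close>

lemma cross_cap_if_corank_one:
  fixes P Q :: "real \<times> real \<Rightarrow> real"
  assumes W: "open W" "(0, 0) \<in> W" and P: "smooth_on W P" "partial2 P (0, 0) = 0"
    and Q: "smooth_on W Q" "partial2 Q (0, 0) = 0"
    and Pt: "((\<lambda>t. partial2 P (0, t)) has_real_derivative 0) (at 0)"
    and Pa: "((\<lambda>a. partial2 P (a, 0)) has_real_derivative c) (at 0)" "c \<noteq> 0"
    and Qt: "((\<lambda>t. partial2 Q (0, t)) has_real_derivative d) (at 0)" "d > 0"
  shows "cross_cap (\<lambda>(a, t). vector [a, P (a, t), Q (a, t)]) (0, 0)"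
proof -
  obtain A M g \<beta> where A: "open A" and M: "open M" "(0, 0) \<in> M" "M \<subseteq> W" "fst ` M \<subseteq> A"
    and g: "smooth_on A g" and \<beta>: "smooth_on M \<beta>" "\<beta> (0, 0) = 0" "partial2 \<beta> (0, 0) \<noteq> 0"
    and Q\<beta>: "\<forall>p\<in>M. Q p = g (fst p) + (\<beta> p)\<^sup>2"
    by (rule parametric_Morse_lemma[OF W Q Qt])
  obtain U V T where U: "open U" "open V" "(0, 0) \<in> U" "U \<subseteq> M" and V: "(fst (0 :: real, 0 :: real), \<beta> (0, 0)) \<in> V"
    and T: "smooth_on V T" and UV: "diffeomorphism_on U V (\<lambda>p. (fst p, \<beta> p))"
    and T1: "\<forall>y\<in>V. (fst y, T y) \<in> U \<and> \<beta> (fst y, T y) = snd y"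
    and T2: "\<forall>x\<in>U. T (fst x, \<beta> x) = snd x"
    by (rule fibrewise_inverse2E[OF M(1) \<beta>(1) M(2) \<beta>(3)])
  have V0: "(0, 0) \<in> V" using V \<beta>(2) by simp
  have T0: "T (0, 0) = 0" using bspec[OF T2 U(3)] \<beta>(2) by simp
  have UW: "U \<subseteq> W" using U(4) M(3) by blast
  define P2 where "P2 = (\<lambda>y. P (fst y, T y))"
  have sFT: "smooth_on V (\<lambda>y. (fst y, T y))"
    by (intro smooth_intros T U(2))
  have sP2: "smooth_on V P2"
    unfolding P2_def by (rule smooth_on_compose[OF U(2) W(1) _ P(1) sFT]) (use T1 UW in auto)
  have DT: "((\<lambda>b. T (a, b)) has_real_derivative partial2 T (a, b)) (at b)" if "(a, b) \<in> V" for a b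
    by (rule DERIV_partial2[OF T U(2) that])
  have P22: "partial2 P2 (a, b) = partial2 P (a, T (a, b)) * partial2 T (a, b)" if ab: "(a, b) \<in> V" for a b
  proof -
    have "(a, T (a, b)) \<in> W" using bspec[OF T1 ab] UW by auto
    from DERIV_chain2[OF DERIV_partial2[OF P(1) W(1) this] DT[OF ab]]
    have "((\<lambda>b. P2 (a, b)) has_real_derivative partial2 P (a, T (a, b)) * partial2 T (a, b)) (at b)"
      by (simp add: P2_def)
    then show ?thesis using DERIV_unique[OF DERIV_partial2[OF sP2 U(2) ab]] by blast
  qed
  \<comment> \<open>Differentiating beta(0, T(0, b)) = b shows that T_b is nonzero at the
    origin.\<close>
  have T20: "partial2 T (0, 0) \<noteq> 0"
  proof -
    have m: "(0, T (0, 0)) \<in> M" using M(2) T0 by simp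
    have "((\<lambda>b. \<beta> (0, T (0, b))) has_real_derivative partial2 \<beta> (0, T (0, 0)) * partial2 T (0, 0)) (at 0)"
      by (rule DERIV_chain2[OF DERIV_partial2[OF \<beta>(1) M(1) m] DT[OF V0]])
    moreover have "((\<lambda>b. \<beta> (0, T (0, b))) has_real_derivative 1) (at 0)"
    proof (rule has_field_derivative_transform_within_open[OF DERIV_ident])
      show "open {b. (0, b) \<in> V}" by (rule open_slice2[OF U(2)])
    qed (use V0 T1 in auto)
    ultimately have "partial2 \<beta> (0, T (0, 0)) * partial2 T (0, 0) = 1" by (rule DERIV_unique)
    then show ?thesis by auto
  qed
  have "((\<lambda>a. partial2 P (a, T (a, 0))) has_real_derivative c) (at 0)"
  proof -
    have sPt: "smooth_on W (partial2 P)" by (rule smooth_on_frechet_derivative[OF P(1) W(1)])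
    have "partial1 (partial2 P) (0, 0) = c" "partial2 (partial2 P) (0, 0) = 0"
      using DERIV_unique[OF DERIV_partial1[OF sPt W] Pa(1)] DERIV_unique[OF DERIV_partial2[OF sPt W] Pt] .
    with frechet_derivative_plane[OF sPt W] have 1: "(partial2 P has_derivative (\<lambda>h. fst h * c)) (at (0, T (0, 0)))"
      by (simp add: T0)
    have 2: "((\<lambda>a. (a, T (a, 0))) has_derivative (\<lambda>h. (h, partial1 T (0, 0) * h))) (at 0)"
      using DERIV_partial1[OF T U(2) V0] unfolding has_field_derivative_def
      by (intro has_derivative_Pair has_derivative_ident)
    from has_derivative_compose[OF 2 1] show ?thesis
      by (simp add: has_field_derivative_def mult.commute[of _ c])
  qed
  moreover have sT2: "smooth_on V (partial2 T)" by (rule smooth_on_frechet_derivative[OF T U(2)])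
  ultimately have "((\<lambda>a. partial2 P (a, T (a, 0)) * partial2 T (a, 0)) has_real_derivative
      c * partial2 T (0, 0) + partial1 (partial2 T) (0, 0) * partial2 P (0, T (0, 0))) (at 0)"
    by (intro DERIV_mult DERIV_partial1[OF _ U(2) V0])
  then have "((\<lambda>a. partial2 P (a, T (a, 0)) * partial2 T (a, 0)) has_real_derivative c * partial2 T (0, 0)) (at 0)"
    using P(2) by (simp add: T0)
  then have D: "((\<lambda>a. partial2 P2 (a, 0)) has_real_derivative c * partial2 T (0, 0)) (at 0)"
  proof (rule has_field_derivative_transform_within_open)
    show "open {a. (a, 0) \<in> V}" by (rule open_slice1[OF U(2)])
  qed (use V0 P22 in auto)
  have "cross_cap (\<lambda>(a, b). vector [a, P2 (a, b), b\<^sup>2]) (0, 0)"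
    by (rule cross_cap_if_fold_form[OF U(2) V0 sP2 _ D]) (use P22[OF V0] P(2) T0 T20 Pa(2) in auto)
  moreover have "A_equivalent (\<lambda>(a, t). vector [a, P (a, t), (\<beta> (a, t))\<^sup>2] :: real^3) (0, 0)
      (\<lambda>(a, b). vector [a, P2 (a, b), b\<^sup>2]) (0, 0)"
    by (rule A_equivalent_source[OF UV U(3)]) (use \<beta>(2) T2 in \<open>auto simp: P2_def\<close>)
  moreover have "A_equivalent (\<lambda>(a, t). vector [a, P (a, t), Q (a, t)] :: real^3) (0, 0)
      (\<lambda>(a, t). vector [a, P (a, t), (\<beta> (a, t))\<^sup>2]) (0, 0)"
    by (rule A_equivalent_target[OF diffeomorphism_on_shear3[OF A g] M(1,2)])
      (use M(4) Q\<beta> in \<open>auto intro!: vec3_eqI\<close>)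
  ultimately show ?thesis unfolding cross_cap_def by (blast intro: A_equivalent_trans)
qed

section \<open>Cross caps of translation surfaces\<close>

lemma DERIV_inner:
  "(f has_vector_derivative f') (at x) \<Longrightarrow> ((\<lambda>x. \<xi> \<bullet> f x) has_real_derivative \<xi> \<bullet> f') (at x)"
  unfolding has_real_derivative_iff_has_vector_derivative
  by (rule bounded_linear.has_vector_derivative[OF bounded_linear_inner_right])

text \<open>Cramer's rule in space with denominators cleared: up to the factor a . (b x c), the
  cross products of pairs form the dual basis.\<close>

lemma cross3_dual_basis:
  fixes a b c d :: "real^3"
  shows "(cross3 b c \<bullet> d) *\<^sub>R a + (cross3 c a \<bullet> d) *\<^sub>R b + (cross3 a b \<bullet> d) *\<^sub>R c = (a \<bullet> cross3 b c) *\<^sub>R d"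
  by (rule vec3_eqI) (simp_all add: cross3_def inner_vec_def sum_3 algebra_simps)

text \<open>The vectors x, y, z are dual to gamma', gamma'', delta''. The coordinate along x serves
  as parameter a in place of u, and t = v - v0. For zeta orthogonal to gamma', the coordinate along
  zeta has tt-derivative c^2 (zeta . gamma'') + zeta . delta'' and at-derivative -c (zeta . gamma'')
  at the origin.\<close>

theorem cross_cap_translation_surface:
  fixes \<gamma> \<delta> \<gamma>1 \<delta>1 :: "real \<Rightarrow> real^3"
  assumes I: "open I" "u0 \<in> I" "smooth_on I \<gamma>" and J: "open J" "v0 \<in> J" "smooth_on J \<delta>"
    and \<gamma>1: "\<And>u. u \<in> I \<Longrightarrow> (\<gamma> has_vector_derivative \<gamma>1 u) (at u)" "(\<gamma>1 has_vector_derivative g2) (at u0)"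
    and \<delta>1: "\<And>v. v \<in> J \<Longrightarrow> (\<delta> has_vector_derivative \<delta>1 v) (at v)" "(\<delta>1 has_vector_derivative h2) (at v0)"
    and c: "\<delta>1 v0 = c *\<^sub>R \<gamma>1 u0" "c \<noteq> 0" and triple: "\<gamma>1 u0 \<bullet> cross3 g2 h2 \<noteq> 0"
  shows "cross_cap (translation_surface \<gamma> \<delta>) (u0, v0)"
proof -
  define \<Delta> where "\<Delta> = \<gamma>1 u0 \<bullet> cross3 g2 h2"
  define x where "x = (1 / \<Delta>) *\<^sub>R cross3 g2 h2"
  define y where "y = (1 / \<Delta>) *\<^sub>R cross3 h2 (\<gamma>1 u0)"
  define z where "z = (1 / \<Delta>) *\<^sub>R cross3 (\<gamma>1 u0) g2"
  \<comment> \<open>Chosen so that the tt-derivative c^2 - c^2 vanishes while the at-derivative is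
    -c; the coordinate along z has tt-derivative 1.\<close>
  define \<xi> where "\<xi> = y - c\<^sup>2 *\<^sub>R z"
  have \<Delta>: "\<Delta> \<noteq> 0" "cross3 g2 h2 \<bullet> \<gamma>1 u0 = \<Delta>" "cross3 h2 (\<gamma>1 u0) \<bullet> g2 = \<Delta>" "cross3 (\<gamma>1 u0) g2 \<bullet> h2 = \<Delta>"
    using triple by (simp_all add: \<Delta>_def cross3_def inner_vec_def sum_3 algebra_simps)
  have dual: "x \<bullet> \<gamma>1 u0 = 1" "x \<bullet> g2 = 0" "x \<bullet> h2 = 0" "y \<bullet> \<gamma>1 u0 = 0" "y \<bullet> g2 = 1" "y \<bullet> h2 = 0"
    "z \<bullet> \<gamma>1 u0 = 0" "z \<bullet> g2 = 0" "z \<bullet> h2 = 1"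
    using \<Delta> by (simp_all add: x_def y_def z_def) (simp_all add: cross3_def inner_vec_def sum_3 algebra_simps)
  have \<xi>: "\<xi> \<bullet> \<gamma>1 u0 = 0" "\<xi> \<bullet> g2 = 1" "\<xi> \<bullet> h2 = - c\<^sup>2"
    by (simp_all add: \<xi>_def inner_diff_left dual)
  have expand: "(x \<bullet> d) *\<^sub>R \<gamma>1 u0 + (y \<bullet> d) *\<^sub>R g2 + (z \<bullet> d) *\<^sub>R h2 = d" for d
  proof -
    have "(x \<bullet> d) *\<^sub>R \<gamma>1 u0 + (y \<bullet> d) *\<^sub>R g2 + (z \<bullet> d) *\<^sub>R h2 = (1 / \<Delta>) *\<^sub>R
        ((cross3 g2 h2 \<bullet> d) *\<^sub>R \<gamma>1 u0 + (cross3 h2 (\<gamma>1 u0) \<bullet> d) *\<^sub>R g2 + (cross3 (\<gamma>1 u0) g2 \<bullet> d) *\<^sub>R h2)"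
      by (simp add: x_def y_def z_def scaleR_add_right)
    also have "\<dots> = d" unfolding cross3_dual_basis using \<Delta>(1) by (simp add: \<Delta>_def)
    finally show ?thesis .
  qed
  define f0 where "f0 = \<gamma> u0 + \<delta> v0"
  define \<Phi> where "\<Phi> = (\<lambda>w. vector [x \<bullet> (w - f0), \<xi> \<bullet> (w - f0), z \<bullet> (w - f0)] :: real^3)"
  \<comment> \<open>The inverse of Phi: as xi = y - c^2 z, the coordinate along gamma'' is recovered
    as w2 + c^2 w3.\<close>
  define \<Psi> where "\<Psi> = (\<lambda>w :: real^3. f0 + ((w $ 1) *\<^sub>R \<gamma>1 u0 + (w $ 2 + c\<^sup>2 * (w $ 3)) *\<^sub>R g2 + (w $ 3) *\<^sub>R h2))"
  have \<Phi>: "diffeomorphism_on UNIV UNIV \<Phi>"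
  proof (rule diffeomorphism_onI[where \<psi> = \<Psi>])
    show "smooth_on UNIV \<Phi>"
      unfolding \<Phi>_def
      by (intro smooth_intros open_UNIV smooth_on_linear_compose[OF _ bounded_linear_inner_right])
    show "smooth_on UNIV \<Psi>"
      unfolding \<Psi>_def
      by (intro smooth_intros open_UNIV)
    show "\<Psi> (\<Phi> w) = w" for w
      using expand[of "w - f0"] by (simp add: \<Phi>_def \<Psi>_def \<xi>_def inner_diff_left)
    show "\<Phi> (\<Psi> w) = w" for w
      by (rule vec3_eqI) (simp_all add: \<Phi>_def \<Psi>_def inner_add_right dual \<xi>)
  qed auto
  have o: "open (I \<times> J)" by (intro open_Times I J)
  define L where "L = (\<lambda>\<zeta> p. \<zeta> \<bullet> (\<gamma> (fst p) + \<delta> (snd p) - f0))"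
  have sL: "smooth_on (I \<times> J) (L \<zeta>)" for \<zeta>
    unfolding L_def
    by (intro smooth_on_linear_compose[OF o bounded_linear_inner_right] smooth_intros o smooth_on_compose[OF o I(1) _ I(3)] smooth_on_compose[OF o J(1) _ J(3)])
      auto
  have L1: "partial1 (L \<zeta>) (u, v) = \<zeta> \<bullet> \<gamma>1 u" and L2: "partial2 (L \<zeta>) (u, v) = \<zeta> \<bullet> \<delta>1 v"
    if uv: "(u, v) \<in> I \<times> J" for \<zeta> u v
  proof -
    have "((\<lambda>u. L \<zeta> (u, v)) has_real_derivative \<zeta> \<bullet> (\<gamma>1 u + 0 - 0)) (at u)"
      unfolding L_def fst_conv snd_conv
      by (intro DERIV_inner has_vector_derivative_add has_vector_derivative_diff has_vector_derivative_const \<gamma>1)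
        (use uv in auto)
    then show "partial1 (L \<zeta>) (u, v) = \<zeta> \<bullet> \<gamma>1 u" using DERIV_unique[OF DERIV_partial1[OF sL o uv]] by simp
    have "((\<lambda>v. L \<zeta> (u, v)) has_real_derivative \<zeta> \<bullet> (0 + \<delta>1 v - 0)) (at v)"
      unfolding L_def fst_conv snd_conv
      by (intro DERIV_inner has_vector_derivative_add has_vector_derivative_diff has_vector_derivative_const \<delta>1)
        (use uv in auto)
    then show "partial2 (L \<zeta>) (u, v) = \<zeta> \<bullet> \<delta>1 v" using DERIV_unique[OF DERIV_partial2[OF sL o uv]] by simp
  qed
  have p0: "(u0, v0) \<in> I \<times> J" using I J by simp
  let ?F = "\<lambda>p. (L x p, snd p - v0)"
  let ?D = "\<lambda>h :: real \<times> real. (fst h * partial1 (L x) (u0, v0) + snd h * partial2 (L x) (u0, v0), snd h - 0)"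
  have sF: "smooth_on (I \<times> J) ?F"
    by (intro smooth_intros o sL)
  have DF: "(?F has_derivative ?D) (at (u0, v0))"
    by (rule has_derivative_Pair[OF frechet_derivative_plane[OF sL o p0]
          has_derivative_diff[OF bounded_linear_imp_has_derivative[OF bounded_linear_snd] has_derivative_const]])
  have "fst (?D (1, 0)) * snd (?D (0, 1)) - fst (?D (0, 1)) * snd (?D (1, 0)) \<noteq> 0"
    using L1[OF p0] dual(1) by simp
  then obtain U V where UV: "diffeomorphism_on U V ?F" "(u0, v0) \<in> U" "U \<subseteq> I \<times> J"
    using plane_inverse_function[OF o sF p0 DF] by metis
  obtain \<psi> where V: "open U" "open V" and "smooth_on U ?F" and s\<psi>: "smooth_on V \<psi>"
    and 1: "\<forall>p\<in>U. ?F p \<in> V" and 2: "\<forall>q\<in>V. \<psi> q \<in> U"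
    and 3: "\<forall>p\<in>U. \<psi> (?F p) = p" and 4: "\<forall>q\<in>V. ?F (\<psi> q) = q"
    by (rule diffeomorphism_onE[OF UV(1)])
  define r where "r = (\<lambda>q. fst (\<psi> q))"
  have \<psi>: "\<psi> (a, t) = (r (a, t), v0 + t)" "r (a, t) \<in> I" "v0 + t \<in> J" "L x (r (a, t), v0 + t) = a"
    if "(a, t) \<in> V" for a t
  proof -
    have "L x (\<psi> (a, t)) = a" "snd (\<psi> (a, t)) = v0 + t"
      using arg_cong[OF bspec[OF 4 that], of fst] arg_cong[OF bspec[OF 4 that], of snd] by simp_all
    moreover have "\<psi> (a, t) \<in> I \<times> J" using bspec[OF 2 that] UV(3) by blast
    ultimately show "\<psi> (a, t) = (r (a, t), v0 + t)" "r (a, t) \<in> I" "v0 + t \<in> J" "L x (r (a, t), v0 + t) = a"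
      by (simp_all add: r_def prod_eq_iff mem_Times_iff flip: \<open>snd (\<psi> (a, t)) = v0 + t\<close>)
  qed
  have \<psi>0: "L x (r (a, 0), v0) = a" if "(a, 0) \<in> V" for a
    using \<psi>(4)[OF that] by simp
  have F0: "?F (u0, v0) = (0, 0)" by (simp add: L_def f0_def)
  have V0: "(0, 0) \<in> V" using bspec[OF 1 UV(2)] unfolding F0 .
  have r0: "r (0, 0) = u0" using bspec[OF 3 UV(2)] unfolding F0 by (simp add: r_def)
  have sr: "smooth_on V r" unfolding r_def by (intro smooth_on_fst s\<psi> V)
  note Dr1 = DERIV_partial1[OF sr V(2)] and Dr2 = DERIV_partial2[OF sr V(2)]
  define N where "N = (\<lambda>\<zeta> q. L \<zeta> (\<psi> q))"
  have sN: "smooth_on V (N \<zeta>)" for \<zeta>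
    unfolding N_def by (rule smooth_on_compose[OF V(2) o _ sL s\<psi>]) (use 2 UV(3) in auto)
  have DL: "((\<lambda>s. \<zeta> \<bullet> (\<gamma> (f s) + \<delta> (g s) - f0)) has_real_derivative
      \<zeta> \<bullet> \<gamma>1 (f s) * f' + \<zeta> \<bullet> \<delta>1 (g s) * g') (at s)"
    if "(f has_real_derivative f') (at s)" "(g has_real_derivative g') (at s)" "f s \<in> I" "g s \<in> J"
    for \<zeta> f f' g g' s
  proof -
    have "((\<lambda>s. (\<zeta> \<bullet> \<gamma> (f s) + \<zeta> \<bullet> \<delta> (g s)) - \<zeta> \<bullet> f0) has_real_derivative
      (\<zeta> \<bullet> \<gamma>1 (f s) * f' + \<zeta> \<bullet> \<delta>1 (g s) * g') - 0) (at s)"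
      by (intro DERIV_diff DERIV_add DERIV_const DERIV_chain2[OF DERIV_inner[OF \<gamma>1(1)]]
          DERIV_chain2[OF DERIV_inner[OF \<delta>1(1)]] that)
    then show ?thesis by (simp add: inner_add_right inner_diff_right)
  qed
  \<comment> \<open>Here r(a, t) is the parameter u expressed in the new coordinates.
    Differentiating the identity that the coordinate along x equals a gives the value, because x .
    gamma' = 1.\<close>
  have r1: "partial1 r (0, 0) = 1"
  proof -
    have "((\<lambda>a. N x (a, 0)) has_real_derivative x \<bullet> \<gamma>1 (r (0, 0)) * partial1 r (0, 0) + x \<bullet> \<delta>1 (v0 + 0) * 0) (at 0)"
    proof (rule has_field_derivative_transform_within_open[OF DL[OF Dr1[OF V0] DERIV_const]])
      show "open {a. (a, 0) \<in> V}" by (rule open_slice1[OF V(2)])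
    qed (use V0 \<psi> r0 I J in \<open>auto simp: N_def L_def\<close>)
    moreover have "((\<lambda>a. N x (a, 0)) has_real_derivative 1) (at 0)"
    proof (rule has_field_derivative_transform_within_open[OF DERIV_ident])
      show "open {a. (a, 0) \<in> V}" by (rule open_slice1[OF V(2)])
    qed (use V0 \<psi> \<psi>0 in \<open>auto simp: N_def\<close>)
    ultimately show ?thesis using DERIV_unique r0 dual(1) by fastforce
  qed
  have N2: "partial2 (N \<zeta>) (a, t) = \<zeta> \<bullet> \<gamma>1 (r (a, t)) * partial2 r (a, t) + \<zeta> \<bullet> \<delta>1 (v0 + t)"
    if at: "(a, t) \<in> V" for \<zeta> a t
  proof -
    have "((\<lambda>t. N \<zeta> (a, t)) has_real_derivative \<zeta> \<bullet> \<gamma>1 (r (a, t)) * partial2 r (a, t) + \<zeta> \<bullet> \<delta>1 (v0 + t) * (0 + 1)) (at t)"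
    proof (rule has_field_derivative_transform_within_open[OF DL[OF Dr2[OF at] DERIV_add[OF DERIV_const DERIV_ident]]])
      show "open {t. (a, t) \<in> V}" by (rule open_slice2[OF V(2)])
    qed (use at \<psi> in \<open>auto simp: N_def L_def\<close>)
    then show ?thesis using DERIV_unique[OF DERIV_partial2[OF sN V(2) at]] by simp
  qed
  have Nx: "partial2 (N x) (0, 0) = 0"
  proof -
    have "((\<lambda>t. N x (0, t)) has_real_derivative 0) (at 0)"
    proof (rule has_field_derivative_transform_within_open[OF DERIV_const])
      show "open {t. (0, t) \<in> V}" by (rule open_slice2[OF V(2)])
    qed (use V0 \<psi> in \<open>auto simp: N_def\<close>)
    then show ?thesis using DERIV_unique[OF DERIV_partial2[OF sN V(2) V0]] by simp
  qed
  \<comment> \<open>With a fixed, the coordinate along x does not change, so 0 = r_t + x . delta' =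
    r_t + c.\<close>
  have r2: "partial2 r (0, 0) = - c"
    using N2[OF V0, of x] Nx by (simp add: r0 c dual)
  have sr2: "smooth_on V (partial2 r)" by (rule smooth_on_frechet_derivative[OF sr V(2)])
  \<comment> \<open>Second derivatives of r occur only with the factor zeta . gamma' = 0, so the
    first derivatives 1 and -c of r determine both results.\<close>
  have N0: "partial2 (N \<zeta>) (0, 0) = 0"
    and Nt: "((\<lambda>t. partial2 (N \<zeta>) (0, t)) has_real_derivative c\<^sup>2 * (\<zeta> \<bullet> g2) + \<zeta> \<bullet> h2) (at 0)"
    and Na: "((\<lambda>a. partial2 (N \<zeta>) (a, 0)) has_real_derivative - c * (\<zeta> \<bullet> g2)) (at 0)"
    if \<zeta>: "\<zeta> \<bullet> \<gamma>1 u0 = 0" for \<zeta>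
  proof -
    show "partial2 (N \<zeta>) (0, 0) = 0" using N2[OF V0, of \<zeta>] \<zeta> by (simp add: r0 c)
    have \<gamma>: "((\<lambda>s. \<zeta> \<bullet> \<gamma>1 s) has_real_derivative \<zeta> \<bullet> g2) (at (r (0, 0)))"
      unfolding r0 by (rule DERIV_inner[OF \<gamma>1(2)])
    have \<delta>: "((\<lambda>t. \<zeta> \<bullet> \<delta>1 (v0 + t)) has_real_derivative \<zeta> \<bullet> h2 * (0 + 1)) (at 0)"
      by (rule DERIV_chain2[where f = "\<lambda>s. \<zeta> \<bullet> \<delta>1 s" and g = "\<lambda>t. v0 + t"])
        (use DERIV_inner[OF \<delta>1(2)] in simp, intro DERIV_add DERIV_const DERIV_ident)
    have "((\<lambda>t. \<zeta> \<bullet> \<gamma>1 (r (0, t)) * partial2 r (0, t) + \<zeta> \<bullet> \<delta>1 (v0 + t)) has_real_derivative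
        ((\<zeta> \<bullet> g2 * partial2 r (0, 0)) * partial2 r (0, 0) + partial2 (partial2 r) (0, 0) * (\<zeta> \<bullet> \<gamma>1 (r (0, 0))))
          + \<zeta> \<bullet> h2 * (0 + 1)) (at 0)"
      by (intro DERIV_add[OF DERIV_mult[OF DERIV_chain2[OF \<gamma> Dr2[OF V0]] DERIV_partial2[OF sr2 V(2) V0]]] \<delta>)
    then have "((\<lambda>t. \<zeta> \<bullet> \<gamma>1 (r (0, t)) * partial2 r (0, t) + \<zeta> \<bullet> \<delta>1 (v0 + t)) has_real_derivative
        c\<^sup>2 * (\<zeta> \<bullet> g2) + \<zeta> \<bullet> h2) (at 0)"
      using \<zeta> by (simp add: r0 r2 power2_eq_square mult_ac)
    then show "((\<lambda>t. partial2 (N \<zeta>) (0, t)) has_real_derivative c\<^sup>2 * (\<zeta> \<bullet> g2) + \<zeta> \<bullet> h2) (at 0)"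
    proof (rule has_field_derivative_transform_within_open)
      show "open {t. (0, t) \<in> V}" by (rule open_slice2[OF V(2)])
    qed (use V0 N2 in auto)
    have "((\<lambda>a. \<zeta> \<bullet> \<gamma>1 (r (a, 0)) * partial2 r (a, 0) + \<zeta> \<bullet> \<delta>1 (v0 + 0)) has_real_derivative
        ((\<zeta> \<bullet> g2 * partial1 r (0, 0)) * partial2 r (0, 0) + partial1 (partial2 r) (0, 0) * (\<zeta> \<bullet> \<gamma>1 (r (0, 0)))) + 0) (at 0)"
      by (intro DERIV_add[OF DERIV_mult[OF DERIV_chain2[OF \<gamma> Dr1[OF V0]] DERIV_partial1[OF sr2 V(2) V0]]] DERIV_const)
    then have "((\<lambda>a. \<zeta> \<bullet> \<gamma>1 (r (a, 0)) * partial2 r (a, 0) + \<zeta> \<bullet> \<delta>1 (v0 + 0)) has_real_derivative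
        - c * (\<zeta> \<bullet> g2)) (at 0)"
      using \<zeta> by (simp add: r0 r1 r2 mult_ac)
    then show "((\<lambda>a. partial2 (N \<zeta>) (a, 0)) has_real_derivative - c * (\<zeta> \<bullet> g2)) (at 0)"
    proof (rule has_field_derivative_transform_within_open)
      show "open {a. (a, 0) \<in> V}" by (rule open_slice1[OF V(2)])
    qed (use V0 N2 in auto)
  qed
  have cc: "cross_cap (\<lambda>(a, t). vector [a, N \<xi> (a, t), N z (a, t)]) (0, 0)"
  proof (rule cross_cap_if_corank_one[OF V(2) V0 sN N0 sN N0])
    show "((\<lambda>t. partial2 (N \<xi>) (0, t)) has_real_derivative 0) (at 0)" using Nt[OF \<xi>(1)] by (simp add: \<xi>)
    show "((\<lambda>a. partial2 (N \<xi>) (a, 0)) has_real_derivative - c) (at 0)" using Na[OF \<xi>(1)] by (simp add: \<xi>)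
    show "((\<lambda>t. partial2 (N z) (0, t)) has_real_derivative 1) (at 0)" using Nt[OF dual(7)] by (simp add: dual)
  qed (use c(2) \<xi>(1) dual(7) in auto)
  have "A_equivalent (translation_surface \<gamma> \<delta>) (u0, v0) (\<lambda>p. vector [L x p, L \<xi> p, L z p]) (u0, v0)"
    by (rule A_equivalent_target[OF \<Phi> open_UNIV]) (auto simp: translation_surface_def \<Phi>_def L_def)
  moreover have "A_equivalent (\<lambda>p. vector [L x p, L \<xi> p, L z p] :: real^3) (u0, v0)
      (\<lambda>(a, t). vector [a, N \<xi> (a, t), N z (a, t)]) (0, 0)"
    by (rule A_equivalent_source[OF UV(1,2) F0]) (use 3 in \<open>simp add: N_def\<close>)
  ultimately show ?thesis using cc unfolding cross_cap_def by (blast intro: A_equivalent_trans)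
qed

section \<open>Second derivatives and equivalence\<close>

abbreviation "dderiv h f \<equiv> (\<lambda>x. frechet_derivative f (at x) h)"

lemma frechet_derivative_open_cong:
  assumes "open S" "x \<in> S" "\<And>y. y \<in> S \<Longrightarrow> f y = g y"
  shows "frechet_derivative f (at x) = frechet_derivative g (at x)"
  using frechet_derivative_within_cong[of x S f g, OF assms(2,3)]
  unfolding at_within_open[OF assms(2,1)] .

text \<open>The derivative in direction x of the derivative along y. The vector y is expanded in the
  basis so that the formula remains usable when y varies with the base point, as it does in the
  chain rule.\<close>

definition hessian :: "('a::euclidean_space \<Rightarrow> 'b::euclidean_space) \<Rightarrow> 'a \<Rightarrow> 'a \<Rightarrow> 'a \<Rightarrow> 'b" where
  "hessian \<Phi> z x y = (\<Sum>i\<in>Basis. (y \<bullet> i) *\<^sub>R dderiv x (dderiv i \<Phi>) z)"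

lemma dderiv_compose:
  assumes S: "open S" "smooth_on S f" and W: "open W" "smooth_on W \<Phi>" and fW: "f ` S \<subseteq> W" and p: "p \<in> S"
  shows "dderiv h (\<lambda>p. \<Phi> (f p)) p = dderiv (dderiv h f p) \<Phi> (f p)"
proof -
  have "f p \<in> W" using fW p by blast
  from has_derivative_compose[OF smooth_on_has_derivative[OF S(2,1) p] smooth_on_has_derivative[OF W(2,1) this]]
  show ?thesis by (rule frechet_derivative_at[symmetric, THEN fun_cong])
qed

text \<open>After the basis expansion of the moving direction the product rule gives two terms: the
  Hessian of Phi on the two first derivatives of f, and the first derivative of Phi on the second
  derivative of f.\<close>

lemma dderiv_dderiv_compose:
  assumes S: "open S" "smooth_on S f" and W: "open W" "smooth_on W \<Phi>" and fW: "f ` S \<subseteq> W" and p: "p \<in> S"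
  shows "dderiv k (dderiv h (\<lambda>p. \<Phi> (f p))) p =
    hessian \<Phi> (f p) (dderiv k f p) (dderiv h f p) + dderiv (dderiv k (dderiv h f) p) \<Phi> (f p)"
proof -
  have fp: "f p \<in> W" using fW p by blast
  have expand: "dderiv y \<Phi> z = (\<Sum>i\<in>Basis. (y \<bullet> i) *\<^sub>R dderiv i \<Phi> z)" if "z \<in> W" for y z
  proof -
    interpret linear "frechet_derivative \<Phi> (at z)"
      by (rule has_derivative_linear[OF smooth_on_has_derivative[OF W(2,1) that]])
    have "dderiv (\<Sum>i\<in>Basis. (y \<bullet> i) *\<^sub>R i) \<Phi> z = (\<Sum>i\<in>Basis. (y \<bullet> i) *\<^sub>R dderiv i \<Phi> z)"
      by (simp add: sum scale del: euclidean_representation)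
    then show ?thesis by (simp add: euclidean_representation)
  qed
  have sfh: "smooth_on S (dderiv h f)" by (rule smooth_on_frechet_derivative[OF S(2,1)])
  have 1: "((\<lambda>p. dderiv h f p \<bullet> i) has_derivative (\<lambda>k. dderiv k (dderiv h f) p \<bullet> i)) (at p)" for i
    by (rule bounded_linear.has_derivative[OF bounded_linear_inner_left smooth_on_has_derivative[OF sfh S(1) p]])
  have 2: "((\<lambda>p. dderiv i \<Phi> (f p)) has_derivative (\<lambda>k. dderiv (dderiv k f p) (dderiv i \<Phi>) (f p))) (at p)" for i
    by (rule has_derivative_compose[OF smooth_on_has_derivative[OF S(2,1) p]
          smooth_on_has_derivative[OF smooth_on_frechet_derivative[OF W(2,1)] W(1) fp]])
  have "((\<lambda>p. \<Sum>i\<in>Basis. (dderiv h f p \<bullet> i) *\<^sub>R dderiv i \<Phi> (f p)) has_derivative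
    (\<lambda>k. \<Sum>i\<in>Basis. (dderiv h f p \<bullet> i) *\<^sub>R dderiv (dderiv k f p) (dderiv i \<Phi>) (f p) +
       (dderiv k (dderiv h f) p \<bullet> i) *\<^sub>R dderiv i \<Phi> (f p))) (at p)"
    by (intro has_derivative_sum has_derivative_scaleR 1 2)
  then have "((\<lambda>p. \<Sum>i\<in>Basis. (dderiv h f p \<bullet> i) *\<^sub>R dderiv i \<Phi> (f p)) has_derivative
    (\<lambda>k. hessian \<Phi> (f p) (dderiv k f p) (dderiv h f p) + dderiv (dderiv k (dderiv h f) p) \<Phi> (f p))) (at p)"
    unfolding sum.distrib hessian_def expand[OF fp, of "dderiv _ (dderiv h f) p"] .
  from frechet_derivative_at[OF this]
  have "dderiv k (\<lambda>p. \<Sum>i\<in>Basis. (dderiv h f p \<bullet> i) *\<^sub>R dderiv i \<Phi> (f p)) p =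
    hessian \<Phi> (f p) (dderiv k f p) (dderiv h f p) + dderiv (dderiv k (dderiv h f) p) \<Phi> (f p)"
    by (rule fun_cong[OF sym])
  moreover have "dderiv h (\<lambda>p. \<Phi> (f p)) q = (\<Sum>i\<in>Basis. (dderiv h f q \<bullet> i) *\<^sub>R dderiv i \<Phi> (f q))" if "q \<in> S" for q
    using dderiv_compose[OF S W fW that] expand[of "f q"] that fW by auto
  then have "frechet_derivative (dderiv h (\<lambda>p. \<Phi> (f p))) (at p) =
      frechet_derivative (\<lambda>p. \<Sum>i\<in>Basis. (dderiv h f p \<bullet> i) *\<^sub>R dderiv i \<Phi> (f p)) (at p)"
    by (rule frechet_derivative_open_cong[OF S(1) p])
  ultimately show ?thesis by simp
qed

lemma dderiv_mult:
  fixes a b :: "'a::euclidean_space \<Rightarrow> real"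
  assumes S: "open S" "smooth_on S a" "smooth_on S b" and p: "p \<in> S"
  shows "dderiv h (\<lambda>p. a p * b p) p = dderiv h a p * b p + a p * dderiv h b p"
proof -
  have "((\<lambda>p. a p * b p) has_derivative (\<lambda>h. a p * dderiv h b p + dderiv h a p * b p)) (at p)"
    by (intro has_derivative_mult smooth_on_has_derivative[OF _ S(1) p] S)
  from frechet_derivative_at[OF this, symmetric] show ?thesis by simp
qed

text \<open>At a common zero only the products of first derivatives survive. This evaluates the
  components uv and v^2 of the normal form pulled back by the source diffeomorphism.\<close>

lemma dderiv_dderiv_mult:
  fixes a b :: "'a::euclidean_space \<Rightarrow> real"
  assumes S: "open S" "smooth_on S a" "smooth_on S b" and p: "p \<in> S" "a p = 0" "b p = 0"
  shows "dderiv k (dderiv h (\<lambda>p. a p * b p)) p = dderiv h a p * dderiv k b p + dderiv k a p * dderiv h b p"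
proof -
  note s = smooth_on_frechet_derivative[OF S(2,1), of h] smooth_on_frechet_derivative[OF S(3,1), of h]
  have "((\<lambda>p. dderiv h a p * b p + a p * dderiv h b p) has_derivative
     (\<lambda>k. (dderiv h a p * dderiv k b p + dderiv k (dderiv h a) p * b p) +
       (a p * dderiv k (dderiv h b) p + dderiv k a p * dderiv h b p))) (at p)"
    by (intro has_derivative_add has_derivative_mult smooth_on_has_derivative[OF _ S(1) p(1)] S s)
  from frechet_derivative_at[OF this, symmetric]
  have "dderiv k (\<lambda>p. dderiv h a p * b p + a p * dderiv h b p) p
      = dderiv h a p * dderiv k b p + dderiv k a p * dderiv h b p"
    using p by simp
  moreover have "frechet_derivative (dderiv h (\<lambda>p. a p * b p)) (at p) =
      frechet_derivative (\<lambda>p. dderiv h a p * b p + a p * dderiv h b p) (at p)"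
    by (rule frechet_derivative_open_cong[OF S(1) p(1)]) (rule dderiv_mult[OF S])
  ultimately show ?thesis by simp
qed

lemma dderiv_vec_nth:
  fixes H :: "'a::euclidean_space \<Rightarrow> real^'n"
  assumes S: "open S" "smooth_on S H" and p: "p \<in> S"
  shows "dderiv h H p $ i = dderiv h (\<lambda>p. H p $ i) p"
  by (rule fun_cong[OF frechet_derivative_at[OF bounded_linear.has_derivative[OF bounded_linear_vec_nth
          smooth_on_has_derivative[OF S(2,1) p]]]])

lemma dderiv_dderiv_vec_nth:
  fixes H :: "'a::euclidean_space \<Rightarrow> real^'n"
  assumes S: "open S" "smooth_on S H" and p: "p \<in> S"
  shows "dderiv k (dderiv h H) p $ i = dderiv k (dderiv h (\<lambda>p. H p $ i)) p"
proof -
  have "dderiv k (dderiv h H) p $ i = dderiv k (\<lambda>p. dderiv h H p $ i) p"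
    by (rule dderiv_vec_nth[OF S(1) smooth_on_frechet_derivative[OF S(2,1)] p])
  also have "frechet_derivative (\<lambda>p. dderiv h H p $ i) (at p) = frechet_derivative (dderiv h (\<lambda>p. H p $ i)) (at p)"
    by (rule frechet_derivative_open_cong[OF S(1) p]) (rule dderiv_vec_nth[OF S])
  finally show ?thesis .
qed

lemma diffeomorphism_on_derivative_inj:
  assumes d: "diffeomorphism_on U V \<phi>" and p: "p \<in> U" and h: "dderiv h \<phi> p = 0"
  shows "h = 0"
proof -
  obtain \<psi> where \<psi>: "open U" "open V" "smooth_on U \<phi>" "smooth_on V \<psi>"
    and 1: "\<forall>x\<in>U. \<phi> x \<in> V" and "\<forall>y\<in>V. \<psi> y \<in> U" and 3: "\<forall>x\<in>U. \<psi> (\<phi> x) = x"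
    and "\<forall>y\<in>V. \<phi> (\<psi> y) = y"
    by (rule diffeomorphism_onE[OF d])
  have "dderiv h (\<lambda>x. \<psi> (\<phi> x)) p = dderiv (dderiv h \<phi> p) \<psi> (\<phi> p)"
    by (rule dderiv_compose[OF \<psi>(1,3,2,4) _ p]) (use 1 in blast)
  also have "\<dots> = 0"
    unfolding h by (rule linear_0[OF has_derivative_linear[OF smooth_on_has_derivative[OF \<psi>(4,2)]]]) (use 1 p in blast)
  also have "frechet_derivative (\<lambda>x. \<psi> (\<phi> x)) (at p) = frechet_derivative (\<lambda>x. x) (at p)"
    by (rule frechet_derivative_open_cong[OF \<psi>(1) p]) (use 3 in blast)
  also have "\<dots> = (\<lambda>h. h)" by (rule frechet_derivative_at[symmetric]) (rule has_derivative_ident)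
  finally show ?thesis .
qed

lemma matrix_mult_transpose_rows:
  "vector [A *v x, A *v y, A *v z] = (vector [x, y, z] :: real^3^3) ** transpose (A :: real^3^3)"
proof -
  have "(\<Sum>k\<in>UNIV. A $ i $ k * v $ k) = (\<Sum>k\<in>UNIV. v $ k * A $ i $ k)" for i :: 3 and v :: "real^3"
    by (rule sum.cong) (auto simp: mult.commute)
  then show ?thesis
    unfolding vec_eq_iff forall_3 matrix_matrix_mult_def transpose_def matrix_vector_mult_def vector_3 vec_lambda_beta
    by blast
qed

text \<open>Carries the nonvanishing of the triple product back through the derivative of the target
  diffeomorphism.\<close>

lemma triple_product_linear:
  fixes L :: "real^3 \<Rightarrow> real^3"
  assumes "linear L"
  shows "L x \<bullet> cross3 (L y) (L z) = det (matrix L) * (x \<bullet> cross3 y z)"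
proof -
  have L: "L v = matrix L *v v" for v
    using matrix_works[OF assms[folded linear_matrix_vector_mul_eq]] by (rule sym)
  have "L x \<bullet> cross3 (L y) (L z) = (matrix L *v x) \<bullet> cross3 (matrix L *v y) (matrix L *v z)"
    by (simp only: L[of x] L[of y] L[of z])
  also have "\<dots> = det (vector [x, y, z] :: real^3^3) * det (matrix L)"
    unfolding dot_cross_det matrix_mult_transpose_rows det_mul det_transpose ..
  finally show ?thesis by (simp only: dot_cross_det mult.commute)
qed

text \<open>Compare the 2-jets of Phi o f and of (a, ab, b^2), where (a, b) are the components of
  phi. At first order the images of gamma' and delta' under A = Phi' lie on the first axis. At
  second order f_uv = 0 determines the relevant components of the Hessian B, and the uu and vv
  equations then give those of A gamma'' and A delta''.\<close>

theorem translation_surface_cross_capD: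
  fixes \<gamma> \<delta> \<gamma>1 \<delta>1 :: "real \<Rightarrow> real^3"
  assumes I: "open I" "u0 \<in> I" "smooth_on I \<gamma>" and J: "open J" "v0 \<in> J" "smooth_on J \<delta>"
    and \<gamma>1: "\<And>u. u \<in> I \<Longrightarrow> (\<gamma> has_vector_derivative \<gamma>1 u) (at u)" "(\<gamma>1 has_vector_derivative g2) (at u0)"
    and \<delta>1: "\<And>v. v \<in> J \<Longrightarrow> (\<delta> has_vector_derivative \<delta>1 v) (at v)" "(\<delta>1 has_vector_derivative h2) (at v0)"
    and cc: "cross_cap (translation_surface \<gamma> \<delta>) (u0, v0)"
  obtains c where "\<delta>1 v0 = c *\<^sub>R \<gamma>1 u0" "c \<noteq> 0" "\<gamma>1 u0 \<bullet> cross3 g2 h2 \<noteq> 0"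
proof -
  define p0 where "p0 = (u0, v0)"
  define f where "f = (\<lambda>p :: real \<times> real. \<gamma> (fst p) + \<delta> (snd p))"
  have f: "translation_surface \<gamma> \<delta> = f" by (auto simp: translation_surface_def f_def)
  have o: "open (I \<times> J)" "p0 \<in> I \<times> J" using I J by (auto simp: p0_def intro: open_Times)
  have sf: "smooth_on (I \<times> J) f"
    unfolding f_def
    by (intro smooth_intros o smooth_on_compose[OF o(1) I(1) _ I(3)] smooth_on_compose[OF o(1) J(1) _ J(3)]) auto
  have fs: "(fst has_derivative fst) (at p)" "(snd has_derivative snd) (at p)" for p :: "real \<times> real"
    by (intro bounded_linear_imp_has_derivative bounded_linear_fst bounded_linear_snd)+
  have Df: "dderiv h f p = fst h *\<^sub>R \<gamma>1 (fst p) + snd h *\<^sub>R \<delta>1 (snd p)" if p: "p \<in> I \<times> J" for h p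
  proof -
    have "fst p \<in> I" "snd p \<in> J" using p by auto
    then have "(f has_derivative (\<lambda>h. fst h *\<^sub>R \<gamma>1 (fst p) + snd h *\<^sub>R \<delta>1 (snd p))) (at p)"
      unfolding f_def
      by (intro has_derivative_add has_derivative_compose[OF fs(1) \<gamma>1(1)[unfolded has_vector_derivative_def]]
          has_derivative_compose[OF fs(2) \<delta>1(1)[unfolded has_vector_derivative_def]])
    from frechet_derivative_at[OF this, symmetric] show ?thesis by simp
  qed
  have DDf: "dderiv k (dderiv h f) p0 = fst h *\<^sub>R fst k *\<^sub>R g2 + snd h *\<^sub>R snd k *\<^sub>R h2" for h k
  proof -
    have "((\<lambda>p. fst h *\<^sub>R \<gamma>1 (fst p) + snd h *\<^sub>R \<delta>1 (snd p)) has_derivative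
        (\<lambda>k. fst h *\<^sub>R fst k *\<^sub>R g2 + snd h *\<^sub>R snd k *\<^sub>R h2)) (at p0)"
      by (intro has_derivative_add has_derivative_scaleR_right
          has_derivative_compose[OF fs(1)] has_derivative_compose[OF fs(2)])
        (use \<gamma>1(2) \<delta>1(2) in \<open>simp_all add: p0_def has_vector_derivative_def\<close>)
    from frechet_derivative_at[OF this, symmetric]
    have "dderiv k (\<lambda>p. fst h *\<^sub>R \<gamma>1 (fst p) + snd h *\<^sub>R \<delta>1 (snd p)) p0
      = fst h *\<^sub>R fst k *\<^sub>R g2 + snd h *\<^sub>R snd k *\<^sub>R h2" by simp
    moreover have "frechet_derivative (dderiv h f) (at p0) =
        frechet_derivative (\<lambda>p. fst h *\<^sub>R \<gamma>1 (fst p) + snd h *\<^sub>R \<delta>1 (snd p)) (at p0)"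
      by (rule frechet_derivative_open_cong[OF o]) (rule Df)
    ultimately show ?thesis by simp
  qed
  obtain U V \<phi> W Z \<Phi> where \<phi>: "diffeomorphism_on U V \<phi>" "p0 \<in> U" "\<phi> p0 = (0, 0)"
    and \<Phi>: "diffeomorphism_on W Z \<Phi>" "f p0 \<in> W" "f ` U \<subseteq> W"
    and eq: "\<forall>x\<in>U. \<Phi> (f x) = (\<lambda>(u, v). vector [u, u * v, v\<^sup>2]) (\<phi> x)"
    using cc unfolding cross_cap_def A_equivalent_def f p0_def by blast
  have oU: "open U" "smooth_on U \<phi>" and oW: "open W" "smooth_on W \<Phi>"
    using \<phi>(1) \<Phi>(1) unfolding diffeomorphism_on_def by blast+
  define S where "S = U \<inter> (I \<times> J)"
  have S: "open S" "p0 \<in> S" "S \<subseteq> U" "S \<subseteq> I \<times> J"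
    using oU o \<phi>(2) by (auto simp: S_def)
  have sfS: "smooth_on S f" by (rule smooth_on_subset[OF sf S(4,1)])
  have fS: "f ` S \<subseteq> W" using \<Phi>(3) S(3) by blast
  define a where "a = (\<lambda>p. fst (\<phi> p))"
  define b where "b = (\<lambda>p. snd (\<phi> p))"
  have s\<phi>: "smooth_on S \<phi>" by (rule smooth_on_subset[OF oU(2) S(3,1)])
  have ab: "smooth_on S a" "smooth_on S b" "a p0 = 0" "b p0 = 0"
    unfolding a_def b_def by (intro smooth_intros S s\<phi>)+ (simp_all add: \<phi>(3))
  define H where "H = (\<lambda>p. \<Phi> (f p))"
  have sH: "smooth_on S H" unfolding H_def by (rule smooth_on_compose[OF S(1) oW(1) fS oW(2) sfS])
  have H: "H p $ 1 = a p" "H p $ 2 = a p * b p" "H p $ 3 = b p * b p" if "p \<in> S" for p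
  proof -
    have "H p = (\<lambda>(u, v). vector [u, u * v, v\<^sup>2]) (\<phi> p)" using eq that S(3) unfolding H_def by blast
    then show "H p $ 1 = a p" "H p $ 2 = a p * b p" "H p $ 3 = b p * b p"
      by (simp_all add: case_prod_unfold a_def b_def power2_eq_square)
  qed
  note cong = frechet_derivative_open_cong[OF S(1,2)]
  define A where "A = (\<lambda>k. dderiv k \<Phi> (f p0))"
  define B where "B = hessian \<Phi> (f p0)"
  have A1: "A (dderiv h f p0) $ 1 = dderiv h a p0" "A (dderiv h f p0) $ 2 = 0" "A (dderiv h f p0) $ 3 = 0" for h
  proof -
    have "A (dderiv h f p0) = dderiv h H p0"
      unfolding A_def H_def by (rule dderiv_compose[OF S(1) sfS oW fS S(2), symmetric])
    then have *: "A (dderiv h f p0) $ i = dderiv h (\<lambda>p. H p $ i) p0" for i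
      using dderiv_vec_nth[OF S(1) sH S(2)] by simp
    have "frechet_derivative (\<lambda>p. H p $ 1) (at p0) = frechet_derivative a (at p0)"
      "frechet_derivative (\<lambda>p. H p $ 2) (at p0) = frechet_derivative (\<lambda>p. a p * b p) (at p0)"
      "frechet_derivative (\<lambda>p. H p $ 3) (at p0) = frechet_derivative (\<lambda>p. b p * b p) (at p0)"
      by (rule cong, erule H)+
    then show "A (dderiv h f p0) $ 1 = dderiv h a p0" "A (dderiv h f p0) $ 2 = 0" "A (dderiv h f p0) $ 3 = 0"
      unfolding * by (simp_all add: dderiv_mult[OF S(1) ab(1,2) S(2)] dderiv_mult[OF S(1) ab(2,2) S(2)] ab)
  qed
  have B2: "(B (dderiv k f p0) (dderiv h f p0) + A (dderiv k (dderiv h f) p0)) $ 2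
      = dderiv h a p0 * dderiv k b p0 + dderiv k a p0 * dderiv h b p0"
    and B3: "(B (dderiv k f p0) (dderiv h f p0) + A (dderiv k (dderiv h f) p0)) $ 3
      = dderiv h b p0 * dderiv k b p0 + dderiv k b p0 * dderiv h b p0" for h k
  proof -
    have "B (dderiv k f p0) (dderiv h f p0) + A (dderiv k (dderiv h f) p0) = dderiv k (dderiv h H) p0"
      unfolding A_def B_def H_def by (rule dderiv_dderiv_compose[OF S(1) sfS oW fS S(2), symmetric])
    then have *: "(B (dderiv k f p0) (dderiv h f p0) + A (dderiv k (dderiv h f) p0)) $ i =
        dderiv k (dderiv h (\<lambda>p. H p $ i)) p0" for i
      by (rule trans[OF arg_cong[where f = "\<lambda>w. w $ i"] dderiv_dderiv_vec_nth[OF S(1) sH S(2)]])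
    have "frechet_derivative (dderiv h (\<lambda>p. H p $ 2)) (at p0) = frechet_derivative (dderiv h (\<lambda>p. a p * b p)) (at p0)"
      by (rule cong) (rule fun_cong, rule frechet_derivative_open_cong[OF S(1)], assumption, erule H)
    then show "(B (dderiv k f p0) (dderiv h f p0) + A (dderiv k (dderiv h f) p0)) $ 2
      = dderiv h a p0 * dderiv k b p0 + dderiv k a p0 * dderiv h b p0"
      unfolding * using dderiv_dderiv_mult[OF S(1) ab(1,2) S(2) ab(3,4)] by simp
    have "frechet_derivative (dderiv h (\<lambda>p. H p $ 3)) (at p0) = frechet_derivative (dderiv h (\<lambda>p. b p * b p)) (at p0)"
      by (rule cong) (rule fun_cong, rule frechet_derivative_open_cong[OF S(1)], assumption, erule H)
    then show "(B (dderiv k f p0) (dderiv h f p0) + A (dderiv k (dderiv h f) p0)) $ 3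
      = dderiv h b p0 * dderiv k b p0 + dderiv k b p0 * dderiv h b p0"
      unfolding * using dderiv_dderiv_mult[OF S(1) ab(2,2) S(2) ab(4,4)] by simp
  qed
  define au av bu bv where "au = dderiv (1, 0) a p0" and "av = dderiv (0, 1) a p0"
    and "bu = dderiv (1, 0) b p0" and "bv = dderiv (0, 1) b p0"
  define g1 h1 where "g1 = \<gamma>1 u0" and "h1 = \<delta>1 v0"
  have D1: "dderiv (1, 0) f p0 = g1" "dderiv (0, 1) f p0 = h1"
    using Df[OF o(2)] by (simp_all add: p0_def g1_def h1_def)
  have linA: "linear A"
    unfolding A_def by (rule has_derivative_linear[OF smooth_on_has_derivative[OF oW(2,1) \<Phi>(2)]])
  have injA: "x = 0" if "A x = 0" for x
    using diffeomorphism_on_derivative_inj[OF \<Phi>(1,2)] that unfolding A_def .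
  have det: "au * bv - av * bu \<noteq> 0"
  proof
    assume 0: "au * bv - av * bu = 0"
    have D\<phi>: "dderiv h \<phi> p0 = (fst h * au + snd h * av, fst h * bu + snd h * bv)" for h
    proof -
      have "(\<phi> has_derivative (\<lambda>h. (fst h * au + snd h * av, fst h * bu + snd h * bv))) (at p0)"
        using has_derivative_Pair[OF frechet_derivative_plane[OF ab(1) S(1,2)] frechet_derivative_plane[OF ab(2) S(1,2)]]
        by (simp add: a_def b_def au_def av_def bu_def bv_def)
      from frechet_derivative_at[OF this, symmetric] show ?thesis by simp
    qed
    have inj: "h = 0" if "dderiv h \<phi> p0 = 0" for h
      by (rule diffeomorphism_on_derivative_inj[OF \<phi>(1,2) that])
    \<comment> \<open>If the determinant vanishes, these two vectors lie in the kernel of the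
      derivative of phi. Injectivity then forces au = bu = 0, so that (1, 0) is in the kernel as
      well.\<close>
    have "dderiv (bv, - bu) \<phi> p0 = 0" "dderiv (av, - au) \<phi> p0 = 0"
      unfolding D\<phi> using 0 by (simp_all add: zero_prod_def algebra_simps)
    from this[THEN inj] have "(bv, - bu) = 0" "(av, - au) = 0" .
    then have "au = 0" "bu = 0" by (simp_all add: zero_prod_def)
    then have "dderiv (1, 0) \<phi> p0 = 0" unfolding D\<phi> by (simp add: zero_prod_def)
    then have "(1 :: real, 0 :: real) = 0" by (rule inj)
    then show False by (simp add: zero_prod_def)
  qed
  have Ag1: "A g1 $ 1 = au" "A g1 $ 2 = 0" "A g1 $ 3 = 0"
    using A1[of "(1, 0)"] by (simp_all add: D1 au_def)
  have Ah1: "A h1 $ 1 = av" "A h1 $ 2 = 0" "A h1 $ 3 = 0"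
    using A1[of "(0, 1)"] by (simp_all add: D1 av_def)
  have A0: "A 0 = 0" by (rule linear_0[OF linA])
  \<comment> \<open>As f_uv = 0, the Hessian term stands alone on the left.\<close>
  have uv: "B h1 g1 $ 2 = au * bv + av * bu" "B h1 g1 $ 3 = 2 * bu * bv"
    using B2[of "(0, 1)" "(1, 0)"] B3[of "(0, 1)" "(1, 0)"]
    by (simp_all add: D1 DDf A0 au_def av_def bu_def bv_def)
  have uu: "B g1 g1 $ 2 + A g2 $ 2 = 2 * au * bu" "B g1 g1 $ 3 + A g2 $ 3 = 2 * bu * bu"
    using B2[of "(1, 0)" "(1, 0)"] B3[of "(1, 0)" "(1, 0)"]
    by (simp_all add: D1 DDf au_def bu_def)
  have vv: "B h1 h1 $ 2 + A h2 $ 2 = 2 * av * bv" "B h1 h1 $ 3 + A h2 $ 3 = 2 * bv * bv"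
    using B2[of "(0, 1)" "(0, 1)"] B3[of "(0, 1)" "(0, 1)"]
    by (simp_all add: D1 DDf av_def bv_def)
  have B_left: "B (r *\<^sub>R x) y = r *\<^sub>R B x y" for r x y
  proof -
    have "dderiv (r *\<^sub>R x) (dderiv i \<Phi>) (f p0) = r *\<^sub>R dderiv x (dderiv i \<Phi>) (f p0)" for i
      by (rule linear_scale[OF has_derivative_linear[OF smooth_on_has_derivative[OF
              smooth_on_frechet_derivative[OF oW(2,1)] oW(1) \<Phi>(2)]]])
    then show ?thesis unfolding B_def hessian_def by (simp add: scaleR_sum_right mult.commute)
  qed
  have B_right: "B x (r *\<^sub>R y) = r *\<^sub>R B x y" for r x y
    unfolding B_def hessian_def by (simp add: scaleR_sum_right)
  \<comment> \<open>If au = 0 then A kills gamma', so gamma' = 0 and B h1 g1 = 0. The uv equation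
    then reads av bu = 0, contrary to the Jacobian.\<close>
  have au0: "au \<noteq> 0"
  proof
    assume "au = 0"
    then have "A g1 = 0" using Ag1 by (intro vec3_eqI) simp_all
    then have "g1 = 0" by (rule injA)
    then have "B h1 g1 = 0" using B_right[of h1 0 0] by simp
    then show False using uv(1) det \<open>au = 0\<close> by simp
  qed
  have av0: "av \<noteq> 0"
  proof
    assume "av = 0"
    then have "A h1 = 0" using Ah1 by (intro vec3_eqI) simp_all
    then have "h1 = 0" by (rule injA)
    then have "B h1 g1 = 0" using B_left[of 0 0 g1] by simp
    then show False using uv(1) det \<open>av = 0\<close> by simp
  qed
  \<comment> \<open>Both images under A lie on the first axis, with coordinates au and av, so their
    ratio is the factor between the velocities.\<close>
  define c where "c = av / au"
  have c: "c \<noteq> 0" "av = c * au" using au0 av0 by (simp_all add: c_def)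
  have "A (h1 - c *\<^sub>R g1) = A h1 - c *\<^sub>R A g1" by (simp add: linear_diff[OF linA] linear_scale[OF linA])
  also have "\<dots> = 0" by (rule vec3_eqI) (simp_all add: Ag1 Ah1 c)
  finally have h1: "h1 = c *\<^sub>R g1" using injA by fastforce
  \<comment> \<open>The Jacobian au bv - av bu equals au E, hence E is nonzero.\<close>
  define E where "E = bv - c * bu"
  have E: "E \<noteq> 0" "bv = E + c * bu" using det by (auto simp: E_def c(2) algebra_simps)
  \<comment> \<open>Since h1 = c g1, the uv equation determines B g1 g1, which also occurs in the uu
    and vv equations.\<close>
  have Q: "c * (B g1 g1 $ 2) = au * bv + av * bu" "c * (B g1 g1 $ 3) = 2 * bu * bv"
    using uv unfolding h1 B_left by simp_all
  have R: "B h1 h1 = c *\<^sub>R c *\<^sub>R B g1 g1" unfolding h1 B_left B_right ..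
  have Ag2: "c * A g2 $ 2 = - au * E" "c * A g2 $ 3 = - 2 * bu * E"
  proof -
    have "c * A g2 $ 2 = c * (2 * au * bu) - c * (B g1 g1 $ 2)" unfolding uu(1)[symmetric] by (simp add: distrib_left)
    then show "c * A g2 $ 2 = - au * E" unfolding Q c(2) E(2) by (simp add: algebra_simps)
    have "c * A g2 $ 3 = c * (2 * bu * bu) - c * (B g1 g1 $ 3)" unfolding uu(2)[symmetric] by (simp add: distrib_left)
    then show "c * A g2 $ 3 = - 2 * bu * E" unfolding Q E(2) by (simp add: algebra_simps)
  qed
  have Ah2: "A h2 $ 2 = c * au * E" "A h2 $ 3 = 2 * bv * E"
  proof -
    have "A h2 $ 2 = 2 * av * bv - c * (c * (B g1 g1 $ 2))" using vv(1) unfolding R by simp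
    then show "A h2 $ 2 = c * au * E" unfolding Q c(2) E(2) by (simp add: algebra_simps)
    have "A h2 $ 3 = 2 * bv * bv - c * (c * (B g1 g1 $ 3))" using vv(2) unfolding R by simp
    then show "A h2 $ 3 = 2 * bv * E" unfolding Q E(2) by (simp add: algebra_simps)
  qed
  \<comment> \<open>Only the first component of A g1 is nonzero, so the triple product reduces to a
    2 x 2 determinant; the result is a nonzero multiple of au^2 E^3.\<close>
  have "c * (A g1 \<bullet> cross3 (A g2) (A h2)) = au * ((c * A g2 $ 2) * A h2 $ 3 - (c * A g2 $ 3) * A h2 $ 2)"
    by (simp add: cross3_def inner_vec_def sum_3 Ag1 algebra_simps)
  also have "\<dots> = - 2 * au\<^sup>2 * E ^ 3"
    unfolding Ag2 Ah2 E(2) by (simp add: algebra_simps power2_eq_square power3_eq_cube)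
  finally have "A g1 \<bullet> cross3 (A g2) (A h2) \<noteq> 0" using au0 E(1) by auto
  then have "g1 \<bullet> cross3 g2 h2 \<noteq> 0" unfolding triple_product_linear[OF linA] by auto
  then show thesis using h1 c(1) by (intro that[of c]) (simp_all add: g1_def h1_def)
qed

section \<open>Frames\<close>

lemma smooth_on_vector_derivative:
  fixes f :: "real \<Rightarrow> 'b::euclidean_space"
  assumes "smooth_on S f" "open S"
  shows "smooth_on S (\<lambda>x. vector_derivative f (at x))"
    and "x \<in> S \<Longrightarrow> (f has_vector_derivative vector_derivative f (at x)) (at x)"
proof -
  have *: "(f has_vector_derivative frechet_derivative f (at x) 1) (at x)" if "x \<in> S" for x
  proof -
    have D: "(f has_derivative frechet_derivative f (at x)) (at x)"
      by (rule smooth_on_has_derivative[OF assms that])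
    have "frechet_derivative f (at x) h = h *\<^sub>R frechet_derivative f (at x) 1" for h
      using linear_scale[OF has_derivative_linear[OF D], of h 1] by simp
    then show ?thesis
      unfolding has_vector_derivative_def by (intro has_derivative_eq_rhs[OF D] ext)
  qed
  show "smooth_on S (\<lambda>x. vector_derivative f (at x))"
    by (rule iffD2[OF smooth_on_cong smooth_on_frechet_derivative[OF assms, of 1]])
      (rule vector_derivative_at[OF *])
  show "(f has_vector_derivative vector_derivative f (at x)) (at x)" if "x \<in> S"
    unfolding vector_derivative_at[OF *[OF that]] by (rule *[OF that])
qed

text \<open>For the triple a, b, a x b the cross products of pairs give back the third vector, so
  the dual basis is the basis itself.\<close>

lemma orthonormal_expansion:
  fixes a b d :: "real^3"
  assumes "a \<bullet> a = 1" "b \<bullet> b = 1" "a \<bullet> b = 0"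
  shows "(a \<bullet> d) *\<^sub>R a + (b \<bullet> d) *\<^sub>R b + (cross3 a b \<bullet> d) *\<^sub>R cross3 a b = d"
proof -
  have "cross3 b (cross3 a b) = a" "cross3 (cross3 a b) a = b"
    using assms by (simp_all add: Lagrange cross_triple inner_commute) (simp add: cross_skew[of "cross3 a b"] Lagrange inner_commute)
  then show ?thesis using cross3_dual_basis[of b "cross3 a b" d a] assms(1) by simp
qed

lemma cross3_unit:
  fixes a b :: "real^3"
  assumes "a \<bullet> a = 1" "b \<bullet> b = 1" "a \<bullet> b = 0"
  shows "cross3 a b \<bullet> cross3 a b = 1" "a \<bullet> cross3 a b = 0" "b \<bullet> cross3 a b = 0"
  using assms by (simp_all add: dot_cross dot_cross_self inner_commute)

text \<open>Orthogonality to both normals leaves gamma' = alpha mu. Differentiating gamma' . nu_i =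
  0 gives nu_i . gamma'' = -alpha (nu_i' . mu), which is how m and n enter the triple
  product.\<close>

lemma framed_curve_second_order:
  assumes F: "framed_curve I \<gamma> \<nu>1 \<nu>2" and u0: "u0 \<in> interior I"
    and curv: "framed_curvature I \<gamma> \<nu>1 \<nu>2 u0 = (l, m, n, \<alpha>)"
  defines "\<gamma>1 \<equiv> \<lambda>u. vector_derivative \<gamma> (at u)"
  shows "smooth_on (interior I) \<gamma>"
    and "u \<in> interior I \<Longrightarrow> (\<gamma> has_vector_derivative \<gamma>1 u) (at u)"
    and "(\<gamma>1 has_vector_derivative vector_derivative \<gamma>1 (at u0)) (at u0)"
    and "\<gamma>1 u0 = \<alpha> *\<^sub>R frame_mu \<nu>1 \<nu>2 u0"
    and "\<nu>1 u0 \<bullet> vector_derivative \<gamma>1 (at u0) = - \<alpha> * m"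
    and "\<nu>2 u0 \<bullet> vector_derivative \<gamma>1 (at u0) = - \<alpha> * n"
    and "\<nu>1 u0 \<bullet> \<nu>1 u0 = 1" "\<nu>2 u0 \<bullet> \<nu>2 u0 = 1" "\<nu>1 u0 \<bullet> \<nu>2 u0 = 0"
proof -
  let ?I = "interior I"
  note F' = F[unfolded framed_curve_def]
  have s: "smooth_on ?I \<gamma>" "smooth_on ?I \<nu>1" "smooth_on ?I \<nu>2"
    using F' smooth_on_subset[OF _ interior_subset open_interior] by blast+
  have at: "at u within I = at u" if "u \<in> ?I" for u using at_within_interior[OF that] .
  have uI: "u \<in> I" if "u \<in> ?I" for u using that interior_subset by blast
  show "smooth_on ?I \<gamma>" by (rule s)
  have D: "(\<gamma> has_vector_derivative \<gamma>1 u) (at u)" if "u \<in> ?I" for u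
    unfolding \<gamma>1_def by (rule smooth_on_vector_derivative(2)[OF s(1) open_interior that])
  then show "u \<in> ?I \<Longrightarrow> (\<gamma> has_vector_derivative \<gamma>1 u) (at u)" .
  have s1: "smooth_on ?I \<gamma>1"
    unfolding \<gamma>1_def by (rule smooth_on_vector_derivative(1)[OF s(1) open_interior])
  show D2: "(\<gamma>1 has_vector_derivative vector_derivative \<gamma>1 (at u0)) (at u0)"
    by (rule smooth_on_vector_derivative(2)[OF s1 open_interior u0])
  have orth: "\<gamma>1 u \<bullet> \<nu>1 u = 0" "\<gamma>1 u \<bullet> \<nu>2 u = 0" if "u \<in> ?I" for u
    using F' uI[OF that] at[OF that] unfolding \<gamma>1_def by auto
  have on: "\<nu>1 u0 \<bullet> \<nu>1 u0 = 1" "\<nu>2 u0 \<bullet> \<nu>2 u0 = 1" "\<nu>1 u0 \<bullet> \<nu>2 u0 = 0"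
    using F' uI[OF u0] by (auto simp: Delta_def dot_square_norm)
  then show "\<nu>1 u0 \<bullet> \<nu>1 u0 = 1" "\<nu>2 u0 \<bullet> \<nu>2 u0 = 1" "\<nu>1 u0 \<bullet> \<nu>2 u0 = 0" .
  have c: "m = vector_derivative \<nu>1 (at u0) \<bullet> frame_mu \<nu>1 \<nu>2 u0"
    "n = vector_derivative \<nu>2 (at u0) \<bullet> frame_mu \<nu>1 \<nu>2 u0" "\<alpha> = \<gamma>1 u0 \<bullet> frame_mu \<nu>1 \<nu>2 u0"
    using curv unfolding framed_curvature_def at[OF u0] \<gamma>1_def by auto
  show g1: "\<gamma>1 u0 = \<alpha> *\<^sub>R frame_mu \<nu>1 \<nu>2 u0"
    using orthonormal_expansion[OF on, of "\<gamma>1 u0"] orth[OF u0] unfolding c(3) frame_mu_def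
    by (simp add: inner_commute)
  have *: "\<nu> u0 \<bullet> vector_derivative \<gamma>1 (at u0) = - \<alpha> * (vector_derivative \<nu> (at u0) \<bullet> frame_mu \<nu>1 \<nu>2 u0)"
    if \<nu>: "smooth_on ?I \<nu>" "\<And>u. u \<in> ?I \<Longrightarrow> \<gamma>1 u \<bullet> \<nu> u = 0" for \<nu>
  proof -
    have "((\<lambda>u. \<gamma>1 u \<bullet> \<nu> u) has_vector_derivative
        (\<gamma>1 u0 \<bullet> vector_derivative \<nu> (at u0) + vector_derivative \<gamma>1 (at u0) \<bullet> \<nu> u0)) (at u0)"
      by (rule bounded_bilinear.has_vector_derivative[OF bounded_bilinear_inner D2
            smooth_on_vector_derivative(2)[OF \<nu>(1) open_interior u0]])
    moreover have "((\<lambda>u. \<gamma>1 u \<bullet> \<nu> u) has_vector_derivative 0) (at u0)"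
      by (rule has_vector_derivative_transform_within_open[OF has_vector_derivative_const open_interior u0])
        (simp add: \<nu>(2))
    ultimately have "\<gamma>1 u0 \<bullet> vector_derivative \<nu> (at u0) + vector_derivative \<gamma>1 (at u0) \<bullet> \<nu> u0 = 0"
      by (rule vector_derivative_unique_at)
    then show ?thesis unfolding g1 by (simp add: inner_commute)
  qed
  show "\<nu>1 u0 \<bullet> vector_derivative \<gamma>1 (at u0) = - \<alpha> * m" unfolding c(1) by (rule *[OF s(2) orth(1)])
  show "\<nu>2 u0 \<bullet> vector_derivative \<gamma>1 (at u0) = - \<alpha> * n" unfolding c(2) by (rule *[OF s(3) orth(2)])
qed

text \<open>Pairing the rows of the matrix equation with the orthonormal frame at u isolates the
  entries as inner products.\<close>

lemma frame_matrix_entries: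
  assumes T: "is_frame_matrix I \<nu>1 \<nu>2 J \<nu>1' \<nu>2' T" and "u \<in> I" "v \<in> J"
    and on: "\<nu>1 u \<bullet> \<nu>1 u = 1" "\<nu>2 u \<bullet> \<nu>2 u = 1" "\<nu>1 u \<bullet> \<nu>2 u = 0"
  shows "T u v $ 1 $ 1 = \<nu>1' v \<bullet> \<nu>1 u" "T u v $ 1 $ 2 = \<nu>1' v \<bullet> \<nu>2 u"
    "T u v $ 2 $ 1 = \<nu>2' v \<bullet> \<nu>1 u" "T u v $ 2 $ 2 = \<nu>2' v \<bullet> \<nu>2 u"
    "T u v $ 3 $ 3 = frame_mu \<nu>1' \<nu>2' v \<bullet> frame_mu \<nu>1 \<nu>2 u"
proof -
  have "frame \<nu>1' \<nu>2' v = T u v ** frame \<nu>1 \<nu>2 u"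
    using T assms(2,3) unfolding is_frame_matrix_def by blast
  then have row: "frame \<nu>1' \<nu>2' v $ i =
      T u v $ i $ 1 *\<^sub>R \<nu>1 u + T u v $ i $ 2 *\<^sub>R \<nu>2 u + T u v $ i $ 3 *\<^sub>R frame_mu \<nu>1 \<nu>2 u" for i
    by (simp add: vec_eq_iff matrix_matrix_mult_def sum_3 frame_def)
  note \<mu> = cross3_unit[OF on, folded frame_mu_def]
  have "\<nu>2 u \<bullet> \<nu>1 u = 0" "frame_mu \<nu>1 \<nu>2 u \<bullet> \<nu>1 u = 0" "frame_mu \<nu>1 \<nu>2 u \<bullet> \<nu>2 u = 0"
    using on(3) \<mu> by (simp_all add: inner_commute)
  then have "frame \<nu>1' \<nu>2' v $ i \<bullet> \<nu>1 u = T u v $ i $ 1" "frame \<nu>1' \<nu>2' v $ i \<bullet> \<nu>2 u = T u v $ i $ 2"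
    "frame \<nu>1' \<nu>2' v $ i \<bullet> frame_mu \<nu>1 \<nu>2 u = T u v $ i $ 3" for i
    unfolding row by (simp_all add: inner_add_left on \<mu>)
  from this(1)[of 1] this(2)[of 1] this(1)[of 2] this(2)[of 2] this(3)[of 3]
  show "T u v $ 1 $ 1 = \<nu>1' v \<bullet> \<nu>1 u" "T u v $ 1 $ 2 = \<nu>1' v \<bullet> \<nu>2 u"
    "T u v $ 2 $ 1 = \<nu>2' v \<bullet> \<nu>1 u" "T u v $ 2 $ 2 = \<nu>2' v \<bullet> \<nu>2 u"
    "T u v $ 3 $ 3 = frame_mu \<nu>1' \<nu>2' v \<bullet> frame_mu \<nu>1 \<nu>2 u"
    by (simp_all add: frame_def)
qed

text \<open>When \<open>\<mu>' = \<epsilon> \<mu>\<close> with \<open>\<epsilon> = \<plusminus>1\<close>, the frames differ by a planar orthogonal map of determinant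
  \<open>\<epsilon>\<close>, which turns the triple product into the expression of the theorem.\<close>

lemma frame_triple_product:
  fixes a b a' b' g h :: "real^3"
  assumes ab: "a \<bullet> a = 1" "b \<bullet> b = 1" "a \<bullet> b = 0" and ab': "a' \<bullet> a' = 1" "b' \<bullet> b' = 1" "a' \<bullet> b' = 0"
    and \<epsilon>: "cross3 a' b' = \<epsilon> *\<^sub>R cross3 a b" "\<epsilon> * \<epsilon> = 1"
    and g: "a \<bullet> g = - \<alpha> * m" "b \<bullet> g = - \<alpha> * n" and h: "a' \<bullet> h = - \<beta> * m'" "b' \<bullet> h = - \<beta> * n'"
  shows "cross3 a b \<bullet> cross3 g h = - \<epsilon> * \<alpha> * \<beta> *
    (m * (m' * (b' \<bullet> a) - n' * (a' \<bullet> a)) + n * (m' * (b' \<bullet> b) - n' * (a' \<bullet> b)))"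
proof -
  have b': "b' = \<epsilon> *\<^sub>R cross3 (cross3 a b) a'"
  proof -
    have "b' = cross3 (cross3 a' b') a'"
      using ab' by (simp add: cross_skew[of "cross3 a' b'"] Lagrange)
    then show ?thesis unfolding \<epsilon>(1) by (simp add: cross_mult_left)
  qed
  have "cross3 (cross3 a b) a' \<bullet> a = - (a' \<bullet> b)" "cross3 (cross3 a b) a' \<bullet> b = a' \<bullet> a"
    using ab by (simp_all add: cross_skew[of "cross3 a b"] Lagrange inner_diff_left inner_diff_right inner_commute)
  then have t: "b' \<bullet> a = - \<epsilon> * (a' \<bullet> b)" "b' \<bullet> b = \<epsilon> * (a' \<bullet> a)" by (subst b', simp)+
  have t': "a' \<bullet> a = \<epsilon> * (b' \<bullet> b)" "a' \<bullet> b = - \<epsilon> * (b' \<bullet> a)"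
    unfolding t using \<epsilon>(2) by (simp_all flip: mult.assoc)
  have orth: "cross3 a' b' \<bullet> a = 0" "cross3 a' b' \<bullet> b = 0"
    unfolding \<epsilon>(1) using cross3_unit[OF ab] by (simp_all add: inner_commute)
  have "a \<bullet> h = ((a' \<bullet> a) *\<^sub>R a' + (b' \<bullet> a) *\<^sub>R b' + (cross3 a' b' \<bullet> a) *\<^sub>R cross3 a' b') \<bullet> h"
    unfolding orthonormal_expansion[OF ab'] ..
  then have ah: "a \<bullet> h = - \<beta> * ((a' \<bullet> a) * m' + (b' \<bullet> a) * n')"
    unfolding orth by (simp add: inner_add_left h algebra_simps)
  have "b \<bullet> h = ((a' \<bullet> b) *\<^sub>R a' + (b' \<bullet> b) *\<^sub>R b' + (cross3 a' b' \<bullet> b) *\<^sub>R cross3 a' b') \<bullet> h"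
    unfolding orthonormal_expansion[OF ab'] ..
  then have bh: "b \<bullet> h = - \<beta> * ((a' \<bullet> b) * m' + (b' \<bullet> b) * n')"
    unfolding orth by (simp add: inner_add_left h algebra_simps)
  have "cross3 a b \<bullet> cross3 g h = (a \<bullet> g) * (b \<bullet> h) - (a \<bullet> h) * (b \<bullet> g)" by (rule dot_cross)
  also have "\<dots> = \<alpha> * \<beta> * (m * ((a' \<bullet> b) * m' + (b' \<bullet> b) * n') - n * ((a' \<bullet> a) * m' + (b' \<bullet> a) * n'))"
    unfolding g ah bh by (simp add: algebra_simps)
  also have "\<dots> = \<alpha> * \<beta> * (m * ((- \<epsilon> * (b' \<bullet> a)) * m' + (\<epsilon> * (a' \<bullet> a)) * n') - n * ((\<epsilon> * (b' \<bullet> b)) * m' + (- \<epsilon> * (a' \<bullet> b)) * n'))"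
    by (simp only: t[symmetric] t'[symmetric])
  also have "\<dots> = - \<epsilon> * \<alpha> * \<beta> *
    (m * (m' * (b' \<bullet> a) - n' * (a' \<bullet> a)) + n * (m' * (b' \<bullet> b) - n' * (a' \<bullet> b)))"
    by (simp add: algebra_simps)
  finally show ?thesis .
qed

theorem theorem2p6:
  fixes I J :: "real set"
    and \<gamma> \<nu>1 \<nu>2 \<gamma>' \<nu>1' \<nu>2' :: "real \<Rightarrow> real ^ 3"
    and l m n \<alpha> l' m' n' \<alpha>' :: "real \<Rightarrow> real"
    and T :: "real \<Rightarrow> real \<Rightarrow> real ^ 3 ^ 3"
    and u0 v0 :: real
  assumes "is_interval I" and "is_interval J"
    and "framed_curve I \<gamma> \<nu>1 \<nu>2"
    and "framed_curve J \<gamma>' \<nu>1' \<nu>2'"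
    and "\<And>u. u \<in> I \<Longrightarrow> framed_curvature I \<gamma> \<nu>1 \<nu>2 u = (l u, m u, n u, \<alpha> u)"
    and "\<And>v. v \<in> J \<Longrightarrow> framed_curvature J \<gamma>' \<nu>1' \<nu>2' v = (l' v, m' v, n' v, \<alpha>' v)"
    and "is_frame_matrix I \<nu>1 \<nu>2 J \<nu>1' \<nu>2' T"
    and "u0 \<in> interior I" and "v0 \<in> interior J"
  shows "cross_cap (translation_surface \<gamma> \<gamma>') (u0, v0) \<longleftrightarrow>
    \<alpha> u0 * \<alpha>' v0 \<noteq> 0 \<and>
    \<bar>T u0 v0 $ 3 $ 3\<bar> = 1 \<and>
    m u0 * (m' v0 * T u0 v0 $ 2 $ 1 - n' v0 * T u0 v0 $ 1 $ 1) +
    n u0 * (m' v0 * T u0 v0 $ 2 $ 2 - n' v0 * T u0 v0 $ 1 $ 2) \<noteq> 0"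
proof -
  have uI: "u0 \<in> I" "v0 \<in> J" using assms(8,9) interior_subset by blast+
  let ?\<gamma>1 = "\<lambda>u. vector_derivative \<gamma> (at u)" and ?\<delta>1 = "\<lambda>v. vector_derivative \<gamma>' (at v)"
  define g2 where "g2 = vector_derivative ?\<gamma>1 (at u0)"
  define h2 where "h2 = vector_derivative ?\<delta>1 (at v0)"
  define a b where "a = \<nu>1 u0" and "b = \<nu>2 u0"
  define a' b' where "a' = \<nu>1' v0" and "b' = \<nu>2' v0"
  note g = framed_curve_second_order[OF assms(3,8) assms(5)[OF uI(1)], folded g2_def a_def b_def]
  note h = framed_curve_second_order[OF assms(4,9) assms(6)[OF uI(2)], folded h2_def a'_def b'_def]
  have mu: "frame_mu \<nu>1 \<nu>2 u0 = cross3 a b" "frame_mu \<nu>1' \<nu>2' v0 = cross3 a' b'"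
    by (simp_all add: frame_mu_def a_def b_def a'_def b'_def)
  note t = frame_matrix_entries[OF assms(7) uI g(7-9)[unfolded a_def b_def],
      folded a_def b_def a'_def b'_def, unfolded mu]
  \<comment> \<open>This is t33. For the unit vectors mu and mu' it has absolute value 1 exactly
    when they are parallel.\<close>
  define \<epsilon> where "\<epsilon> = cross3 a' b' \<bullet> cross3 a b"
  have \<mu>: "cross3 a b \<bullet> cross3 a b = 1" and \<mu>': "cross3 a' b' \<bullet> cross3 a' b' = 1"
    by (rule cross3_unit[OF g(7-9)], rule cross3_unit[OF h(7-9)])
  have crit: "cross_cap (translation_surface \<gamma> \<gamma>') (u0, v0) \<longleftrightarrow>
      (\<exists>c. ?\<delta>1 v0 = c *\<^sub>R ?\<gamma>1 u0 \<and> c \<noteq> 0 \<and> ?\<gamma>1 u0 \<bullet> cross3 g2 h2 \<noteq> 0)"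
  proof
    assume "cross_cap (translation_surface \<gamma> \<gamma>') (u0, v0)"
    from translation_surface_cross_capD[OF open_interior assms(8) g(1) open_interior assms(9) h(1) g(2,3) h(2,3) this]
    show "\<exists>c. ?\<delta>1 v0 = c *\<^sub>R ?\<gamma>1 u0 \<and> c \<noteq> 0 \<and> ?\<gamma>1 u0 \<bullet> cross3 g2 h2 \<noteq> 0" by blast
  next
    assume "\<exists>c. ?\<delta>1 v0 = c *\<^sub>R ?\<gamma>1 u0 \<and> c \<noteq> 0 \<and> ?\<gamma>1 u0 \<bullet> cross3 g2 h2 \<noteq> 0"
    then obtain c where "?\<delta>1 v0 = c *\<^sub>R ?\<gamma>1 u0" "c \<noteq> 0" "?\<gamma>1 u0 \<bullet> cross3 g2 h2 \<noteq> 0" by blast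
    from cross_cap_translation_surface[OF open_interior assms(8) g(1) open_interior assms(9) h(1) g(2,3) h(2,3) this]
    show "cross_cap (translation_surface \<gamma> \<gamma>') (u0, v0)" .
  qed
  note g1 = g(4)[unfolded mu] and h1 = h(4)[unfolded mu]
  let ?X = "m u0 * (m' v0 * (b' \<bullet> a) - n' v0 * (a' \<bullet> a)) + n u0 * (m' v0 * (b' \<bullet> b) - n' v0 * (a' \<bullet> b))"
  \<comment> \<open>The first factor alpha comes from gamma' = alpha mu; the second one and alpha'
    come from the normal components of gamma'' and delta''.\<close>
  have triple: "?\<gamma>1 u0 \<bullet> cross3 g2 h2 = \<alpha> u0 * (- \<epsilon> * \<alpha> u0 * \<alpha>' v0 * ?X)"
    if "cross3 a' b' = \<epsilon> *\<^sub>R cross3 a b" "\<epsilon> * \<epsilon> = 1"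
    unfolding g1 inner_scaleR_left frame_triple_product[OF g(7-9) h(7-9) that g(5,6) h(5,6)] ..
  show ?thesis
    unfolding crit t \<epsilon>_def[symmetric]
  proof
    assume "\<exists>c. ?\<delta>1 v0 = c *\<^sub>R ?\<gamma>1 u0 \<and> c \<noteq> 0 \<and> ?\<gamma>1 u0 \<bullet> cross3 g2 h2 \<noteq> 0"
    then obtain c where c: "?\<delta>1 v0 = c *\<^sub>R ?\<gamma>1 u0" "c \<noteq> 0" and 3: "?\<gamma>1 u0 \<bullet> cross3 g2 h2 \<noteq> 0" by blast
    have \<alpha>: "\<alpha> u0 \<noteq> 0" using 3 unfolding g1 by auto
    have eq: "\<alpha>' v0 *\<^sub>R cross3 a' b' = (c * \<alpha> u0) *\<^sub>R cross3 a b" using c(1) unfolding g1 h1 by simp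
    have \<alpha>': "\<alpha>' v0 \<noteq> 0"
    proof
      assume "\<alpha>' v0 = 0"
      then have "cross3 a b = 0" using eq \<alpha> c(2) by simp
      then show False using \<mu> by simp
    qed
    have "cross3 a' b' = (1 / \<alpha>' v0) *\<^sub>R (\<alpha>' v0 *\<^sub>R cross3 a' b')" using \<alpha>' by simp
    also have "\<dots> = (c * \<alpha> u0 / \<alpha>' v0) *\<^sub>R cross3 a b" unfolding eq by simp
    finally have par: "cross3 a' b' = (c * \<alpha> u0 / \<alpha>' v0) *\<^sub>R cross3 a b" .
    \<comment> \<open>Pairing the parallel relation with the unit vector mu identifies the factor
      with epsilon; equality of lengths then gives epsilon^2 = 1.\<close>
    then have "\<epsilon> = c * \<alpha> u0 / \<alpha>' v0" unfolding \<epsilon>_def by (simp add: \<mu>)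
    with par have par': "cross3 a' b' = \<epsilon> *\<^sub>R cross3 a b" by simp
    then have \<epsilon>: "\<epsilon> * \<epsilon> = 1" using \<mu>' by (simp add: \<mu>)
    then have "\<bar>\<epsilon>\<bar> = 1" by (auto simp: square_eq_1_iff)
    then show "\<alpha> u0 * \<alpha>' v0 \<noteq> 0 \<and> \<bar>\<epsilon>\<bar> = 1 \<and> ?X \<noteq> 0"
      using 3 \<alpha> \<alpha>' unfolding triple[OF par' \<epsilon>] by simp
  next
    assume R: "\<alpha> u0 * \<alpha>' v0 \<noteq> 0 \<and> \<bar>\<epsilon>\<bar> = 1 \<and> ?X \<noteq> 0"
    then have \<epsilon>: "\<epsilon> * \<epsilon> = 1" by (metis abs_mult_self_eq mult_1)
    \<comment> \<open>The equality case of Cauchy-Schwarz: the squared length of mu' - epsilon mu is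
      1 - epsilon^2 = 0.\<close>
    have "(cross3 a' b' - \<epsilon> *\<^sub>R cross3 a b) \<bullet> (cross3 a' b' - \<epsilon> *\<^sub>R cross3 a b) = 1 - \<epsilon> * \<epsilon> - \<epsilon> * \<epsilon> + \<epsilon> * \<epsilon>"
      by (simp add: inner_diff_left inner_diff_right \<mu> \<mu>' inner_commute[of "cross3 a b" "cross3 a' b'"]
          flip: \<epsilon>_def)
    then have par: "cross3 a' b' = \<epsilon> *\<^sub>R cross3 a b" using \<epsilon> by simp
    have "?\<delta>1 v0 = (\<alpha>' v0 * \<epsilon> / \<alpha> u0) *\<^sub>R ?\<gamma>1 u0" using R unfolding g1 h1 par by simp
    moreover have "\<alpha>' v0 * \<epsilon> / \<alpha> u0 \<noteq> 0" using R by auto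
    moreover have "?\<gamma>1 u0 \<bullet> cross3 g2 h2 \<noteq> 0" using R unfolding triple[OF par \<epsilon>] by auto
    ultimately show "\<exists>c. ?\<delta>1 v0 = c *\<^sub>R ?\<gamma>1 u0 \<and> c \<noteq> 0 \<and> ?\<gamma>1 u0 \<bullet> cross3 g2 h2 \<noteq> 0" by blast
  qed
qed


end
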